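(* Let $(X,\mathfrak{E})$ be a pre-augmented tree (of an IFS $\{S_i\}_{i=1}^N$ of contractive similitudes) which is hyperbolic and has bounded degree, let $0<\lambda<1$, and let $\{Z_n\}_{n=0}^\infty$ be a $\lambda$-quasi-natural random walk ($\lambda$-QNRW) on $(X,\mathfrak{E})$ with transition probability $P$. Then $P$ is uniformly irreducible, has bounded range, and has spectral radius $r(P)<1$. Hence $\mathcal M=\mathcal M_{\min}$, and the hyperbolic boundary $\partial_HX$ and the Martin boundary $\mathcal M$ are homeomorphic under the canonical mapping. In particular, if the IFS satisfies the open set condition and $(X,\mathfrak E)$ is the augmented tree of the IFS, then $\partial_HX$, $\mathcal M$ and the self-similar set $K$ are all homeomorphic under the canonical mappings.
   Context: IFS and levels. $N\ge2$; $\{S_i\}_{i=1}^N$ are contractive similitudes of $\mathbb R^d$ with ratios $r_i\in(0,1)$, $r=\min_ir_i$; $K$ is the unique nonempty compact set with $K=\bigcup_iS_i(K)$. Open set condition (OSC): there is a nonempty bounded open $U$ with $S_i(U)\subset U$ and $S_i(U)\cap S_j(U)=\emptyset$ for $i\neq j$. For a word $x=i_1\cdots i_k$ over $\{1,\dots,N\}$: $S_x=S_{i_1}\circ\cdots\circ S_{i_k}$, $r_x=r_{i_1}\cdots r_{i_k}$ ($r_\vartheta=1$ for the empty word $\vartheta$). $\mathcal J_0=\{\vartheta\}$, $\mathcal J_n=\{x=i_1\cdots i_k: r_x\le r^n<r_{i_1\cdots i_{k-1}}\}$ for $n\ge1$ (pairwise disjoint), $X=\bigcup_{n\ge0}\mathcal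 J_n$, $|x|=n$ for $x\in\mathcal J_n$. For $x\in\mathcal J_n$, $n\ge1$, the parent $x^-$ is the unique prefix of $x$ in $\mathcal J_{n-1}$. Vertical edges: $\mathfrak E_v=\{(x,y):x=y^-\text{ or }y=x^-\}$. Pre-augmented tree: $(X,\mathfrak E)$ with $\mathfrak E=\mathfrak E_v\cup\mathfrak E_h$, where the set $\mathfrak E_h$ of horizontal edges is a symmetric set of pairs of distinct vertices such that $(x,y)\in\mathfrak E_h$ implies $|x|=|y|$ and either $x^-=y^-$ or $(x^-,y^-)\in\mathfrak E_h$. Write $x\sim y$ for $(x,y)\in\mathfrak E$ and $x\sim_hy$ for $(x,y)\in\mathfrak E_h$. Augmented tree: the case where, for a fixed $\gamma>0$, $\mathfrak E_h=\{(x,y):x\ne y,|x|=|y|,\inf_{\xi,\eta\in K}|S_x(\xi)-S_y(\eta)|\le\gamma r^{|x|}\}$. Bounded degree: $\sup_x\deg(x)<\infty$. $\lambda$-QNRW: Markov chain with $P(x,y)=c(x,y)/m(x)$, $m(x)=\sum_yc(x,y)$, $c$ symmetric and nonnegative, such that for some positive probability weights $\{p_i\}_{i=1}^N$ (with $p_x=p_{i_1}\cdots p_{i_k}$): $c(x,x^-)=p_x\lambda^{-m}$ for $x\in\mathcal J_m$, $m\ge1$; $c(x,y)\asymp c(x,x^-)$ for $x\sim_hy$ (two-sided bounds with positive constants independent of $x,y$ and the level); $c(x,y)=0$ if $x\not\sim y$. This walk is irreducible and transient. Hyperbolicity. With $d$ the graph metric, $(x|y)=\frac12(|x|+|y|-d(x,y))$;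 hyperbolic means there is $\delta\ge0$ with $(x|y)\ge\min\{(x|z),(z|y)\}-\delta$ for all $x,y,z$. For $a>0$ with $e^{\delta a}<\sqrt2$, $\varrho_a(x,y)=e^{-a(x|y)}$ ($x\ne y$), $\varrho_a(x,x)=0$, is equivalent to a metric; $\widehat X_H$ is the completion of $(X,\varrho_a)$, $\partial_HX=\widehat X_H\setminus X$. (Augmented trees are known to be always hyperbolic, and to have bounded degree under the OSC.) Markov chain notions. Bounded range: $\sup\{d(x,y):P(x,y)>0\}<\infty$. Uniformly irreducible: there are $\epsilon>0$, $k_0$ such that for all $x\sim y$ some $k\le k_0$ has $P^k(x,y)\ge\epsilon$. $r(P)=\limsup_n(P^n(x,y))^{1/n}$. $G=\sum_kP^k$, Martin kernel $K(x,y)=G(x,y)/G(\vartheta,y)$; the Martin compactification $\widehat X$ is the minimal compactification of $X$ to which all $K(x,\cdot)$ extend continuously; $\mathcal M=\widehat X\setminus X$. A nonnegative harmonic function $h$ ($Ph=h$) is minimal if $h(\vartheta)=1$ and every nonnegative harmonic $h'\le h$ is a constant multiple of $h$; $\mathcal M_{\min}=\{\xi\in\mathcal M:K(\cdot,\xi)\text{ is minimal}\}$. Canonical mappings. Between $\partial_HX$ and $\mathcal M$: the boundary map of the extension of the identity of $X$ to $\widehat X_H\to\widehat X$. For the augmented tree, $\iota:\partial_HX\to K$, $\{\iota(\xi)\}=\bigcap_nS_{x_n}(K)$ for any geodesic ray $(x_n)$ from $\vartheta$ converging to $\xi$. *)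

theory Defs
  imports "HOL-Analysis.Analysis" "HOL-Library.Sublist"
begin

section \<open>Iterated function systems and the word tree\<close>

text \<open>The maps and ratios are indexed by \<^term>\<open>{1..N}\<close>; words are lists over this set.\<close>

definition similitude_ifs ::
  "nat \<Rightarrow> (nat \<Rightarrow> real) \<Rightarrow> (nat \<Rightarrow> 'a::euclidean_space \<Rightarrow> 'a) \<Rightarrow> bool" where
  "similitude_ifs N \<rho> S \<longleftrightarrow> 2 \<le> N \<and>
     (\<forall>i\<in>{1..N}. 0 < \<rho> i \<and> \<rho> i < 1 \<and> (\<forall>u v. dist (S i u) (S i v) = \<rho> i * dist u v))"

definition is_attractor :: "nat \<Rightarrow> (nat \<Rightarrow> 'a::euclidean_space \<Rightarrow> 'a) \<Rightarrow> 'a set \<Rightarrow> bool" where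
  "is_attractor N S K \<longleftrightarrow> compact K \<and> K \<noteq> {} \<and> K = (\<Union>i\<in>{1..N}. S i ` K)"

definition open_set_condition :: "nat \<Rightarrow> (nat \<Rightarrow> 'a::euclidean_space \<Rightarrow> 'a) \<Rightarrow> bool" where
  "open_set_condition N S \<longleftrightarrow>
     (\<exists>U. open U \<and> bounded U \<and> U \<noteq> {} \<and> (\<forall>i\<in>{1..N}. S i ` U \<subseteq> U) \<and>
          (\<forall>i\<in>{1..N}. \<forall>j\<in>{1..N}. i \<noteq> j \<longrightarrow> S i ` U \<inter> S j ` U = {}))"

definition word_map :: "(nat \<Rightarrow> 'a \<Rightarrow> 'a) \<Rightarrow> nat list \<Rightarrow> 'a \<Rightarrow> 'a" where
  "word_map S x = foldr (\<circ>) (map S x) id"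

text \<open>Used both for the ratios \<open>r_x\<close> and for the weights \<open>p_x\<close>.\<close>

definition word_prod :: "(nat \<Rightarrow> real) \<Rightarrow> nat list \<Rightarrow> real" where
  "word_prod w x = prod_list (map w x)"

definition min_ratio :: "nat \<Rightarrow> (nat \<Rightarrow> real) \<Rightarrow> real" where
  "min_ratio N \<rho> = Min (\<rho> ` {1..N})"

definition word_level_set :: "nat \<Rightarrow> (nat \<Rightarrow> real) \<Rightarrow> nat \<Rightarrow> nat list set" where
  "word_level_set N \<rho> n =
     (if n = 0 then {[]}
      else {x \<in> lists {1..N}. x \<noteq> [] \<and>
              word_prod \<rho> x \<le> min_ratio N \<rho> ^ n \<and> min_ratio N \<rho> ^ n < word_prod \<rho> (butlast x)})"

definition tree_vertices :: "nat \<Rightarrow> (nat \<Rightarrow> real) \<Rightarrow> nat list set" where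
  "tree_vertices N \<rho> = (\<Union>n. word_level_set N \<rho> n)"

definition level :: "nat \<Rightarrow> (nat \<Rightarrow> real) \<Rightarrow> nat list \<Rightarrow> nat" where
  "level N \<rho> x = (THE n. x \<in> word_level_set N \<rho> n)"

text \<open>The parent is meaningful only for vertices other than the root \<^term>\<open>[]\<close>.\<close>

definition parent :: "nat \<Rightarrow> (nat \<Rightarrow> real) \<Rightarrow> nat list \<Rightarrow> nat list" where
  "parent N \<rho> x = (THE u. prefix u x \<and> u \<in> word_level_set N \<rho> (level N \<rho> x - 1))"

definition vertical_edges :: "nat \<Rightarrow> (nat \<Rightarrow> real) \<Rightarrow> (nat list \<times> nat list) set" where
  "vertical_edges N \<rho> =
     {(x, y). x \<in> tree_vertices N \<rho> \<and> y \<in> tree_vertices N \<rho> \<and>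
        (y \<noteq> [] \<and> x = parent N \<rho> y \<or> x \<noteq> [] \<and> y = parent N \<rho> x)}"

text \<open>Here and below, \<open>Eh\<close> is the set of horizontal edges.\<close>

definition tree_edges ::
  "nat \<Rightarrow> (nat \<Rightarrow> real) \<Rightarrow> (nat list \<times> nat list) set \<Rightarrow> (nat list \<times> nat list) set" where
  "tree_edges N \<rho> Eh = vertical_edges N \<rho> \<union> Eh"

definition pre_augmented_tree :: "nat \<Rightarrow> (nat \<Rightarrow> real) \<Rightarrow> (nat list \<times> nat list) set \<Rightarrow> bool" where
  "pre_augmented_tree N \<rho> Eh \<longleftrightarrow>
     Eh \<subseteq> tree_vertices N \<rho> \<times> tree_vertices N \<rho> \<and> sym Eh \<and> irrefl Eh \<and>
     (\<forall>(x, y)\<in>Eh. level N \<rho> x = level N \<rho> y \<and>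
        (parent N \<rho> x = parent N \<rho> y \<or> (parent N \<rho> x, parent N \<rho> y) \<in> Eh))"

definition augmented_edges ::
  "nat \<Rightarrow> (nat \<Rightarrow> real) \<Rightarrow> (nat \<Rightarrow> 'a::euclidean_space \<Rightarrow> 'a) \<Rightarrow> 'a set \<Rightarrow> real
     \<Rightarrow> (nat list \<times> nat list) set" where
  "augmented_edges N \<rho> S K \<gamma> =
     {(x, y). x \<in> tree_vertices N \<rho> \<and> y \<in> tree_vertices N \<rho> \<and> x \<noteq> y \<and>
        level N \<rho> x = level N \<rho> y \<and>
        setdist (word_map S x ` K) (word_map S y ` K) \<le> \<gamma> * min_ratio N \<rho> ^ level N \<rho> x}"


section \<open>Graphs and hyperbolicity\<close>

definition bounded_degree :: "'v set \<Rightarrow> ('v \<times> 'v) set \<Rightarrow> bool" where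
  "bounded_degree V E \<longleftrightarrow> (\<exists>D. \<forall>x\<in>V. finite (E `` {x}) \<and> card (E `` {x}) \<le> D)"

text \<open>Graph metric of a connected graph: \<^term>\<open>(x, y) \<in> E ^^ n\<close> says that there is a walk of
  length \<^term>\<open>n\<close> from \<^term>\<open>x\<close> to \<^term>\<open>y\<close>.\<close>

definition graph_dist :: "('v \<times> 'v) set \<Rightarrow> 'v \<Rightarrow> 'v \<Rightarrow> nat" where
  "graph_dist E x y = (LEAST n. (x, y) \<in> E ^^ n)"

definition gromov_product :: "('v \<times> 'v) set \<Rightarrow> ('v \<Rightarrow> nat) \<Rightarrow> 'v \<Rightarrow> 'v \<Rightarrow> real" where
  "gromov_product E lev x y = (real (lev x) + real (lev y) - real (graph_dist E x y)) / 2"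

definition delta_hyperbolic ::
  "'v set \<Rightarrow> ('v \<times> 'v) set \<Rightarrow> ('v \<Rightarrow> nat) \<Rightarrow> real \<Rightarrow> bool" where
  "delta_hyperbolic V E lev \<delta> \<longleftrightarrow> 0 \<le> \<delta> \<and>
     (\<forall>x\<in>V. \<forall>y\<in>V. \<forall>z\<in>V.
        gromov_product E lev x y \<ge> min (gromov_product E lev x z) (gromov_product E lev z y) - \<delta>)"

definition hyperbolic :: "'v set \<Rightarrow> ('v \<times> 'v) set \<Rightarrow> ('v \<Rightarrow> nat) \<Rightarrow> bool" where
  "hyperbolic V E lev \<longleftrightarrow> (\<exists>\<delta>. delta_hyperbolic V E lev \<delta>)"

definition visual_rho :: "('v \<times> 'v) set \<Rightarrow> ('v \<Rightarrow> nat) \<Rightarrow> real \<Rightarrow> 'v \<Rightarrow> 'v \<Rightarrow> real" where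
  "visual_rho E lev a x y = (if x = y then 0 else exp (- a * gromov_product E lev x y))"

definition admissible_exponent ::
  "'v set \<Rightarrow> ('v \<times> 'v) set \<Rightarrow> ('v \<Rightarrow> nat) \<Rightarrow> real \<Rightarrow> bool" where
  "admissible_exponent V E lev a \<longleftrightarrow>
     0 < a \<and> (\<exists>\<delta>. delta_hyperbolic V E lev \<delta> \<and> exp (\<delta> * a) < sqrt 2)"

text \<open>\<open>visual_rho\<close> need not satisfy the triangle inequality but is bi-Lipschitz equivalent to a
  metric. A completion is a complete metric space \<open>(Y, D)\<close> containing \<open>V\<close> (through \<open>e\<close>) as a dense
  subset on which \<open>D\<close> is equivalent to \<open>visual_rho\<close>. The topology of the pair \<open>(Y, e)\<close> does not
  depend on the choice of \<open>D\<close>.\<close>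

definition hyperbolic_completion ::
  "'v set \<Rightarrow> ('v \<times> 'v) set \<Rightarrow> ('v \<Rightarrow> nat) \<Rightarrow> real \<Rightarrow> 'b set \<Rightarrow> ('b \<Rightarrow> 'b \<Rightarrow> real) \<Rightarrow> ('v \<Rightarrow> 'b) \<Rightarrow> bool"
  where
  "hyperbolic_completion V E lev a Y D e \<longleftrightarrow>
     Metric_space Y D \<and> Metric_space.mcomplete Y D \<and>
     e ` V \<subseteq> Y \<and> Metric_space.mtopology Y D closure_of (e ` V) = Y \<and>
     (\<exists>C>0. \<forall>x\<in>V. \<forall>y\<in>V. visual_rho E lev a x y / C \<le> D (e x) (e y) \<and>
                            D (e x) (e y) \<le> C * visual_rho E lev a x y)"

definition geodesic_ray :: "'v set \<Rightarrow> ('v \<times> 'v) set \<Rightarrow> 'v \<Rightarrow> (nat \<Rightarrow> 'v) \<Rightarrow> bool" where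
  "geodesic_ray V E o\<^sub>0 x \<longleftrightarrow> x 0 = o\<^sub>0 \<and> (\<forall>n. x n \<in> V) \<and>
     (\<forall>m n. m \<le> n \<longrightarrow> graph_dist E (x m) (x n) = n - m)"


section \<open>Markov chains\<close>

primrec nstep :: "'v set \<Rightarrow> ('v \<Rightarrow> 'v \<Rightarrow> real) \<Rightarrow> nat \<Rightarrow> 'v \<Rightarrow> 'v \<Rightarrow> real" where
  "nstep V P 0 = (\<lambda>x y. if x = y then 1 else 0)"
| "nstep V P (Suc n) = (\<lambda>x y. \<Sum>\<^sub>\<infinity>z\<in>V. P x z * nstep V P n z y)"

definition bounded_range :: "'v set \<Rightarrow> ('v \<times> 'v) set \<Rightarrow> ('v \<Rightarrow> 'v \<Rightarrow> real) \<Rightarrow> bool" where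
  "bounded_range V E P \<longleftrightarrow> bdd_above {graph_dist E x y |x y. x \<in> V \<and> y \<in> V \<and> P x y > 0}"

definition uniformly_irreducible :: "'v set \<Rightarrow> ('v \<times> 'v) set \<Rightarrow> ('v \<Rightarrow> 'v \<Rightarrow> real) \<Rightarrow> bool" where
  "uniformly_irreducible V E P \<longleftrightarrow>
     (\<exists>\<epsilon>>0. \<exists>k\<^sub>0. \<forall>(x, y)\<in>E. \<exists>k\<le>k\<^sub>0. nstep V P k x y \<ge> \<epsilon>)"

text \<open>For an irreducible chain the limes superior does not depend on \<^term>\<open>x\<close> and \<^term>\<open>y\<close>;
  the spectral radius is the common value.\<close>

definition has_spectral_radius :: "'v set \<Rightarrow> ('v \<Rightarrow> 'v \<Rightarrow> real) \<Rightarrow> real \<Rightarrow> bool" where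
  "has_spectral_radius V P s \<longleftrightarrow>
     (\<forall>x\<in>V. \<forall>y\<in>V. limsup (\<lambda>n. ereal (root n (nstep V P n x y))) = ereal s)"

definition green :: "'v set \<Rightarrow> ('v \<Rightarrow> 'v \<Rightarrow> real) \<Rightarrow> 'v \<Rightarrow> 'v \<Rightarrow> real" where
  "green V P x y = (\<Sum>k. nstep V P k x y)"

definition martin_kernel :: "'v set \<Rightarrow> ('v \<Rightarrow> 'v \<Rightarrow> real) \<Rightarrow> 'v \<Rightarrow> 'v \<Rightarrow> 'v \<Rightarrow> real" where
  "martin_kernel V P o\<^sub>0 x y = green V P x y / green V P o\<^sub>0 y"

definition nonneg_harmonic :: "'v set \<Rightarrow> ('v \<Rightarrow> 'v \<Rightarrow> real) \<Rightarrow> ('v \<Rightarrow> real) \<Rightarrow> bool" where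
  "nonneg_harmonic V P h \<longleftrightarrow> (\<forall>x\<in>V. 0 \<le> h x \<and> (\<Sum>\<^sub>\<infinity>y\<in>V. P x y * h y) = h x)"

definition minimal_harmonic :: "'v set \<Rightarrow> ('v \<Rightarrow> 'v \<Rightarrow> real) \<Rightarrow> 'v \<Rightarrow> ('v \<Rightarrow> real) \<Rightarrow> bool" where
  "minimal_harmonic V P o\<^sub>0 h \<longleftrightarrow> nonneg_harmonic V P h \<and> h o\<^sub>0 = 1 \<and>
     (\<forall>h'. nonneg_harmonic V P h' \<and> (\<forall>x\<in>V. h' x \<le> h x) \<longrightarrow> (\<exists>t. \<forall>x\<in>V. h' x = t * h x))"


section \<open>Compactifications and boundaries\<close>

text \<open>A (Hausdorff) compactification \<open>(T, e)\<close> of the discrete space \<open>V\<close>.\<close>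

definition compactification :: "'v set \<Rightarrow> 'c topology \<Rightarrow> ('v \<Rightarrow> 'c) \<Rightarrow> bool" where
  "compactification V T e \<longleftrightarrow> compact_space T \<and> Hausdorff_space T \<and>
     embedding_map (discrete_topology V) T e \<and> T closure_of (e ` V) = topspace T"

definition extends_continuously ::
  "'v set \<Rightarrow> 'c topology \<Rightarrow> ('v \<Rightarrow> 'c) \<Rightarrow> ('v \<Rightarrow> real) \<Rightarrow> ('c \<Rightarrow> real) \<Rightarrow> bool" where
  "extends_continuously V T e g f \<longleftrightarrow> continuous_map T euclideanreal f \<and> (\<forall>y\<in>V. f (e y) = g y)"

definition kernel_compactification ::
  "'v set \<Rightarrow> ('v \<Rightarrow> 'v \<Rightarrow> real) \<Rightarrow> 'c topology \<Rightarrow> ('v \<Rightarrow> 'c) \<Rightarrow> bool" where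
  "kernel_compactification V k T e \<longleftrightarrow>
     compactification V T e \<and> (\<forall>x\<in>V. \<exists>f. extends_continuously V T e (k x) f)"

text \<open>The smallest compactification to which all functions \<^term>\<open>k x\<close> extend continuously, in the
  usual order: \<open>(T, e)\<close> lies below \<open>(T', e')\<close> if the identity of \<open>V\<close> extends to a continuous map
  from \<open>T'\<close> to \<open>T\<close>. Comparing only with spaces on the type of \<open>T\<close> is no restriction: everything
  below \<open>T\<close> is a quotient of \<open>T\<close>, so if \<open>T\<close> is any compactification with the extension property,
  the smallest one can be realised on the type of \<open>T\<close>.\<close>

definition martin_compactification ::
  "'v set \<Rightarrow> ('v \<Rightarrow> 'v \<Rightarrow> real) \<Rightarrow> 'c topology \<Rightarrow> ('v \<Rightarrow> 'c) \<Rightarrow> bool" where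
  "martin_compactification V k T e \<longleftrightarrow>
     kernel_compactification V k T e \<and>
     (\<forall>(T' :: 'c topology) e'. kernel_compactification V k T' e' \<longrightarrow>
        (\<exists>q. continuous_map T' T q \<and> (\<forall>x\<in>V. q (e' x) = e x)))"

definition boundary_set :: "'v set \<Rightarrow> 'c topology \<Rightarrow> ('v \<Rightarrow> 'c) \<Rightarrow> 'c set" where
  "boundary_set V T e = topspace T - e ` V"

definition boundary_space :: "'v set \<Rightarrow> 'c topology \<Rightarrow> ('v \<Rightarrow> 'c) \<Rightarrow> 'c topology" where
  "boundary_space V T e = subtopology T (boundary_set V T e)"

text \<open>The value at \<^term>\<open>\<xi>\<close> of the (unique) continuous extension of \<^term>\<open>k x\<close>.\<close>

definition extended_kernel ::
  "'v set \<Rightarrow> ('v \<Rightarrow> 'v \<Rightarrow> real) \<Rightarrow> 'c topology \<Rightarrow> ('v \<Rightarrow> 'c) \<Rightarrow> 'v \<Rightarrow> 'c \<Rightarrow> real" where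
  "extended_kernel V k T e x \<xi> = (THE t. \<exists>f. extends_continuously V T e (k x) f \<and> t = f \<xi>)"

definition minimal_martin_boundary ::
  "'v set \<Rightarrow> ('v \<Rightarrow> 'v \<Rightarrow> real) \<Rightarrow> 'v \<Rightarrow> 'c topology \<Rightarrow> ('v \<Rightarrow> 'c) \<Rightarrow> 'c set" where
  "minimal_martin_boundary V P o\<^sub>0 T e =
     {\<xi> \<in> boundary_set V T e.
        minimal_harmonic V P o\<^sub>0 (\<lambda>x. extended_kernel V (martin_kernel V P o\<^sub>0) T e x \<xi>)}"

text \<open>\<open>\<phi>\<close> extends the identity of \<open>V\<close> continuously to \<open>T\<^sub>1 \<rightarrow> T\<^sub>2\<close>, and is a homeomorphism between the
  boundaries. By density of \<open>V\<close>, such an extension is unique if \<open>T\<^sub>2\<close> is Hausdorff.\<close>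

definition canonical_boundary_homeomorphism ::
  "'v set \<Rightarrow> 'b topology \<Rightarrow> ('v \<Rightarrow> 'b) \<Rightarrow> 'c topology \<Rightarrow> ('v \<Rightarrow> 'c) \<Rightarrow> ('b \<Rightarrow> 'c) \<Rightarrow> bool" where
  "canonical_boundary_homeomorphism V T\<^sub>1 e\<^sub>1 T\<^sub>2 e\<^sub>2 \<phi> \<longleftrightarrow>
     continuous_map T\<^sub>1 T\<^sub>2 \<phi> \<and> (\<forall>x\<in>V. \<phi> (e\<^sub>1 x) = e\<^sub>2 x) \<and>
     homeomorphic_map (boundary_space V T\<^sub>1 e\<^sub>1) (boundary_space V T\<^sub>2 e\<^sub>2) \<phi>"

text \<open>The canonical map from the hyperbolic boundary to \<open>K\<close>; \<open>(T, e)\<close> is the completed tree. The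
  first conjunct (every boundary point is the limit of a ray) makes \<open>\<iota>\<close> unique on the boundary.\<close>

definition canonical_attractor_map ::
  "nat list set \<Rightarrow> (nat list \<times> nat list) set \<Rightarrow> (nat \<Rightarrow> 'a \<Rightarrow> 'a) \<Rightarrow> 'a set
     \<Rightarrow> 'b topology \<Rightarrow> (nat list \<Rightarrow> 'b) \<Rightarrow> ('b \<Rightarrow> 'a) \<Rightarrow> bool" where
  "canonical_attractor_map V E S K T e \<iota> \<longleftrightarrow>
     (\<forall>\<xi>\<in>boundary_set V T e.
        (\<exists>x. geodesic_ray V E [] x \<and> limitin T (\<lambda>n. e (x n)) \<xi> sequentially) \<and>
        (\<forall>x. geodesic_ray V E [] x \<and> limitin T (\<lambda>n. e (x n)) \<xi> sequentially \<longrightarrow>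
             (\<Inter>n. word_map S (x n) ` K) = {\<iota> \<xi>}))"


section \<open>Quasi-natural random walks\<close>

text \<open>\<open>c\<close> are the conductances and \<open>p\<close> the probability weights. All level sets are finite, so the
  infinite sum defining the total conductance has only finitely many nonzero terms.\<close>

definition quasi_natural_walk ::
  "nat \<Rightarrow> (nat \<Rightarrow> real) \<Rightarrow> (nat list \<times> nat list) set \<Rightarrow> real \<Rightarrow> (nat list \<Rightarrow> nat list \<Rightarrow> real) \<Rightarrow> bool"
  where
  "quasi_natural_walk N \<rho> Eh lam P \<longleftrightarrow>
     (\<exists>c p. let V = tree_vertices N \<rho> in
        (\<forall>x\<in>V. \<forall>y\<in>V. P x y = c x y / (\<Sum>\<^sub>\<infinity>z\<in>V. c x z)) \<and>
        (\<forall>x\<in>V. \<forall>y\<in>V. c x y = c y x \<and> 0 \<le> c x y) \<and>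
        (\<forall>i\<in>{1..N}. 0 < p i) \<and> (\<Sum>i=1..N. p i) = 1 \<and>
        (\<forall>m\<ge>1. \<forall>x\<in>word_level_set N \<rho> m. c x (parent N \<rho> x) = word_prod p x * (1 / lam) ^ m) \<and>
        (\<exists>A>0. \<exists>B>0. \<forall>(x, y)\<in>Eh.
            A * c x (parent N \<rho> x) \<le> c x y \<and> c x y \<le> B * c x (parent N \<rho> x)) \<and>
        (\<forall>x\<in>V. \<forall>y\<in>V. (x, y) \<notin> tree_edges N \<rho> Eh \<longrightarrow> c x y = 0))"

end

theory Submission
  imports Defs "HOL-Library.Diagonal_Subsequence"
begin

text \<open>
  The children of a vertex carry \<open>1/\<lambda>\<close> times the conductance of the edge to its parent. This drift
  away from the root makes \<open>h(x) = \<surd>\<lambda>\<close> to the power \<open>|x|\<close> satisfy \<open>P h \<le> \<theta> h\<close> with \<open>\<theta> < 1\<close>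
  (\<open>walk_transient\<close>). Hence \<open>P\<^sup>n(x,y) \<le> \<theta>\<^sup>n h(x)/h(y)\<close>, which bounds the spectral radius, and the
  Green function \<open>Gt\<close> of \<open>t P\<close> is finite for some \<open>t > 1\<close>. The analysis of the
  Martin boundary uses nothing else about the walk, apart from reversibility and a lower bound for
  \<open>P\<close> along edges.

  Since \<open>t > 1\<close>, a subharmonic function that is bounded by a multiple of \<open>Gt(\<cdot>, y)\<close> is not
  positive anywhere: it lies below \<open>t\<^sup>-\<^sup>k\<close> times that multiple for all \<open>k\<close>. This domination principle
  takes the place of hitting distributions: a bound for a Green function that holds on the
  boundary of a set spreads over the set. With it, Ancona's inequality \<open>G(x,s) \<le> C G(x,w) G(w,s)\<close>
  for \<open>w\<close> close to a geodesic from \<open>x\<close> to \<open>s\<close> follows by induction along the geodesic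
  (\<open>ancona_half\<close>, \<open>ancona\<close>). In a hyperbolic graph, vertices with different projections to the
  geodesic are far from each other if they are far from the geodesic, and every unit of distance
  gains a factor \<open>t\<close>; this outweighs the Harnack constants that are lost when \<open>w\<close> moves on.

  Let vertices \<open>z\<^sub>n\<close> converge to a point of the hyperbolic boundary, and let \<open>f\<close> be a pointwise limit
  of their Martin kernels. By Ancona's inequality, \<open>f(x)\<close> is comparable to \<open>G(x,v) f(v)\<close> for vertices
  \<open>v\<close> on the way to the boundary point. The same holds for every harmonic \<open>w \<le> C f\<close>, since \<open>w\<close>
  is on each ball a finite sum of Green functions (\<open>finite_balayage\<close>, \<open>harmonic_le_gate\<close>). So all
  these functions are comparable with one constant, and then they are proportional
  (\<open>harmonic_proportional\<close>). It follows that \<open>f\<close> is minimal, and that it is the only limit, so that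
  the Martin kernels extend continuously to the hyperbolic compactification. They separate its
  boundary points: a common limit at two points would be bounded by Green functions and thus vanish.

  The Martin compactification is the smallest one to which the kernels extend, which forces them to
  separate its boundary points as well (\<open>martin_compactification_separates\<close>). Hence the kernels
  embed both compactifications into the same product space. Both images are the closure of the
  image of the tree, so the compactifications are homeomorphic.

  In the augmented tree, \<open>r\<close> to the power \<open>(x|y)\<close> is comparable to
  \<open>r\<^sup>|\<^sup>x\<^sup>| + r\<^sup>|\<^sup>y\<^sup>| + |S\<^sub>x \<kappa> - S\<^sub>y \<kappa>|\<close> for a fixed \<open>\<kappa> \<in> K\<close> (\<open>cell_dist_le\<close>, \<open>scale_gp_le\<close>). The triangle
  inequality for this expression is hyperbolicity. At the boundary it compares the visual metric
  with a power of the Euclidean distance on \<open>K\<close>, so that \<open>\<iota>\<close> is a homeomorphism. Bounded degree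
  is a packing argument that uses the open set condition.
\<close>

section \<open>Graphs with a level function\<close>

locale level_graph =
  fixes V :: "'v set" and E :: "('v \<times> 'v) set" and lev :: "'v \<Rightarrow> nat" and o\<^sub>0 :: 'v
  assumes E_subset: "E \<subseteq> V \<times> V"
    and E_sym: "sym E"
    and base_in: "o\<^sub>0 \<in> V"
    and lev_eq_0_iff: "x \<in> V \<Longrightarrow> lev x = 0 \<longleftrightarrow> x = o\<^sub>0"
    and lev_edge: "(x, y) \<in> E \<Longrightarrow> lev x \<le> Suc (lev y)"
    and lev_pred: "x \<in> V \<Longrightarrow> x \<noteq> o\<^sub>0 \<Longrightarrow> \<exists>y. (x, y) \<in> E \<and> Suc (lev y) = lev x"
    and finite_lev: "finite {x \<in> V. lev x = n}"
begin

abbreviation gd :: "'v \<Rightarrow> 'v \<Rightarrow> nat" where "gd \<equiv> graph_dist E"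
abbreviation gp :: "'v \<Rightarrow> 'v \<Rightarrow> real" where "gp \<equiv> gromov_product E lev"

lemma lev_base [simp]: "lev o\<^sub>0 = 0"
  using base_in lev_eq_0_iff by blast

lemma edge_sym: "(x, y) \<in> E \<Longrightarrow> (y, x) \<in> E"
  using E_sym by (auto dest: symD)

lemma edge_in: "(x, y) \<in> E \<Longrightarrow> x \<in> V" "(x, y) \<in> E \<Longrightarrow> y \<in> V"
  using E_subset by auto

lemma walk_in: "(x, y) \<in> E ^^ n \<Longrightarrow> x \<in> V \<Longrightarrow> y \<in> V"
  by (cases n) (auto dest: edge_in)

lemma walk_sym: "(x, y) \<in> E ^^ n \<Longrightarrow> (y, x) \<in> E ^^ n"
proof (induction n arbitrary: y)
  case (Suc n)
  then obtain z where "(x, z) \<in> E ^^ n" "(z, y) \<in> E" by auto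
  with Suc.IH have "(z, x) \<in> E ^^ n" "(y, z) \<in> E" by (auto intro: edge_sym)
  then show ?case by (rule relpow_Suc_I2[rotated])
qed auto

lemma walk_to_level:
  assumes "x \<in> V" "l \<le> lev x"
  shows "\<exists>w\<in>V. lev w = l \<and> (x, w) \<in> E ^^ (lev x - l)"
  using assms
proof (induction "lev x - l" arbitrary: x)
  case 0
  then show ?case by auto
next
  case (Suc n)
  then have "x \<noteq> o\<^sub>0" by auto
  with Suc.prems obtain y where y: "(x, y) \<in> E" "Suc (lev y) = lev x" using lev_pred by blast
  from Suc.hyps y have n: "n = lev y - l" "l \<le> lev y" by auto
  obtain w where "w \<in> V" "lev w = l" "(y, w) \<in> E ^^ (lev y - l)"
    using Suc.hyps(1)[OF n(1) _ n(2)] edge_in y by blast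
  moreover have "lev x - l = Suc (lev y - l)" using y n Suc.hyps by auto
  ultimately show ?case using y by (metis relpow_Suc_I2)
qed

lemma walk_exists:
  assumes "x \<in> V" "y \<in> V"
  shows "\<exists>n. (x, y) \<in> E ^^ n"
proof -
  have *: "(z, o\<^sub>0) \<in> E ^^ lev z" if "z \<in> V" for z
    using walk_to_level[OF that, of 0] lev_eq_0_iff by auto
  show ?thesis
    using relpow_trans[OF *[OF assms(1)] walk_sym[OF *[OF assms(2)]]] by blast
qed

lemma graph_dist_walk: "x \<in> V \<Longrightarrow> y \<in> V \<Longrightarrow> (x, y) \<in> E ^^ gd x y"
  unfolding graph_dist_def using walk_exists by (rule LeastI_ex)

lemma graph_dist_le: "(x, y) \<in> E ^^ n \<Longrightarrow> gd x y \<le> n"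
  unfolding graph_dist_def by (rule Least_le)

lemma gd_self [simp]: "gd x x = 0"
  using graph_dist_le[of x x 0] by simp

lemma gd_sym: "x \<in> V \<Longrightarrow> y \<in> V \<Longrightarrow> gd x y = gd y x"
  by (meson graph_dist_le graph_dist_walk le_antisym walk_sym)

lemma gd_triangle:
  assumes "x \<in> V" "y \<in> V" "z \<in> V"
  shows "gd x z \<le> gd x y + gd y z"
  by (rule graph_dist_le) (meson assms graph_dist_walk relpow_trans)

lemma gd_triangle_real:
  "x \<in> V \<Longrightarrow> y \<in> V \<Longrightarrow> z \<in> V \<Longrightarrow> real (gd x z) \<le> real (gd x y) + real (gd y z)"
  using gd_triangle[of x y z] by linarith

lemma gd_edge: "(x, y) \<in> E \<Longrightarrow> gd x y \<le> 1"
  by (rule graph_dist_le) auto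

lemma gd_eq_1: "x \<in> V \<Longrightarrow> y \<in> V \<Longrightarrow> gd x y = 1 \<Longrightarrow> (x, y) \<in> E"
  using graph_dist_walk[of x y] by auto

lemma lev_walk: "(x, y) \<in> E ^^ n \<Longrightarrow> lev x \<le> lev y + n"
proof (induction n arbitrary: y)
  case (Suc n)
  then obtain z where z: "(x, z) \<in> E ^^ n" "(z, y) \<in> E" by auto
  then show ?case using Suc.IH[OF z(1)] lev_edge[OF z(2)] by auto
qed auto

lemma lev_gd: "x \<in> V \<Longrightarrow> y \<in> V \<Longrightarrow> lev x \<le> lev y + gd x y"
  by (rule lev_walk[OF graph_dist_walk])

lemma gd_base:
  assumes "x \<in> V"
  shows "gd o\<^sub>0 x = lev x"
proof -
  obtain w where w: "w \<in> V" "lev w = 0" "(x, w) \<in> E ^^ (lev x - 0)"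
    using walk_to_level[OF assms, of 0] by auto
  then have "w = o\<^sub>0" using lev_eq_0_iff by auto
  with w have "gd o\<^sub>0 x \<le> lev x" by (auto intro: graph_dist_le walk_sym)
  moreover have "lev x \<le> gd o\<^sub>0 x"
    using lev_gd[OF assms base_in] gd_sym[OF assms base_in] by auto
  ultimately show ?thesis by simp
qed

lemma ancestor_exists:
  assumes "x \<in> V" "l \<le> lev x"
  obtains w where "w \<in> V" "lev w = l" "gd w x = lev x - l"
proof -
  obtain w where w: "w \<in> V" "lev w = l" "(x, w) \<in> E ^^ (lev x - l)"
    using walk_to_level[OF assms] by auto
  have "gd w x \<le> lev x - l" using w by (auto intro: graph_dist_le walk_sym)
  moreover have "lev x \<le> l + gd w x" using lev_gd[of x w] w assms gd_sym[of x w] by auto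
  ultimately show ?thesis using that[OF w(1,2)] by linarith
qed

lemma geodesic_point:
  assumes "x \<in> V" "y \<in> V" "j \<le> gd x y"
  obtains w where "w \<in> V" "gd x w = j" "gd w y = gd x y - j"
proof -
  have "(x, y) \<in> E ^^ (j + (gd x y - j))" using graph_dist_walk assms by simp
  then obtain w where w: "(x, w) \<in> E ^^ j" "(w, y) \<in> E ^^ (gd x y - j)"
    by (auto simp: relpow_add)
  then have "w \<in> V" using walk_in assms by blast
  moreover have "gd x w \<le> j" "gd w y \<le> gd x y - j" using w graph_dist_le by auto
  moreover have "gd x y \<le> gd x w + gd w y" using gd_triangle calculation(1) assms by blast
  ultimately show ?thesis using that[of w] assms(3) by linarith
qed

lemma finite_ball: "finite {x \<in> V. lev x \<le> n}"
proof -
  have "{x \<in> V. lev x \<le> n} = (\<Union>k\<le>n. {x \<in> V. lev x = k})" by auto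
  then show ?thesis using finite_lev by simp
qed

lemma finite_nb: "finite (E `` {x})"
proof (rule finite_subset[OF _ finite_ball[of "Suc (lev x)"]])
  show "E `` {x} \<subseteq> {y \<in> V. lev y \<le> Suc (lev x)}"
    using edge_in edge_sym lev_edge by blast
qed

lemma gp_sym: "x \<in> V \<Longrightarrow> y \<in> V \<Longrightarrow> gp x y = gp y x"
  unfolding gromov_product_def using gd_sym by simp

lemma gp_self [simp]: "gp x x = lev x"
  unfolding gromov_product_def by simp

lemma gp_le_lev:
  assumes "x \<in> V" "y \<in> V"
  shows "gp x y \<le> lev x" "gp x y \<le> lev y"
  using lev_gd[OF assms] lev_gd[OF assms(2,1)] gd_sym[OF assms]
  by (simp_all add: gromov_product_def)

lemma gp_nonneg:
  assumes "x \<in> V" "y \<in> V"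
  shows "0 \<le> gp x y"
  using gd_triangle[OF assms(1) base_in assms(2)] gd_sym[OF assms(1) base_in]
    gd_base[OF assms(1)] gd_base[OF assms(2)]
  unfolding gromov_product_def by simp

lemma gp_ancestor:
  assumes "l \<le> lev x" "lev w = l" "gd w x = lev x - l"
  shows "gp w x = l"
  using assms unfolding gromov_product_def by simp

end

text \<open>The constant is an integer, so that it can serve as an exponent in Harnack inequalities.\<close>

locale hyperbolic_graph = level_graph V E lev o\<^sub>0
  for V :: "'v set" and E :: "('v \<times> 'v) set" and lev :: "'v \<Rightarrow> nat" and o\<^sub>0 :: 'v +
  fixes \<delta> :: nat
  assumes hyperbolic_ineq:
    "x \<in> V \<Longrightarrow> y \<in> V \<Longrightarrow> z \<in> V \<Longrightarrow> min (gp x z) (gp z y) - real \<delta> \<le> gp x y"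
begin

text \<open>Hyperbolicity is assumed for products based at the root only; the four-point inequality is
  its base-free form. If \<open>(x|z)\<close> is the largest of the four products on the right, then
  \<open>(x|y)\<close> and \<open>(z|w)\<close> are bounded below by \<open>(z|y)\<close> and \<open>(x|w)\<close> up to \<open>\<delta>\<close>.\<close>

lemma four_point:
  assumes "x \<in> V" "y \<in> V" "z \<in> V" "w \<in> V"
  shows "real (gd x y) + gd z w \<le> max (real (gd x z) + gd y w) (real (gd x w) + gd y z) + 4 * \<delta>"
proof -
  have "min (gp x z) (gp y z) - \<delta> \<le> gp x y" "min (gp x w) (gp y w) - \<delta> \<le> gp x y"
    "min (gp x z) (gp x w) - \<delta> \<le> gp z w" "min (gp y z) (gp y w) - \<delta> \<le> gp z w"
    using hyperbolic_ineq[of x y z] hyperbolic_ineq[of x y w] hyperbolic_ineq[of z w x]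
      hyperbolic_ineq[of z w y] assms gp_sym[of y z] gp_sym[of y w] gp_sym[of x z] by auto
  then have "gp x y + gp z w \<ge> min (gp x z + gp y w) (gp x w + gp y z) - 2 * \<delta>" by linarith
  then show ?thesis unfolding gromov_product_def by (simp add: min_def max_def field_simps split: if_splits)
qed

text \<open>For fixed endpoints \<open>x\<close>, \<open>s\<close> these are coordinates along and transversal to a geodesic from
  \<open>x\<close> to \<open>s\<close>: \<open>proj\<close> is where a vertex projects to, and \<open>offset\<close> is its distance from the
  geodesic, up to a bounded error.\<close>

definition proj :: "'v \<Rightarrow> 'v \<Rightarrow> 'v \<Rightarrow> real" where
  "proj x s b = (real (gd b x) + gd x s - gd b s) / 2"

definition offset :: "'v \<Rightarrow> 'v \<Rightarrow> 'v \<Rightarrow> real" where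
  "offset x s b = (real (gd b x) + gd b s - gd x s) / 2"

lemma offset_nonneg: "x \<in> V \<Longrightarrow> s \<in> V \<Longrightarrow> b \<in> V \<Longrightarrow> 0 \<le> offset x s b"
  using gd_triangle[of x b s] gd_sym[of x b] unfolding offset_def by simp

lemma proj_edge:
  assumes "x \<in> V" "s \<in> V" "(b, b') \<in> E"
  shows "\<bar>proj x s b - proj x s b'\<bar> \<le> 1"
proof -
  have b: "b \<in> V" "b' \<in> V" using assms edge_in by auto
  have "real (gd b b') \<le> 1" "real (gd b' b) \<le> 1" using assms gd_edge edge_sym by auto
  then show ?thesis
    using gd_triangle_real[OF b assms(1)] gd_triangle_real[OF b assms(2)]
      gd_triangle_real[OF b(2,1) assms(1)] gd_triangle_real[OF b(2,1) assms(2)]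
    unfolding proj_def by (simp add: abs_le_iff field_simps)
qed

lemma gd_geodesic_point_le:
  assumes "x \<in> V" "s \<in> V" "b \<in> V" "w \<in> V" "gd x w + gd w s = gd x s"
  shows "real (gd b w) \<le> offset x s b + \<bar>proj x s b - gd x w\<bar> + 4 * \<delta>"
proof -
  have "real (gd x w) + real (gd w s) = real (gd x s)" using assms(5) by linarith
  then show ?thesis
    using four_point[OF assms(3,4,1,2)] gd_sym[OF assms(4,1)]
    unfolding proj_def offset_def by (simp add: max_def abs_real_def field_simps split: if_splits)
qed

text \<open>Vertices with different projections are far apart, the more so the further they are from the
  geodesic. This divergence beats Harnack constants in Ancona's argument.\<close>

lemma gd_diverge:
  assumes "x \<in> V" "s \<in> V" "b \<in> V" "b' \<in> V" "proj x s b + 2 * \<delta> < proj x s b'"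
  shows "offset x s b + offset x s b' + (proj x s b' - proj x s b) - 4 * \<delta> \<le> gd b b'"
  using four_point[OF assms(3,2,4,1)] gd_sym[OF assms(2,4)] gd_sym[OF assms(2,1)] assms(5)
  unfolding proj_def offset_def by (simp add: max_def field_simps split: if_splits)

end

section \<open>Green functions and the domination principle\<close>

text \<open>Because of the positive function \<open>h\<close> with \<open>P h \<le> \<theta> h\<close>, the number \<open>\<theta>\<close> is an upper bound for the
  spectral radius: since \<open>t \<theta> < 1\<close>, the Green function still converges after \<open>P\<close> is
  multiplied by \<open>t > 1\<close>.\<close>

locale transient_walk = level_graph V E lev o\<^sub>0
  for V :: "'v set" and E :: "('v \<times> 'v) set" and lev :: "'v \<Rightarrow> nat" and o\<^sub>0 :: 'v +
  fixes P :: "'v \<Rightarrow> 'v \<Rightarrow> real" and m h :: "'v \<Rightarrow> real" and \<epsilon> \<theta> t :: real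
  assumes eps_pos: "0 < \<epsilon>" and eps_le_1: "\<epsilon> \<le> 1"
    and P_edge: "(x, y) \<in> E \<Longrightarrow> \<epsilon> \<le> P x y"
    and P_nonedge: "x \<in> V \<Longrightarrow> y \<in> V \<Longrightarrow> (x, y) \<notin> E \<Longrightarrow> P x y = 0"
    and m_pos: "x \<in> V \<Longrightarrow> 0 < m x"
    and reversible: "x \<in> V \<Longrightarrow> y \<in> V \<Longrightarrow> m x * P x y = m y * P y x"
    and h_pos: "x \<in> V \<Longrightarrow> 0 < h x"
    and h_contract: "x \<in> V \<Longrightarrow> (\<Sum>y\<in>E `` {x}. P x y * h y) \<le> \<theta> * h x"
    and theta_pos: "0 < \<theta>" and t_gt_1: "1 < t" and t_theta: "t * \<theta> < 1"
begin

definition avg :: "('v \<Rightarrow> real) \<Rightarrow> 'v \<Rightarrow> real" where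
  "avg f x = (\<Sum>y\<in>E `` {x}. P x y * f y)"

definition superharmonic :: "('v \<Rightarrow> real) \<Rightarrow> bool" where
  "superharmonic u \<longleftrightarrow> (\<forall>x\<in>V. 0 \<le> u x \<and> avg u x \<le> u x)"

definition t_superharmonic :: "('v \<Rightarrow> real) \<Rightarrow> bool" where
  "t_superharmonic u \<longleftrightarrow> (\<forall>x\<in>V. 0 \<le> u x \<and> t * avg u x \<le> u x)"

lemma superharmonicD: "superharmonic u \<Longrightarrow> x \<in> V \<Longrightarrow> 0 \<le> u x"
  "superharmonic u \<Longrightarrow> x \<in> V \<Longrightarrow> avg u x \<le> u x"
  by (auto simp: superharmonic_def)

lemma nb_in: "y \<in> E `` {x} \<Longrightarrow> y \<in> V"
  using edge_in by auto

lemma P_nb_pos: "y \<in> E `` {x} \<Longrightarrow> 0 < P x y"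
  using P_edge eps_pos by fastforce

lemma avg_mono: "(\<And>y. (x, y) \<in> E \<Longrightarrow> f y \<le> g y) \<Longrightarrow> avg f x \<le> avg g x"
  unfolding avg_def using P_nb_pos by (intro sum_mono mult_left_mono) (auto intro: less_imp_le)

lemma avg_nonneg: "(\<And>y. (x, y) \<in> E \<Longrightarrow> 0 \<le> f y) \<Longrightarrow> 0 \<le> avg f x"
  unfolding avg_def using P_nb_pos by (intro sum_nonneg mult_nonneg_nonneg) (auto intro: less_imp_le)

lemma avg_ge_term:
  assumes "(x, z) \<in> E" "\<And>y. (x, y) \<in> E \<Longrightarrow> 0 \<le> f y"
  shows "P x z * f z \<le> avg f x"
  unfolding avg_def using assms finite_nb
  by (intro member_le_sum) (auto intro!: mult_nonneg_nonneg less_imp_le[OF P_nb_pos])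

lemma avg_cmult: "avg (\<lambda>y. c * f y) x = c * avg f x"
  unfolding avg_def by (simp add: sum_distrib_left algebra_simps)

lemma avg_diff: "avg (\<lambda>y. f y - g y) x = avg f x - avg g x"
  unfolding avg_def by (simp add: sum_subtractf algebra_simps)

lemma avg_add: "avg (\<lambda>y. f y + g y) x = avg f x + avg g x"
  unfolding avg_def by (simp add: sum.distrib algebra_simps)

lemma avg_sum: "avg (\<lambda>y. \<Sum>a\<in>A. f a y) x = (\<Sum>a\<in>A. avg (f a) x)"
  unfolding avg_def by (simp add: sum_distrib_left sum.swap[of _ A])

lemma infsum_P:
  assumes "x \<in> V"
  shows "(\<Sum>\<^sub>\<infinity>z\<in>V. P x z * f z) = avg f x"
proof -
  have "(\<Sum>\<^sub>\<infinity>z\<in>V. P x z * f z) = (\<Sum>\<^sub>\<infinity>z\<in>E `` {x}. P x z * f z)"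
    using assms P_nonedge nb_in by (intro infsum_cong_neutral) auto
  then show ?thesis unfolding avg_def using finite_nb by simp
qed

subsection \<open>Transition probabilities\<close>

abbreviation "p \<equiv> nstep V P"

lemma nstep_Suc: "x \<in> V \<Longrightarrow> p (Suc n) x y = avg (\<lambda>z. p n z y) x"
  by (simp add: infsum_P)

declare nstep.simps(2) [simp del]

lemma nstep_nonneg: "x \<in> V \<Longrightarrow> 0 \<le> p n x y"
  by (induction n arbitrary: x) (auto simp: nstep_Suc intro!: avg_nonneg edge_in)

lemma nstep_bound:
  assumes "x \<in> V" "y \<in> V"
  shows "p n x y \<le> \<theta> ^ n * (h x / h y)"
  using assms(1)
proof (induction n arbitrary: x)
  case 0
  then show ?case using h_pos[OF 0] h_pos[OF assms(2)] by auto
next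
  case (Suc n)
  have "p (Suc n) x y = avg (\<lambda>z. p n z y) x" using Suc by (simp add: nstep_Suc)
  also have "\<dots> \<le> avg (\<lambda>z. \<theta> ^ n / h y * h z) x"
  proof (rule avg_mono)
    fix z assume "(x, z) \<in> E"
    then show "p n z y \<le> \<theta> ^ n / h y * h z" using Suc.IH edge_in by (fastforce simp: field_simps)
  qed
  also have "\<dots> = \<theta> ^ n / h y * avg h x" by (rule avg_cmult)
  also have "\<dots> \<le> \<theta> ^ n / h y * (\<theta> * h x)"
    using h_contract[OF Suc.prems] h_pos[OF assms(2)] theta_pos
    unfolding avg_def by (intro mult_left_mono) auto
  finally show ?case by (simp add: field_simps)
qed

lemma nstep_Suc_right:
  assumes "x \<in> V" "y \<in> V"
  shows "p (Suc n) x y = (\<Sum>z\<in>E `` {y}. p n x z * P z y)"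
  using assms(1)
proof (induction n arbitrary: x)
  case 0
  have "p (Suc 0) x y = (\<Sum>z\<in>E `` {x}. if z = y then P x z else 0)"
    using 0 by (simp add: nstep_Suc avg_def if_distrib cong: if_cong)
  also have "\<dots> = (if y \<in> E `` {x} then P x y else 0)" using finite_nb by (simp add: sum.delta')
  also have "\<dots> = (if x \<in> E `` {y} then P x y else 0)" using edge_sym by auto
  also have "\<dots> = (\<Sum>z\<in>E `` {y}. p 0 x z * P z y)"
    using finite_nb[of y] by (simp add: if_distrib if_distribR sum.delta cong: if_cong)
  finally show ?case .
next
  case (Suc n)
  have "p (Suc (Suc n)) x y = avg (\<lambda>w. p (Suc n) w y) x" using Suc by (simp add: nstep_Suc)
  also have "\<dots> = avg (\<lambda>w. \<Sum>z\<in>E `` {y}. p n w z * P z y) x"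
    unfolding avg_def using Suc.IH nb_in by (intro sum.cong) auto
  also have "\<dots> = (\<Sum>z\<in>E `` {y}. avg (\<lambda>w. p n w z) x * P z y)"
    by (subst avg_sum) (simp add: mult.commute[of _ "P _ y"] avg_cmult)
  also have "\<dots> = (\<Sum>z\<in>E `` {y}. p (Suc n) x z * P z y)" using Suc by (simp add: nstep_Suc)
  finally show ?case .
qed

lemma nstep_reversible:
  assumes "x \<in> V" "y \<in> V"
  shows "m x * p n x y = m y * p n y x"
  using assms(1)
proof (induction n arbitrary: x)
  case (Suc n)
  have "m x * p (Suc n) x y = (\<Sum>z\<in>E `` {x}. m x * P x z * p n z y)"
    using Suc by (simp add: nstep_Suc avg_def sum_distrib_left algebra_simps)
  also have "\<dots> = (\<Sum>z\<in>E `` {x}. P z x * (m z * p n z y))"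
    using reversible Suc.prems nb_in by (intro sum.cong) auto
  also have "\<dots> = (\<Sum>z\<in>E `` {x}. m y * (p n y z * P z x))"
    using Suc.IH nb_in by (intro sum.cong) auto
  also have "\<dots> = m y * p (Suc n) y x"
    using nstep_Suc_right[OF assms(2) Suc.prems] by (simp add: sum_distrib_left)
  finally show ?case .
qed auto

lemma nstep_compose_le:
  assumes "finite B" "B \<subseteq> V" "x \<in> V"
  shows "(\<Sum>b\<in>B. p k x b * p l b y) \<le> p (k + l) x y"
  using assms(3)
proof (induction k arbitrary: x)
  case 0
  have "(\<Sum>b\<in>B. p 0 x b * p l b y) = (\<Sum>b\<in>B. if x = b then p l b y else 0)"
    by (intro sum.cong) auto
  also have "\<dots> \<le> p l x y" using 0 assms nstep_nonneg by (simp add: sum.delta')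
  finally show ?case by simp
next
  case (Suc k)
  have "(\<Sum>b\<in>B. p (Suc k) x b * p l b y) = avg (\<lambda>z. \<Sum>b\<in>B. p k z b * p l b y) x"
    using Suc.prems by (subst avg_sum) (simp add: nstep_Suc mult.commute[of _ "p l _ y"] avg_cmult)
  also have "\<dots> \<le> avg (\<lambda>z. p (k + l) z y) x"
    using Suc.IH edge_in by (intro avg_mono) blast
  finally show ?case using Suc.prems by (simp add: nstep_Suc)
qed

lemma nstep_positive:
  assumes "x \<in> V" "y \<in> V"
  shows "\<exists>k. 0 < p k x y"
proof -
  have "0 < p n x y" if "(x, y) \<in> E ^^ n" "x \<in> V" for n x
    using that
  proof (induction n arbitrary: x)
    case (Suc n)
    from relpow_Suc_E2[OF Suc.prems(1)] obtain z where z: "(x, z) \<in> E" "(z, y) \<in> E ^^ n" .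
    have "0 < P x z * p n z y" using Suc.IH z edge_in P_nb_pos by auto
    also have "\<dots> \<le> avg (\<lambda>z. p n z y) x"
      using z nstep_nonneg edge_in by (intro avg_ge_term) auto
    finally show ?case using Suc.prems by (simp add: nstep_Suc)
  qed auto
  then show ?thesis using walk_exists[OF assms] assms by blast
qed

subsection \<open>Green functions\<close>

definition Gs :: "real \<Rightarrow> 'v \<Rightarrow> 'v \<Rightarrow> real" where
  "Gs s x y = (\<Sum>k. s ^ k * p k x y)"

abbreviation "G \<equiv> Gs 1"
abbreviation "Gt \<equiv> Gs t"

lemma green_eq: "green V P = G"
  unfolding green_def Gs_def by simp

lemma Gs_term_le:
  assumes "x \<in> V" "y \<in> V" "0 \<le> s"
  shows "s ^ k * p k x y \<le> h x / h y * (s * \<theta>) ^ k"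
  using mult_left_mono[OF nstep_bound[OF assms(1,2)], of "s ^ k"] assms(3)
  by (simp add: power_mult_distrib mult_ac)

lemma s_theta: "1 \<le> s \<Longrightarrow> s \<le> t \<Longrightarrow> \<bar>s * \<theta>\<bar> < 1"
  using t_theta theta_pos by (smt (verit) mult_nonneg_nonneg mult_right_mono)

lemma summable_Gs:
  assumes "x \<in> V" "y \<in> V" "1 \<le> s" "s \<le> t"
  shows "summable (\<lambda>k. s ^ k * p k x y)"
proof (rule summable_comparison_test'[where N = 0])
  show "summable (\<lambda>k. h x / h y * (s * \<theta>) ^ k)"
    using s_theta[OF assms(3,4)] by (intro summable_mult summable_geometric) simp
  show "norm (s ^ k * p k x y) \<le> h x / h y * (s * \<theta>) ^ k" for k
    using Gs_term_le[of x y s k] assms nstep_nonneg[OF assms(1)] by simp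
qed

lemma Gs_nonneg: "x \<in> V \<Longrightarrow> y \<in> V \<Longrightarrow> 1 \<le> s \<Longrightarrow> s \<le> t \<Longrightarrow> 0 \<le> Gs s x y"
  unfolding Gs_def using nstep_nonneg by (intro suminf_nonneg summable_Gs) auto

lemma Gs_le:
  assumes "x \<in> V" "y \<in> V" "1 \<le> s" "s \<le> t"
  shows "Gs s x y \<le> h x / h y / (1 - s * \<theta>)"
proof -
  have "Gs s x y \<le> (\<Sum>k. h x / h y * (s * \<theta>) ^ k)"
    unfolding Gs_def using assms Gs_term_le s_theta[OF assms(3,4)]
    by (intro suminf_le summable_Gs summable_mult summable_geometric) auto
  also have "\<dots> = h x / h y / (1 - s * \<theta>)"
    using s_theta[OF assms(3,4)]
    by (subst suminf_mult) (auto simp: summable_geometric suminf_geometric)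
  finally show ?thesis .
qed

lemma Gs_eq:
  assumes "x \<in> V" "y \<in> V" "1 \<le> s" "s \<le> t"
  shows "Gs s x y = (if x = y then 1 else 0) + s * avg (\<lambda>z. Gs s z y) x"
proof -
  have "(\<Sum>k. s ^ Suc k * p (Suc k) x y) = (\<Sum>k. \<Sum>z\<in>E `` {x}. s * P x z * (s ^ k * p k z y))"
    using assms by (simp add: nstep_Suc avg_def sum_distrib_left algebra_simps)
  also have "\<dots> = (\<Sum>z\<in>E `` {x}. \<Sum>k. s * P x z * (s ^ k * p k z y))"
    using assms nb_in by (intro suminf_sum summable_mult summable_Gs) auto
  also have "\<dots> = (\<Sum>z\<in>E `` {x}. s * P x z * Gs s z y)"
    unfolding Gs_def using assms nb_in by (intro sum.cong suminf_mult summable_Gs) auto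
  also have "\<dots> = s * avg (\<lambda>z. Gs s z y) x"
    by (simp add: avg_def sum_distrib_left algebra_simps)
  finally show ?thesis
    using suminf_split_head[OF summable_Gs[OF assms]] unfolding Gs_def by simp
qed

lemma t_ge_1: "1 \<le> t" "1 \<le> (1::real)" "t \<le> t" using t_gt_1 by auto

lemma G_nonneg: "x \<in> V \<Longrightarrow> y \<in> V \<Longrightarrow> 0 \<le> G x y"
  using Gs_nonneg t_ge_1 by auto

lemma Gt_nonneg: "x \<in> V \<Longrightarrow> y \<in> V \<Longrightarrow> 0 \<le> Gt x y"
  using Gs_nonneg t_ge_1 by auto

lemma avg_G: "x \<in> V \<Longrightarrow> y \<in> V \<Longrightarrow> avg (\<lambda>z. G z y) x = G x y - (if x = y then 1 else 0)"
  using Gs_eq[of x y 1] t_ge_1 by simp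

lemma avg_Gt: "x \<in> V \<Longrightarrow> y \<in> V \<Longrightarrow> t * avg (\<lambda>z. Gt z y) x = Gt x y - (if x = y then 1 else 0)"
  using Gs_eq[of x y t] t_ge_1 by simp

lemma superharmonic_G: "y \<in> V \<Longrightarrow> superharmonic (\<lambda>x. G x y)"
  unfolding superharmonic_def using avg_G G_nonneg by auto

lemma t_superharmonic_Gt: "y \<in> V \<Longrightarrow> t_superharmonic (\<lambda>x. Gt x y)"
  unfolding t_superharmonic_def using avg_Gt Gt_nonneg by auto

lemma t_superharmonic_imp: "t_superharmonic u \<Longrightarrow> superharmonic u"
  unfolding superharmonic_def t_superharmonic_def
  using avg_nonneg edge_in t_gt_1 by (smt (verit, best) mult_le_cancel_right1)

lemma superharmonic_Gt: "y \<in> V \<Longrightarrow> superharmonic (\<lambda>x. Gt x y)"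
  by (intro t_superharmonic_imp t_superharmonic_Gt)

lemma G_diag: "x \<in> V \<Longrightarrow> 1 \<le> G x x"
  using avg_G[of x x] avg_nonneg[of x "\<lambda>z. G z x"] G_nonneg edge_in by auto

lemma G_le_Gt: "x \<in> V \<Longrightarrow> y \<in> V \<Longrightarrow> G x y \<le> Gt x y"
  unfolding Gs_def using t_gt_1 nstep_nonneg
  by (intro suminf_le summable_Gs mult_right_mono power_mono) auto

lemma Gt_diag: "x \<in> V \<Longrightarrow> 1 \<le> Gt x x"
  using G_diag G_le_Gt by fastforce

lemma Gs_reversible:
  assumes "x \<in> V" "y \<in> V" "1 \<le> s" "s \<le> t"
  shows "m x * Gs s x y = m y * Gs s y x"
proof -
  have "m x * Gs s x y = (\<Sum>k. s ^ k * (m x * p k x y))"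
    unfolding Gs_def using suminf_mult[OF summable_Gs[OF assms], of "m x"] by (simp add: algebra_simps)
  also have "\<dots> = (\<Sum>k. m y * (s ^ k * p k y x))"
    using nstep_reversible[OF assms(1,2)] by (simp add: algebra_simps)
  also have "\<dots> = m y * Gs s y x"
    unfolding Gs_def using suminf_mult[OF summable_Gs[OF assms(2,1,3,4)], of "m y"] by simp
  finally show ?thesis .
qed

definition "G_sup = 1 / (1 - \<theta>)"

lemma theta_lt_1: "\<theta> < 1" using s_theta[of 1] t_ge_1 theta_pos by simp

lemma G_diag_le: "x \<in> V \<Longrightarrow> G x x \<le> G_sup"
  using Gs_le[of x x 1] t_ge_1 h_pos[of x] by (simp add: G_sup_def)

lemma G_sup_pos: "0 < G_sup"
  using theta_lt_1 by (simp add: G_sup_def)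

text \<open>Over all \<open>b\<close>, the sum is that of \<open>(n+1) t\<^sup>n p\<^sup>n(x,y)\<close> over \<open>n\<close>, which converges because \<open>t\<close> is
  strictly inside the disc of convergence.\<close>

lemma sum_Gt_Gt_le:
  assumes "finite B" "B \<subseteq> V" "x \<in> V" "y \<in> V"
  shows "(\<Sum>b\<in>B. Gt x b * Gt b y) \<le> h x / h y / (1 - t * \<theta>)\<^sup>2"
proof (rule LIMSEQ_le_const2)
  let ?S = "\<lambda>n x y. \<Sum>k<n. t ^ k * p k x y"
  have "(\<lambda>n. ?S n x y) \<longlonglongrightarrow> Gt x y" if "x \<in> V" "y \<in> V" for x y
    unfolding Gs_def using that t_ge_1 by (intro summable_LIMSEQ summable_Gs) auto
  then show "(\<lambda>n. \<Sum>b\<in>B. ?S n x b * ?S n b y) \<longlonglongrightarrow> (\<Sum>b\<in>B. Gt x b * Gt b y)"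
    using assms by (intro tendsto_sum tendsto_mult) auto
  have r: "0 \<le> t * \<theta>" "0 \<le> h x / h y"
    using t_gt_1 theta_pos h_pos[OF assms(3)] h_pos[OF assms(4)] by auto
  have "(\<Sum>b\<in>B. ?S n x b * ?S n b y) \<le> h x / h y / (1 - t * \<theta>)\<^sup>2" for n
  proof -
    have "(\<Sum>b\<in>B. ?S n x b * ?S n b y)
        = (\<Sum>b\<in>B. \<Sum>k<n. \<Sum>l<n. t ^ (k + l) * (p k x b * p l b y))"
      unfolding sum_product power_add by (intro sum.cong refl) (simp only: mult_ac)
    also have "\<dots> = (\<Sum>k<n. \<Sum>b\<in>B. \<Sum>l<n. t ^ (k + l) * (p k x b * p l b y))"
      by (rule sum.swap)
    also have "\<dots> = (\<Sum>k<n. \<Sum>l<n. \<Sum>b\<in>B. t ^ (k + l) * (p k x b * p l b y))"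
      by (intro sum.cong refl) (rule sum.swap)
    also have "\<dots> = (\<Sum>k<n. \<Sum>l<n. t ^ (k + l) * (\<Sum>b\<in>B. p k x b * p l b y))"
      by (simp add: sum_distrib_left)
    also have "\<dots> \<le> (\<Sum>k<n. \<Sum>l<n. t ^ (k + l) * p (k + l) x y)"
      using assms t_gt_1 by (intro sum_mono mult_left_mono nstep_compose_le) auto
    also have "\<dots> \<le> (\<Sum>k<n. \<Sum>l<n. h x / h y * (t * \<theta>) ^ (k + l))"
      using Gs_term_le[OF assms(3,4), of t] t_gt_1 by (intro sum_mono) auto
    also have "\<dots> = h x / h y * (\<Sum>k<n. (t * \<theta>) ^ k)\<^sup>2"
    proof -
      have "(\<Sum>k<n. (t * \<theta>) ^ k)\<^sup>2 = (\<Sum>k<n. \<Sum>l<n. (t * \<theta>) ^ (k + l))"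
        by (simp only: power2_eq_square sum_product power_add)
      then show ?thesis by (simp add: sum_distrib_left)
    qed
    also have "\<dots> \<le> h x / h y * (1 / (1 - t * \<theta>))\<^sup>2"
    proof (intro mult_left_mono power_mono r(2) sum_nonneg)
      have "(\<Sum>k<n. (t * \<theta>) ^ k) \<le> (\<Sum>k. (t * \<theta>) ^ k)"
        using r(1) t_theta by (intro sum_le_suminf summable_geometric) auto
      then show "(\<Sum>k<n. (t * \<theta>) ^ k) \<le> 1 / (1 - t * \<theta>)"
        using r(1) t_theta by (simp add: suminf_geometric)
    qed (use r in auto)
    finally show ?thesis by (simp add: power_divide)
  qed
  then show "\<exists>N. \<forall>n\<ge>N. (\<Sum>b\<in>B. ?S n x b * ?S n b y) \<le> h x / h y / (1 - t * \<theta>)\<^sup>2" by blast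
qed

subsection \<open>Domination principle and Harnack inequality\<close>

text \<open>A maximum principle without boundary at infinity: a subharmonic function below a multiple of
  \<open>g\<close> is below \<open>t\<^sup>-\<^sup>n\<close> times that multiple for every \<open>n\<close>.\<close>

lemma subharmonic_nonpos:
  assumes f: "\<And>x. x \<in> V \<Longrightarrow> 0 < f x \<Longrightarrow> f x \<le> avg (\<lambda>y. max 0 (f y)) x"
    and g: "t_superharmonic g" and le: "\<And>x. x \<in> V \<Longrightarrow> f x \<le> C * g x"
    and "x \<in> V"
  shows "f x \<le> 0"
proof -
  define C' where "C' = max 0 C"
  have g0: "0 \<le> g x" "t * avg g x \<le> g x" if "x \<in> V" for x
    using g that by (auto simp: t_superharmonic_def)
  have *: "f x \<le> C' * (1 / t) ^ n * g x" if "x \<in> V" for n x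
    using that
  proof (induction n arbitrary: x)
    case 0
    have "C * g x \<le> C' * g x" using g0[OF 0] by (intro mult_right_mono) (auto simp: C'_def)
    then show ?case using le[OF 0] by simp
  next
    case (Suc n)
    have nn: "0 \<le> C' * (1 / t) ^ k * g y" if "y \<in> V" for k y
      using g0 that t_gt_1 by (simp add: C'_def)
    show ?case
    proof (cases "0 < f x")
      case True
      have "f x \<le> avg (\<lambda>y. max 0 (f y)) x" using f Suc.prems True by blast
      also have "\<dots> \<le> avg (\<lambda>y. C' * (1 / t) ^ n * g y) x"
        using Suc.IH nn edge_in by (intro avg_mono) (meson max.boundedI)
      also have "\<dots> = C' * (1 / t) ^ Suc n * (t * avg g x)"
        using t_gt_1 by (simp add: avg_cmult)
      also have "\<dots> \<le> C' * (1 / t) ^ Suc n * g x"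
        using g0[OF Suc.prems] t_gt_1 by (intro mult_left_mono) (auto simp: C'_def)
      finally show ?thesis .
    next
      case False
      then show ?thesis using nn[OF Suc.prems, of "Suc n"] by simp
    qed
  qed
  have "(\<lambda>n. C' * (1 / t) ^ n * g x) \<longlonglongrightarrow> C' * 0 * g x"
    using t_gt_1 by (intro tendsto_intros LIMSEQ_realpow_zero) auto
  then show ?thesis using *[OF \<open>x \<in> V\<close>] by (intro LIMSEQ_le_const[where a = "f x"]) auto
qed

text \<open>On a set \<open>D\<close> of any size, an inequality between a subharmonic function and a superharmonic
  one needs to be checked only at the vertices adjacent to \<open>D\<close>.\<close>

lemma domination:
  assumes "D \<subseteq> V"
    and u: "\<And>x. x \<in> D \<Longrightarrow> u x \<le> avg u x" and v: "\<And>x. x \<in> D \<Longrightarrow> avg v x \<le> v x"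
    and v0: "\<And>x. x \<in> V \<Longrightarrow> 0 \<le> v x"
    and bd: "\<And>x y. x \<in> D \<Longrightarrow> (x, y) \<in> E \<Longrightarrow> y \<notin> D \<Longrightarrow> u y \<le> v y"
    and g: "t_superharmonic g" and C: "0 \<le> C" "\<And>x. x \<in> D \<Longrightarrow> u x \<le> C * g x"
    and "x \<in> D"
  shows "u x \<le> v x"
proof -
  define f where "f = (\<lambda>x. if x \<in> D then u x - v x else 0)"
  have "f x \<le> 0"
  proof (rule subharmonic_nonpos[OF _ g, of f C])
    fix x assume "x \<in> V" "0 < f x"
    then have D: "x \<in> D" by (auto simp: f_def split: if_splits)
    then have "f x \<le> avg u x - avg v x" using u v by (fastforce simp: f_def)
    also have "\<dots> = avg (\<lambda>y. u y - v y) x" by (simp add: avg_diff)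
    also have "\<dots> \<le> avg (\<lambda>y. max 0 (f y)) x"
    proof (rule avg_mono)
      fix y assume "(x, y) \<in> E"
      then show "u y - v y \<le> max 0 (f y)" using bd[OF D] by (cases "y \<in> D") (auto simp: f_def)
    qed
    finally show "f x \<le> avg (\<lambda>y. max 0 (f y)) x" .
  next
    fix x assume "x \<in> V"
    moreover have "0 \<le> C * g x" using g C \<open>x \<in> V\<close> by (auto simp: t_superharmonic_def)
    ultimately show "f x \<le> C * g x"
      using C(2)[of x] v0[of x] by (cases "x \<in> D") (auto simp: f_def)
  qed (use assms in auto)
  then show ?thesis using \<open>x \<in> D\<close> by (simp add: f_def)
qed

lemma harnack:
  assumes u: "superharmonic u" and "x \<in> V" "y \<in> V" "gd x y \<le> n"
  shows "\<epsilon> ^ n * u y \<le> u x"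
proof -
  have step: "\<epsilon> * u y \<le> u x" if "(x, y) \<in> E" for x y
  proof -
    have "\<epsilon> * u y \<le> P x y * u y"
      using that P_edge superharmonicD(1)[OF u] edge_in by (intro mult_right_mono) auto
    also have "\<dots> \<le> avg u x"
      using that superharmonicD(1)[OF u] edge_in by (intro avg_ge_term) auto
    also have "\<dots> \<le> u x" using superharmonicD(2)[OF u] that edge_in by auto
    finally show ?thesis .
  qed
  have "\<epsilon> ^ k * u y \<le> u x" if "(x, y) \<in> E ^^ k" for k x
    using that
  proof (induction k arbitrary: x)
    case (Suc k)
    from relpow_Suc_E2[OF Suc.prems] obtain z where z: "(x, z) \<in> E" "(z, y) \<in> E ^^ k" .
    have "\<epsilon> ^ Suc k * u y \<le> \<epsilon> * u z" using Suc.IH[OF z(2)] eps_pos by simp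
    also have "\<dots> \<le> u x" by (rule step[OF z(1)])
    finally show ?case .
  qed auto
  then have "\<epsilon> ^ gd x y * u y \<le> u x" using graph_dist_walk assms by blast
  moreover have "\<epsilon> ^ n * u y \<le> \<epsilon> ^ gd x y * u y"
    using assms eps_pos eps_le_1 superharmonicD(1)[OF u]
    by (intro mult_right_mono power_decreasing) auto
  ultimately show ?thesis by linarith
qed

lemma Gs_harnack_right:
  assumes "x \<in> V" "y \<in> V" "z \<in> V" "gd y z \<le> n" "1 \<le> s" "s \<le> t"
  shows "\<epsilon> ^ n * Gs s x z \<le> Gs s x y"
proof -
  have step: "\<epsilon> * Gs s x z \<le> Gs s x y" if "(y, z) \<in> E" for y z
  proof -
    have V: "y \<in> V" "z \<in> V" using that edge_in by auto
    have "\<epsilon> * p k x z \<le> p (Suc k) x y" for k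
    proof -
      have "\<epsilon> * p k x z \<le> p k x z * P z y"
        using mult_left_mono[OF P_edge[OF edge_sym[OF that]] nstep_nonneg[OF assms(1)]]
        by (simp add: mult.commute)
      also have "\<dots> \<le> (\<Sum>w\<in>E `` {y}. p k x w * P w y)"
        using that finite_nb nstep_nonneg[OF assms(1)] edge_sym
        by (intro member_le_sum) (auto intro!: mult_nonneg_nonneg less_imp_le[OF P_nb_pos])
      finally show ?thesis using nstep_Suc_right[OF assms(1) V(1)] by simp
    qed
    then have le: "s ^ k * (\<epsilon> * p k x z) \<le> s ^ Suc k * p (Suc k) x y" for k
      using assms nstep_nonneg[OF assms(1)] eps_pos by (intro mult_mono power_increasing) auto
    have sm: "summable (\<lambda>k. s ^ Suc k * p (Suc k) x y)"
      using summable_Gs[OF assms(1) V(1) assms(5,6)] by (subst summable_Suc_iff)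
    have "\<epsilon> * Gs s x z = (\<Sum>k. \<epsilon> * (s ^ k * p k x z))"
      unfolding Gs_def using suminf_mult[OF summable_Gs[OF assms(1) V(2) assms(5,6)]] by simp
    also have "\<dots> \<le> (\<Sum>k. s ^ Suc k * p (Suc k) x y)"
      using le assms V by (intro suminf_le sm summable_mult summable_Gs) (auto simp: mult_ac)
    also have "\<dots> \<le> Gs s x y"
      using suminf_split_head[OF summable_Gs[OF assms(1) V(1) assms(5,6)]]
      unfolding Gs_def by simp
    finally show ?thesis .
  qed
  have "\<epsilon> ^ k * Gs s x z \<le> Gs s x y" if "(y, z) \<in> E ^^ k" for k y
    using that
  proof (induction k arbitrary: y)
    case (Suc k)
    from relpow_Suc_E2[OF Suc.prems] obtain w where w: "(y, w) \<in> E" "(w, z) \<in> E ^^ k" .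
    have "\<epsilon> ^ Suc k * Gs s x z \<le> \<epsilon> * Gs s x w" using Suc.IH[OF w(2)] eps_pos by simp
    also have "\<dots> \<le> Gs s x y" by (rule step[OF w(1)])
    finally show ?case .
  qed auto
  then have "\<epsilon> ^ gd y z * Gs s x z \<le> Gs s x y" using graph_dist_walk assms by blast
  moreover have "\<epsilon> ^ n * Gs s x z \<le> \<epsilon> ^ gd y z * Gs s x z"
    using assms eps_pos eps_le_1 Gs_nonneg by (intro mult_right_mono power_decreasing) auto
  ultimately show ?thesis by linarith
qed

lemma G_pos: "x \<in> V \<Longrightarrow> y \<in> V \<Longrightarrow> 0 < G x y"
  using harnack[OF superharmonic_G, of y x y "gd x y"] G_diag[of y] eps_pos
  by (smt (verit, best) mult_pos_pos order_refl zero_less_power)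

text \<open>For a Green function \<open>u\<close> this is the converse of Ancona's inequality, which holds for all \<open>w\<close>:
  \<open>G(x,w)/G(w,w)\<close> is the least nonnegative superharmonic function that is \<open>1\<close> at \<open>w\<close>.\<close>

lemma superharmonic_ge_G:
  assumes u: "superharmonic u" and x: "x \<in> V" and w: "w \<in> V"
  shows "G x w * u w \<le> G_sup * u x"
proof -
  have u0: "0 \<le> u z" if "z \<in> V" for z using superharmonicD[OF u] that by auto
  have "u w * G x w \<le> G w w * u x"
  proof (cases "x = w")
    case False
    show ?thesis
    proof (rule domination[of "V - {w}" "\<lambda>x. u w * G x w" "\<lambda>x. G w w * u x" "\<lambda>x. Gt x w" "u w"])
      show "t_superharmonic (\<lambda>x. Gt x w)" by (rule t_superharmonic_Gt[OF w])
    qed (use assms False u0 superharmonicD[OF u] avg_G[OF _ w] G_le_Gt[OF _ w] G_nonneg[OF w w]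
        edge_in in \<open>auto simp: avg_cmult intro!: mult_left_mono\<close>)
  qed (simp add: mult.commute)
  also have "\<dots> \<le> G_sup * u x" using G_diag_le[OF w] u0[OF x] by (rule mult_right_mono)
  finally show ?thesis by (simp add: mult.commute)
qed

end

section \<open>Ancona's inequality\<close>

context level_graph
begin

definition gd_set :: "'v set \<Rightarrow> 'v \<Rightarrow> nat" where
  "gd_set A b = (LEAST n. \<exists>y\<in>A. gd b y = n)"

lemma gd_set_attained:
  assumes "A \<noteq> {}"
  obtains y where "y \<in> A" "gd b y = gd_set A b"
proof -
  have "\<exists>y\<in>A. gd b y = gd_set A b"
    unfolding gd_set_def using LeastI_ex[of "\<lambda>n. \<exists>y\<in>A. gd b y = n"] assms by blast
  then show ?thesis using that by blast
qed

lemma gd_set_le: "y \<in> A \<Longrightarrow> gd_set A b \<le> gd b y"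
  unfolding gd_set_def by (rule Least_le) blast

lemma gd_set_edge:
  assumes "A \<noteq> {}" "A \<subseteq> V" "(b, b') \<in> E"
  shows "gd_set A b \<le> Suc (gd_set A b')"
proof -
  obtain y where y: "y \<in> A" "gd b' y = gd_set A b'" using gd_set_attained[OF assms(1)] .
  have "gd_set A b \<le> gd b y" by (rule gd_set_le[OF y(1)])
  also have "\<dots> \<le> gd b b' + gd b' y" using assms y edge_in by (intro gd_triangle) auto
  also have "\<dots> \<le> Suc (gd_set A b')" using y gd_edge[OF assms(3)] by simp
  finally show ?thesis .
qed

end

lemma has_sum_finite_sum:
  fixes f :: "'i \<Rightarrow> 'a \<Rightarrow> real"
  assumes "finite I" "\<And>i. i \<in> I \<Longrightarrow> (f i has_sum s i) A"
  shows "((\<lambda>a. \<Sum>i\<in>I. f i a) has_sum (\<Sum>i\<in>I. s i)) A"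
  using assms by (induction I rule: finite_induct) (auto intro: has_sum_add)

locale hyperbolic_walk = hyperbolic_graph V E lev o\<^sub>0 \<delta> + transient_walk V E lev o\<^sub>0 P m h \<epsilon> \<theta> t
  for V :: "'v set" and E :: "('v \<times> 'v) set" and lev :: "'v \<Rightarrow> nat" and o\<^sub>0 :: 'v
    and \<delta> :: nat and P :: "'v \<Rightarrow> 'v \<Rightarrow> real" and m h :: "'v \<Rightarrow> real" and \<epsilon> \<theta> t :: real
begin

lemma harnack_inv:
  assumes "superharmonic u" "x \<in> V" "y \<in> V" "gd x y \<le> n"
  shows "u y \<le> (1 / \<epsilon>) ^ n * u x"
  using harnack[OF assms] eps_pos by (simp add: power_one_over field_simps)

lemma Gs_harnack_right_inv:
  assumes "x \<in> V" "y \<in> V" "z \<in> V" "gd y z \<le> n" "1 \<le> s" "s \<le> t"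
  shows "Gs s x z \<le> (1 / \<epsilon>) ^ n * Gs s x y"
  using Gs_harnack_right[OF assms] eps_pos by (simp add: power_one_over field_simps)

lemma inv_eps_ge_1: "1 \<le> (1 / \<epsilon>) ^ n"
  using eps_pos eps_le_1 by (intro one_le_power) simp

lemma inv_t_power_small:
  assumes "0 < (e::real)"
  obtains L where "(1 / t) ^ L \<le> e"
proof -
  have "1 / t < 1" using t_gt_1 by simp
  then obtain L where "(1 / t) ^ L < e" using real_arch_pow_inv[OF assms] by blast
  then show ?thesis using that[of L] by simp
qed

text \<open>Dividing \<open>Gt(\<cdot>, w)\<close> by \<open>t\<close> to the power of the distance from \<open>A\<close> leaves it superharmonic
  outside \<open>A\<close>. So a bound for \<open>G(\<cdot>, x)\<close> at the boundary vertices of \<open>A\<close> improves by the factor \<open>t\<close>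
  with every unit of distance.\<close>

lemma G_le_decay:
  assumes x: "x \<in> A" and w: "w \<in> V" and A: "A \<subseteq> V" and C: "0 \<le> C"
    and bd: "\<And>y. y \<in> A \<Longrightarrow> \<exists>y'. (y, y') \<in> E \<and> y' \<notin> A \<Longrightarrow> G y x \<le> C * Gt y w"
    and b: "b \<in> V" "b \<notin> A"
  shows "G b x \<le> C * (1 / t) ^ gd_set A b * Gt b w"
proof (rule domination[of "V - A" "\<lambda>b. G b x" "\<lambda>b. C * (1 / t) ^ gd_set A b * Gt b w"
      "\<lambda>b. Gt b x" 1])
  have xV: "x \<in> V" using x A by auto
  show "t_superharmonic (\<lambda>b. Gt b x)" by (rule t_superharmonic_Gt[OF xV])
  show "G b x \<le> avg (\<lambda>b. G b x) b" if "b \<in> V - A" for b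
    using avg_G[of b x] that x xV by auto
  show "G b x \<le> 1 * Gt b x" if "b \<in> V - A" for b using G_le_Gt[of b x] that xV by simp
  show "0 \<le> C * (1 / t) ^ gd_set A b * Gt b w" if "b \<in> V" for b
    using Gt_nonneg[OF that w] C t_gt_1 by simp
  show "G y x \<le> C * (1 / t) ^ gd_set A y * Gt y w" if "b \<in> V - A" "(b, y) \<in> E" "y \<notin> V - A" for b y
  proof -
    have y: "y \<in> A" using that edge_in by auto
    have "gd_set A y = 0" using gd_set_le[OF y, of y] by simp
    then show ?thesis using bd[OF y] that edge_sym by auto
  qed
  show "avg (\<lambda>b. C * (1 / t) ^ gd_set A b * Gt b w) b \<le> C * (1 / t) ^ gd_set A b * Gt b w"
    if "b \<in> V - A" for b
  proof -
    have bV: "b \<in> V" using that by simp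
    have "avg (\<lambda>b. C * (1 / t) ^ gd_set A b * Gt b w) b
        \<le> avg (\<lambda>y. (C * (1 / t) ^ gd_set A b * t) * Gt y w) b"
    proof (rule avg_mono)
      fix y assume y: "(b, y) \<in> E"
      have "(1 / t) ^ Suc (gd_set A y) \<le> (1 / t) ^ gd_set A b"
        using gd_set_edge[OF _ A y] x t_gt_1 by (intro power_decreasing) auto
      then have "(1 / t) ^ gd_set A y \<le> (1 / t) ^ gd_set A b * t"
        using t_gt_1 by (simp add: field_simps)
      then have "C * (1 / t) ^ gd_set A y * Gt y w \<le> C * ((1 / t) ^ gd_set A b * t) * Gt y w"
        using C Gt_nonneg[OF edge_in(2)[OF y] w] by (intro mult_right_mono mult_left_mono) auto
      then show "C * (1 / t) ^ gd_set A y * Gt y w \<le> (C * (1 / t) ^ gd_set A b * t) * Gt y w"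
        by (simp add: mult_ac)
    qed
    also have "\<dots> = C * (1 / t) ^ gd_set A b * (t * avg (\<lambda>y. Gt y w) b)"
      by (subst avg_cmult) simp
    also have "\<dots> \<le> C * (1 / t) ^ gd_set A b * Gt b w"
      using avg_Gt[OF bV w] C t_gt_1 by (intro mult_left_mono) auto
    finally show ?thesis .
  qed
qed (use b in auto)

text \<open>Half of Ancona's inequality, with \<open>Gt\<close> in place of \<open>G\<close> on the side that faces away from \<open>x\<close>.
  The waypoint \<open>w\<close> advances along the geodesic in steps of length \<open>4 \<delta> + 2\<close>. Each step costs a
  Harnack constant. Vertices \<open>b\<close> close to the new waypoint absorb this in \<open>C\<close>. All other vertices
  that project beyond the new waypoint are at distance at least \<open>L\<close> from those that project
  before the old one, so they gain \<open>t\<^sup>L\<close>, which pays for the step. Thus \<open>C\<close> does not grow.\<close>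

lemma ancona_half:
  "\<exists>C\<ge>1. \<forall>x\<in>V. \<forall>s\<in>V. \<forall>w\<in>V. \<forall>b\<in>V.
     gd x w + gd w s = gd x s \<and> real (gd x w) \<le> proj x s b \<longrightarrow> G b x \<le> C * Gt b w * G w x"
proof -
  define R where "R = 4 * \<delta> + 2"
  define R' where "R' = R + 4 * \<delta>"
  obtain L where L: "(1 / t) ^ L \<le> \<epsilon> ^ (2 * R')"
    using inv_t_power_small[of "\<epsilon> ^ (2 * R')"] eps_pos by auto
  \<comment> \<open>vertices that gain less than \<open>t\<^sup>L\<close> turn out to be within distance \<open>K\<close> of the waypoint\<close>
  define K where "K = L + 8 * \<delta>"
  define C where "C = (1 / \<epsilon>) ^ (2 * K + 2 * R)"
  have C1: "1 \<le> C" unfolding C_def by (rule inv_eps_ge_1)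
  have near: "G b x \<le> C * Gt b w * G w x"
    if V: "x \<in> V" "w \<in> V" "b \<in> V" and n: "gd b w \<le> n" "n \<le> K" for x w b n
  proof -
    have "G b x \<le> (1 / \<epsilon>) ^ n * G w x"
      using harnack_inv[OF superharmonic_G[OF V(1)] V(2,3)] gd_sym V n by simp
    moreover have "1 \<le> (1 / \<epsilon>) ^ n * Gt b w"
      using harnack_inv[OF superharmonic_Gt[OF V(2)] V(3,2) n(1)] Gt_diag[OF V(2)] by linarith
    ultimately have "G b x * 1 \<le> ((1 / \<epsilon>) ^ n * G w x) * ((1 / \<epsilon>) ^ n * Gt b w)"
      using eps_pos G_nonneg V by (intro mult_mono) auto
    also have "\<dots> = (1 / \<epsilon>) ^ (2 * n) * Gt b w * G w x" by (simp add: power_add mult_2)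
    also have "\<dots> \<le> C * Gt b w * G w x"
      unfolding C_def using eps_pos eps_le_1 n G_nonneg Gt_nonneg V
      by (intro mult_right_mono power_increasing) auto
    finally show ?thesis by simp
  qed
  have "G b x \<le> C * Gt b w * G w x"
    if V: "x \<in> V" "s \<in> V" "w \<in> V" "b \<in> V"
      and w: "gd x w + gd w s = gd x s" and b: "real (gd x w) \<le> proj x s b" for x s w b
    using V(3,4) w b
  proof (induction "gd x w" arbitrary: w b rule: less_induct)
    case less
    show ?case
    proof (cases "gd x w < R")
      case True
      have "G b x \<le> Gt b x * G x x"
        using G_le_Gt[of b x] G_diag[of x] Gt_nonneg[of b x] V less.prems
        by (smt (verit) mult_le_cancel_left1)
      also have "\<dots> \<le> ((1 / \<epsilon>) ^ R * Gt b w) * ((1 / \<epsilon>) ^ R * G w x)"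
        using Gs_harnack_right_inv[of b w x R t] harnack_inv[OF superharmonic_G, of x w x R]
          True V less.prems gd_sym[of x w] t_ge_1 Gt_nonneg[of b x] G_nonneg[of x x]
          Gt_nonneg[of b w] eps_pos
        by (intro mult_mono) auto
      also have "\<dots> = (1 / \<epsilon>) ^ (2 * R) * Gt b w * G w x" by (simp add: power_add mult_2)
      also have "\<dots> \<le> C * Gt b w * G w x"
        unfolding C_def using eps_pos eps_le_1 G_nonneg Gt_nonneg V less.prems
        by (intro mult_right_mono power_increasing) auto
      finally show ?thesis .
    next
      case False
      define j where "j = gd x w - R"
      have j: "gd x w = j + R" using False by (simp add: j_def)
      obtain w\<^sub>0 where w\<^sub>0: "w\<^sub>0 \<in> V" "gd x w\<^sub>0 = j" "gd w\<^sub>0 s = gd x s - j"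
        using geodesic_point[OF V(1,2), of j] less.prems j by auto
      have w\<^sub>0': "gd x w\<^sub>0 + gd w\<^sub>0 s = gd x s" using w\<^sub>0 less.prems j by simp
      have IH: "G y x \<le> C * Gt y w\<^sub>0 * G w\<^sub>0 x" if "y \<in> V" "real j \<le> proj x s y" for y
        using less.hyps[OF _ w\<^sub>0(1) that(1) w\<^sub>0'] that w\<^sub>0(2) j by (simp add: R_def)
      have xw: "real (gd x w) + real (gd w s) = real (gd x s)" using less.prems(3) by linarith
      have pw: "proj x s w = real j + R" "offset x s w = 0"
        using xw j gd_sym[OF less.prems(1) V(1)] unfolding proj_def offset_def by auto
      have "real (gd w w\<^sub>0) \<le> real R'"
        using gd_geodesic_point_le[OF V(1,2) less.prems(1) w\<^sub>0(1) w\<^sub>0'] pw w\<^sub>0(2) by (simp add: R'_def)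
      then have ww: "gd w w\<^sub>0 \<le> R'" by simp
      define A where "A = {y \<in> V. proj x s y \<le> real j + 1}"
      have xA: "x \<in> A" using V gd_sym by (simp add: A_def proj_def)
      have bA: "b \<notin> A" using less.prems(4) j by (simp add: A_def R_def)
      have dist: "offset x s b + proj x s b - real j - 1 - 4 * \<delta> \<le> gd_set A b"
      proof -
        obtain y where y: "y \<in> A" "gd b y = gd_set A b" using gd_set_attained[of A b] xA by blast
        then have yV: "y \<in> V" "proj x s y \<le> real j + 1" by (auto simp: A_def)
        have "proj x s y + 2 * \<delta> < proj x s b" using yV less.prems(4) j by (simp add: R_def)
        from gd_diverge[OF V(1,2) yV(1) less.prems(2) this]
        show ?thesis using y yV offset_nonneg[OF V(1,2) yV(1)] gd_sym[OF yV(1) less.prems(2)] by simp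
      qed
      have decay: "G b x \<le> (C * G w\<^sub>0 x) * (1 / t) ^ gd_set A b * Gt b w\<^sub>0"
      proof (rule G_le_decay[OF xA w\<^sub>0(1)])
        show "0 \<le> C * G w\<^sub>0 x" using C1 G_nonneg[OF w\<^sub>0(1) V(1)] by simp
        show "G y x \<le> C * G w\<^sub>0 x * Gt y w\<^sub>0" if "y \<in> A" "\<exists>y'. (y, y') \<in> E \<and> y' \<notin> A" for y
        proof -
          obtain y' where y': "(y, y') \<in> E" "y' \<notin> A" using \<open>\<exists>y'. _ y'\<close> by blast
          then have "proj x s y' > real j + 1" using edge_in by (auto simp: A_def)
          then have "real j \<le> proj x s y" using proj_edge[OF V(1,2) y'(1)] by linarith
          then show ?thesis using IH that by (auto simp: A_def mult_ac)
        qed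
      qed (use bA less.prems in \<open>auto simp: A_def\<close>)
      show ?thesis
      proof (cases "L \<le> gd_set A b")
        case True
        have "(1 / t) ^ gd_set A b \<le> (1 / t) ^ L"
          using True t_gt_1 by (intro power_decreasing) auto
        then have tA: "(1 / t) ^ gd_set A b \<le> \<epsilon> ^ (2 * R')" using L by linarith
        have "G w\<^sub>0 x \<le> (1 / \<epsilon>) ^ R' * G w x"
          by (rule harnack_inv[OF superharmonic_G[OF V(1)] less.prems(1) w\<^sub>0(1) ww])
        moreover have "Gt b w\<^sub>0 \<le> (1 / \<epsilon>) ^ R' * Gt b w"
          using Gs_harnack_right_inv[OF less.prems(2,1) w\<^sub>0(1) ww, of t] t_ge_1 by simp
        ultimately have "(C * G w\<^sub>0 x) * (1 / t) ^ gd_set A b * Gt b w\<^sub>0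
            \<le> (C * ((1 / \<epsilon>) ^ R' * G w x)) * \<epsilon> ^ (2 * R') * ((1 / \<epsilon>) ^ R' * Gt b w)"
          using C1 tA G_nonneg Gt_nonneg V w\<^sub>0 less.prems t_gt_1 eps_pos
          by (intro mult_mono mult_nonneg_nonneg) auto
        also have "\<dots> = C * Gt b w * G w x"
        proof -
          have "(1 / \<epsilon>) ^ R' * (1 / \<epsilon>) ^ R' * \<epsilon> ^ (2 * R') = 1"
            using eps_pos by (simp add: mult_2 power_add power_one_over)
          moreover have "(C * (a * G w x)) * e * (a * Gt b w) = (a * a * e) * (C * Gt b w * G w x)"
            for a e :: real by simp
          ultimately show ?thesis by (simp only: mult_1)
        qed
        finally show ?thesis using decay by linarith
      next
        case False
        have "real (gd b w) \<le> offset x s b + \<bar>proj x s b - (real j + R)\<bar> + 4 * \<delta>"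
          using gd_geodesic_point_le[OF V(1,2) less.prems(2,1,3)] j by simp
        also have "\<dots> \<le> real K"
          using dist False less.prems(4) j by (simp add: K_def R_def)
        finally show ?thesis using near[OF V(1) less.prems(1,2), of K] by simp
      qed
    qed
  qed
  then show ?thesis using C1 by blast
qed

text \<open>The two halves, seen from \<open>x\<close> and from \<open>s\<close>, are glued along the vertices that project next to
  the waypoint: \<open>G(s, x) \<le> \<Sum>\<^sub>b G(s, b) C Gt(b, w) G(w, x)\<close>, and \<open>G(s, b)\<close> is bounded by
  \<open>G(s, w) Gt(w, b)\<close> up to a constant.\<close>

theorem ancona:
  "\<exists>C\<ge>1. \<forall>x\<in>V. \<forall>s\<in>V. \<forall>w\<in>V. gd x w + gd w s = gd x s \<longrightarrow> G s x \<le> C * G s w * G w x"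
proof -
  obtain C\<^sub>1 where C1: "1 \<le> C\<^sub>1" and half: "\<And>x s w b. \<lbrakk>x \<in> V; s \<in> V; w \<in> V; b \<in> V;
      gd x w + gd w s = gd x s; real (gd x w) \<le> proj x s b\<rbrakk> \<Longrightarrow> G b x \<le> C\<^sub>1 * Gt b w * G w x"
    using ancona_half by blast
  define M where "M = 1 / (1 - t * \<theta>)\<^sup>2"
  define C where "C = (1 / \<epsilon>) ^ 2 + C\<^sub>1 * (C\<^sub>1 * (1 / \<epsilon>) ^ 2 * M)"
  have M0: "0 \<le> M" by (simp add: M_def)
  have "G s x \<le> C * G s w * G w x"
    if V: "x \<in> V" "s \<in> V" "w \<in> V" and w: "gd x w + gd w s = gd x s" for x s w
  proof -
    have pos: "0 \<le> G s w" "0 \<le> G w x" using G_nonneg V by auto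
    show ?thesis
    proof (cases "gd w s \<le> 1")
      case True
      have "G s x \<le> (1 / \<epsilon>) ^ 1 * G w x"
        by (rule harnack_inv[OF superharmonic_G[OF V(1)] V(3,2) True])
      moreover have "1 \<le> (1 / \<epsilon>) ^ 1 * G s w"
        using harnack_inv[OF superharmonic_G[OF V(3)] V(2,3), of 1] True gd_sym[OF V(2,3)] G_diag[OF V(3)]
        by simp
      ultimately have "G s x * 1 \<le> ((1 / \<epsilon>) ^ 1 * G w x) * ((1 / \<epsilon>) ^ 1 * G s w)"
        using eps_pos pos by (intro mult_mono) auto
      also have "\<dots> = (1 / \<epsilon>) ^ 2 * G s w * G w x" by (simp add: power2_eq_square)
      also have "\<dots> \<le> C * G s w * G w x"
        unfolding C_def using pos C1 M0 by (intro mult_right_mono) auto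
      finally show ?thesis by simp
    next
      case False
      obtain w' where w': "w' \<in> V" "gd w w' = 1" "gd w' s = gd w s - 1"
        using geodesic_point[OF V(3,2), of 1] False by auto
      define j where "j = gd x w"
      have s: "gd s w' + gd w' x = gd s x" "gd s w' = gd x s - j - 1"
        using gd_triangle[OF V(1,3) w'(1)] gd_triangle[OF V(1) w'(1) V(2)] w' w False
          gd_sym[OF V(1,2)] gd_sym[OF w'(1) V(1)] gd_sym[OF w'(1) V(2)] by (auto simp: j_def)
      define Band where "Band = {b \<in> V. real j \<le> proj x s b \<and> proj x s b \<le> real j + 1}"
      have BV: "Band \<subseteq> V" by (auto simp: Band_def)
      have far: "G s b \<le> (C\<^sub>1 * (1 / \<epsilon>) ^ 2 * G s w) * Gt w b" if b: "b \<in> Band" for b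
      proof -
        have bV: "b \<in> V" using b BV by auto
        have "real (gd s w') \<le> proj s x b"
          using b s(2) w False gd_sym[OF V(1,2)] gd_sym[OF bV V(1)] gd_sym[OF bV V(2)]
          by (auto simp: Band_def proj_def j_def of_nat_diff field_simps)
        from half[OF V(2,1) w'(1) bV s(1) this] have "G b s \<le> C\<^sub>1 * Gt b w' * G w' s" .
        also have "\<dots> \<le> C\<^sub>1 * ((1 / \<epsilon>) ^ 1 * Gt b w) * ((1 / \<epsilon>) ^ 1 * G w s)"
          using Gs_harnack_right_inv[OF bV V(3) w'(1), of 1 t]
            harnack_inv[OF superharmonic_G[OF V(2)] V(3) w'(1), of 1]
            w' C1 t_ge_1 Gt_nonneg[OF bV V(3)] Gt_nonneg[OF bV w'(1)] G_nonneg[OF w'(1) V(2)] eps_pos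
          by (intro mult_mono mult_nonneg_nonneg) auto
        also have "\<dots> = C\<^sub>1 * (1 / \<epsilon>) ^ 2 * Gt b w * G w s" by (simp add: power2_eq_square)
        finally have "m b * G b s \<le> m b * (C\<^sub>1 * (1 / \<epsilon>) ^ 2 * Gt b w * G w s)"
          using m_pos[OF bV] by (intro mult_left_mono) auto
        also have "\<dots> = C\<^sub>1 * (1 / \<epsilon>) ^ 2 * (m b * Gt b w) * G w s" by simp
        also have "m b * Gt b w = m w * Gt w b"
          using Gs_reversible[OF bV V(3)] t_ge_1 by simp
        also have "C\<^sub>1 * (1 / \<epsilon>) ^ 2 * (m w * Gt w b) * G w s
            = C\<^sub>1 * (1 / \<epsilon>) ^ 2 * Gt w b * (m w * G w s)" by simp
        also have "m w * G w s = m s * G s w" using Gs_reversible[OF V(3,2)] t_ge_1 by simp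
        finally have "m s * G s b \<le> m s * ((C\<^sub>1 * (1 / \<epsilon>) ^ 2 * G s w) * Gt w b)"
          using Gs_reversible[OF bV V(2)] t_ge_1 by (simp add: mult_ac)
        then show ?thesis using m_pos[OF V(2)] by simp
      qed
      have fin: "(\<Sum>b\<in>B. G y b * Gt b w) \<le> h y / h w * M" if "finite B" "B \<subseteq> Band" "y \<in> V" for B y
      proof -
        have "(\<Sum>b\<in>B. G y b * Gt b w) \<le> (\<Sum>b\<in>B. Gt y b * Gt b w)"
          using that BV V G_le_Gt Gt_nonneg by (intro sum_mono mult_right_mono) auto
        also have "\<dots> \<le> h y / h w * M"
          using sum_Gt_Gt_le[OF that(1) _ that(3) V(3)] that BV by (simp add: M_def)
        finally show ?thesis .
      qed
      have smb: "(\<lambda>b. G y b * Gt b w) summable_on Band" if "y \<in> V" for y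
      proof (rule nonneg_bdd_above_summable_on)
        show "0 \<le> G y b * Gt b w" if "b \<in> Band" for b
          using that BV V \<open>y \<in> V\<close> G_nonneg Gt_nonneg by (auto intro!: mult_nonneg_nonneg)
        show "bdd_above (sum (\<lambda>b. G y b * Gt b w) ` {F. F \<subseteq> Band \<and> finite F})"
          using fin[OF _ _ that] by (intro bdd_aboveI[where M = "h y / h w * M"]) auto
      qed
      define S where "S = (\<lambda>y. \<Sum>\<^sub>\<infinity>b\<in>Band. G y b * Gt b w)"
      have S0: "0 \<le> S y" if "y \<in> V" for y
        unfolding S_def using that BV V G_nonneg Gt_nonneg
        by (intro infsum_nonneg) (auto intro!: mult_nonneg_nonneg)
      have Ssup: "avg S y \<le> S y" if y: "y \<in> V" for y
      proof -
        have hs: "((\<lambda>b. \<Sum>z\<in>E `` {y}. P y z * (G z b * Gt b w)) has_sum avg S y) Band"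
          unfolding avg_def S_def using nb_in smb finite_nb
          by (intro has_sum_finite_sum has_sum_cmult_right has_sum_infsum) auto
        then have "avg S y = (\<Sum>\<^sub>\<infinity>b\<in>Band. \<Sum>z\<in>E `` {y}. P y z * (G z b * Gt b w))"
          by (simp add: infsumI)
        also have "\<dots> \<le> S y"
          unfolding S_def
        proof (rule infsum_mono)
          show "(\<lambda>b. \<Sum>z\<in>E `` {y}. P y z * (G z b * Gt b w)) summable_on Band"
            using hs by (auto simp: summable_on_def)
          show "(\<Sum>z\<in>E `` {y}. P y z * (G z b * Gt b w)) \<le> G y b * Gt b w" if "b \<in> Band" for b
          proof -
            have bV: "b \<in> V" using that BV by auto
            have "(\<Sum>z\<in>E `` {y}. P y z * (G z b * Gt b w)) = avg (\<lambda>z. G z b) y * Gt b w"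
              by (simp add: avg_def sum_distrib_right mult.assoc)
            also have "\<dots> \<le> G y b * Gt b w"
              using superharmonicD(2)[OF superharmonic_G[OF bV] y] Gt_nonneg[OF bV V(3)]
              by (intro mult_right_mono) auto
            finally show ?thesis .
          qed
        qed (rule smb[OF y])
        finally show ?thesis .
      qed
      have Sband: "Gt y w \<le> S y" if "y \<in> Band" for y
      proof -
        have yV: "y \<in> V" using that BV by auto
        have "1 * Gt y w \<le> G y y * Gt y w"
          using G_diag[OF yV] Gt_nonneg[OF yV V(3)] by (intro mult_right_mono) auto
        also have "\<dots> = (\<Sum>b\<in>{y}. G y b * Gt b w)" by simp
        also have "\<dots> \<le> S y"
          unfolding S_def using that BV V yV G_nonneg Gt_nonneg
          by (intro finite_sum_le_infsum smb) (auto intro!: mult_nonneg_nonneg)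
        finally show ?thesis by simp
      qed
      have pj: "proj x s s = gd x s" "proj x s x = 0"
        using gd_sym[OF V(1,2)] by (auto simp: proj_def)
      have "G s x \<le> (C\<^sub>1 * G w x) * S s"
      proof (rule domination[of "{b \<in> V. real j + 1 < proj x s b}" "\<lambda>b. G b x" _ "\<lambda>b. Gt b x" 1])
        show "t_superharmonic (\<lambda>b. Gt b x)" by (rule t_superharmonic_Gt[OF V(1)])
        show "G b x \<le> avg (\<lambda>b. G b x) b" if "b \<in> {b \<in> V. real j + 1 < proj x s b}" for b
          using that avg_G[of b x] V pj by auto
        show "avg (\<lambda>y. C\<^sub>1 * G w x * S y) b \<le> C\<^sub>1 * G w x * S b"
          if "b \<in> {b \<in> V. real j + 1 < proj x s b}" for b
          using that Ssup[of b] C1 pos by (subst avg_cmult) (auto intro!: mult_left_mono)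
        show "0 \<le> C\<^sub>1 * G w x * S b" if "b \<in> V" for b using S0[OF that] C1 pos by simp
        show "G y x \<le> C\<^sub>1 * G w x * S y"
          if "b \<in> {b \<in> V. real j + 1 < proj x s b}" "(b, y) \<in> E"
            "y \<notin> {b \<in> V. real j + 1 < proj x s b}" for b y
        proof -
          have y: "y \<in> Band"
            using that proj_edge[OF V(1,2) that(2)] edge_in[OF that(2)] by (auto simp: Band_def)
          then have "G y x \<le> C\<^sub>1 * Gt y w * G w x"
            using half[OF V _ w] BV by (auto simp: Band_def j_def)
          also have "\<dots> \<le> C\<^sub>1 * S y * G w x"
            using Sband[OF y] C1 pos by (intro mult_right_mono mult_left_mono) auto
          finally show ?thesis by (simp add: mult_ac)
        qed
        show "s \<in> {b \<in> V. real j + 1 < proj x s b}" using False w pj V by (simp add: j_def)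
      qed (use G_le_Gt V in auto)
      moreover have "S s \<le> (C\<^sub>1 * (1 / \<epsilon>) ^ 2 * G s w) * M"
        unfolding S_def
      proof (rule infsum_le_finite_sums[OF smb[OF V(2)]])
        fix F assume F: "finite F" "F \<subseteq> Band"
        have "(\<Sum>b\<in>F. G s b * Gt b w) \<le> (\<Sum>b\<in>F. (C\<^sub>1 * (1 / \<epsilon>) ^ 2 * G s w) * Gt w b * Gt b w)"
          using F far BV Gt_nonneg V by (intro sum_mono mult_right_mono) auto
        also have "\<dots> = (C\<^sub>1 * (1 / \<epsilon>) ^ 2 * G s w) * (\<Sum>b\<in>F. Gt w b * Gt b w)"
          by (simp add: sum_distrib_left mult.assoc)
        also have "\<dots> \<le> (C\<^sub>1 * (1 / \<epsilon>) ^ 2 * G s w) * M"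
          using sum_Gt_Gt_le[OF F(1) _ V(3,3)] F BV C1 pos eps_pos h_pos[OF V(3)]
          by (intro mult_left_mono) (auto simp: M_def)
        finally show "(\<Sum>b\<in>F. G s b * Gt b w) \<le> (C\<^sub>1 * (1 / \<epsilon>) ^ 2 * G s w) * M" .
      qed
      ultimately have "G s x \<le> (C\<^sub>1 * G w x) * ((C\<^sub>1 * (1 / \<epsilon>) ^ 2 * G s w) * M)"
        using C1 pos by (smt (verit) mult_left_mono mult_nonneg_nonneg)
      also have "\<dots> = (C\<^sub>1 * (C\<^sub>1 * (1 / \<epsilon>) ^ 2 * M)) * G s w * G w x" by (simp add: mult_ac)
      also have "\<dots> \<le> C * G s w * G w x"
        unfolding C_def using pos by (intro mult_right_mono) auto
      finally show ?thesis .
    qed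
  qed
  moreover have "0 \<le> C\<^sub>1 * (C\<^sub>1 * (1 / \<epsilon>) ^ 2 * M)" using C1 M0 by simp
  then have "1 \<le> C" unfolding C_def using inv_eps_ge_1[of 2] by linarith
  ultimately show ?thesis by blast
qed

lemma ancona_near_geodesic:
  "\<exists>C\<ge>1. \<forall>x\<in>V. \<forall>s\<in>V. \<forall>w\<in>V. gd x w + gd w s \<le> gd x s + e \<longrightarrow> G s x \<le> C * G s w * G w x"
proof -
  obtain C\<^sub>1 where C1: "1 \<le> C\<^sub>1" and A: "\<And>x s w. \<lbrakk>x \<in> V; s \<in> V; w \<in> V;
      gd x w + gd w s = gd x s\<rbrakk> \<Longrightarrow> G s x \<le> C\<^sub>1 * G s w * G w x"
    using ancona by blast
  define K where "K = e + 1 + 4 * \<delta>"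
  define C where "C = C\<^sub>1 * (1 / \<epsilon>) ^ (2 * K)"
  have "G s x \<le> C * G s w * G w x"
    if V: "x \<in> V" "s \<in> V" "w \<in> V" and w: "gd x w + gd w s \<le> gd x s + e" for x s w
  proof -
    have w': "real (gd x w) + real (gd w s) \<le> real (gd x s) + real e" using w by linarith
    have pr: "0 \<le> proj x s w" "proj x s w \<le> gd x s" "offset x s w \<le> e"
      using gd_triangle_real[OF V(3,1,2)] gd_triangle_real[OF V(3,2,1)] gd_triangle_real[OF V(1,3,2)]
        gd_sym[OF V(1,2)] gd_sym[OF V(1,3)] w' by (auto simp: proj_def offset_def)
    define j where "j = nat \<lfloor>proj x s w\<rfloor>"
    have j: "real j \<le> proj x s w" "proj x s w < real j + 1" using pr by (auto simp: j_def)
    then have "j \<le> gd x s" using pr by linarith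
    then obtain v where v: "v \<in> V" "gd x v = j" "gd v s = gd x s - j"
      using geodesic_point[OF V(1,2)] by auto
    then have v': "gd x v + gd v s = gd x s" using \<open>j \<le> gd x s\<close> by simp
    have "real (gd w v) \<le> real K"
      using gd_geodesic_point_le[OF V(1,2,3) v(1) v'] pr j v by (simp add: K_def)
    then have wv: "gd w v \<le> K" by simp
    have "G s x \<le> C\<^sub>1 * G s v * G v x" by (rule A[OF V(1,2) v(1) v'])
    also have "\<dots> \<le> C\<^sub>1 * ((1 / \<epsilon>) ^ K * G s w) * ((1 / \<epsilon>) ^ K * G w x)"
      using Gs_harnack_right_inv[OF V(2,3) v(1) wv, of 1] harnack_inv[OF superharmonic_G[OF V(1)] V(3) v(1) wv]
        C1 t_ge_1 G_nonneg V v eps_pos by (intro mult_mono mult_nonneg_nonneg) auto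
    also have "\<dots> = C * G s w * G w x" by (simp add: C_def power_add mult_2)
    finally show ?thesis .
  qed
  moreover have "1 \<le> C" unfolding C_def using mult_mono[OF C1 inv_eps_ge_1[of "2 * K"]] C1 by simp
  ultimately show ?thesis by blast
qed

text \<open>If, seen from the root, \<open>b\<close> lies behind \<open>w\<close> and \<open>x\<close> does not, then \<open>w\<close> is close to a geodesic
  from \<open>x\<close> to \<open>b\<close>. The thresholds are such that every vertex can take the role of
  \<open>b\<close> in the first variant or that of \<open>x\<close> in the second.\<close>

lemma ancona_separated:
  "\<exists>C\<ge>1. \<forall>x\<in>V. \<forall>b\<in>V. \<forall>w\<in>V. real (lev w) - 2 * \<delta> \<le> gp b w \<and> gp x w < real (lev w) - 3 * \<delta> \<or>
     real (lev w) - \<delta> \<le> gp b w \<and> gp x w < real (lev w) - 2 * \<delta>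
     \<longrightarrow> G x b \<le> C * G x w * G w b \<and> G b x \<le> C * G b w * G w x"
proof -
  obtain C where C1: "1 \<le> C" and A: "\<And>x s w. \<lbrakk>x \<in> V; s \<in> V; w \<in> V;
      gd x w + gd w s \<le> gd x s + 6 * \<delta>\<rbrakk> \<Longrightarrow> G s x \<le> C * G s w * G w x"
    using ancona_near_geodesic[of "6 * \<delta>"] by blast
  have "G x b \<le> C * G x w * G w b \<and> G b x \<le> C * G b w * G w x"
    if V: "x \<in> V" "b \<in> V" "w \<in> V"
      and c: "real (lev w) - real c \<le> gp b w" "gp x w < real (lev w) - real c - \<delta>" "c \<le> 2 * \<delta>"
    for x b w c
  proof -
    have "min (gp x b) (gp b w) - \<delta> \<le> gp x w" by (rule hyperbolic_ineq[OF V(1,3,2)])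
    then have "gp x b - gp x w \<le> \<delta>" using c by (simp add: min_def algebra_simps split: if_splits)
    then have "real (gd x w) + real (gd w b) \<le> real (gd x b) + 6 * \<delta>"
      using c gp_sym[OF V(2,3)] unfolding gromov_product_def by (simp add: field_simps)
    then have "gd x w + gd w b \<le> gd x b + 6 * \<delta>" by linarith
    then show ?thesis using A[OF V(1,2,3)] A[OF V(2,1,3)] gd_sym V by (simp add: add.commute)
  qed
  from this[where c = "2 * \<delta>"] this[where c = \<delta>] show ?thesis using C1 by (intro exI[of _ C]) auto
qed

end

section \<open>Harmonic functions at infinity\<close>

lemma pointwise_convergent_subsequence:
  fixes f :: "nat \<Rightarrow> 'i \<Rightarrow> real"
  assumes "countable I" and bd: "\<And>i n. i \<in> I \<Longrightarrow> \<bar>f n i\<bar> \<le> B i"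
  obtains r where "strict_mono r" "\<And>i. i \<in> I \<Longrightarrow> convergent (\<lambda>n. f (r n) i)"
proof (cases "I = {}")
  case False
  define e where "e = from_nat_into I"
  have e: "e k \<in> I" for k using False by (simp add: e_def from_nat_into)
  interpret subseqs "\<lambda>k s. convergent (\<lambda>n. f (s n) (e k))"
  proof
    fix k and s :: "nat \<Rightarrow> nat" assume "strict_mono s"
    have "bounded (range (\<lambda>n. f (s n) (e k)))"
      using bd[OF e] by (intro boundedI[where B = "B (e k)"]) auto
    then obtain l r where "strict_mono r" "((\<lambda>n. f (s n) (e k)) \<circ> r) \<longlonglongrightarrow> l"
      using bounded_imp_convergent_subsequence by blast
    then show "\<exists>r. strict_mono r \<and> convergent (\<lambda>n. f ((s \<circ> r) n) (e k))"
      by (auto simp: o_def convergent_def)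
  qed
  have diag: "convergent (\<lambda>n. f ((diagseq \<circ> (+) (Suc k)) n) (e k))" for k
  proof (rule diagseq_holds)
    fix k and s r :: "nat \<Rightarrow> nat"
    assume "strict_mono r" "convergent (\<lambda>n. f (s n) (e k))"
    then show "convergent (\<lambda>n. f ((s \<circ> r) n) (e k))"
      using convergent_subseq_convergent[of "\<lambda>n. f (s n) (e k)" r] by (simp add: o_def)
  qed
  have "convergent (\<lambda>n. f (diagseq (n + Suc k)) (e k))" for k
  proof -
    have eq: "diagseq (n + Suc k) = (diagseq \<circ> (+) (Suc k)) n" for n by (simp add: add.commute)
    show ?thesis unfolding eq by (rule diag)
  qed
  then have "convergent (\<lambda>n. f (diagseq n) (e k))" for k
    by (rule iffD1[OF convergent_ignore_initial_segment[of "\<lambda>n. f (diagseq n) (e k)" "Suc k"]])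
  moreover have "\<exists>k. e k = i" if "i \<in> I" for i
    using from_nat_into_surj[OF assms(1) that] by (simp add: e_def)
  ultimately show ?thesis using that[OF subseq_diagseq] by metis
qed (use that[of id] in \<open>auto simp: strict_mono_def\<close>)

context hyperbolic_graph
begin

definition gromov_seq :: "(nat \<Rightarrow> 'v) \<Rightarrow> bool" where
  "gromov_seq z \<longleftrightarrow> (\<forall>n. z n \<in> V) \<and> (\<forall>k. \<exists>n\<^sub>0. \<forall>i\<ge>n\<^sub>0. \<forall>j\<ge>n\<^sub>0. real k \<le> gp (z i) (z j))"

text \<open>A gate of \<open>z\<close> is a vertex close to every geodesic from the root to a late term of \<open>z\<close>.\<close>

definition gate :: "(nat \<Rightarrow> 'v) \<Rightarrow> 'v \<Rightarrow> bool" where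
  "gate z v \<longleftrightarrow> v \<in> V \<and> (\<forall>\<^sub>F n in sequentially. real (lev v) - \<delta> \<le> gp (z n) v)"

lemma gromov_seq_in: "gromov_seq z \<Longrightarrow> z n \<in> V"
  by (simp add: gromov_seq_def)

lemma gromov_seqE:
  assumes "gromov_seq z"
  obtains n\<^sub>0 where "\<And>i j. i \<ge> n\<^sub>0 \<Longrightarrow> j \<ge> n\<^sub>0 \<Longrightarrow> real k \<le> gp (z i) (z j)"
  using assms unfolding gromov_seq_def by blast

lemma gromov_seq_subseq:
  assumes "gromov_seq z" "strict_mono r"
  shows "gromov_seq (z \<circ> r)"
  unfolding gromov_seq_def
proof (intro conjI allI)
  fix k
  obtain n\<^sub>0 where n\<^sub>0: "\<And>i j. i \<ge> n\<^sub>0 \<Longrightarrow> j \<ge> n\<^sub>0 \<Longrightarrow> real k \<le> gp (z i) (z j)"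
    using gromov_seqE[OF assms(1), of k] by blast
  have "r i \<ge> n\<^sub>0" if "i \<ge> n\<^sub>0" for i using that seq_suble[OF assms(2), of i] by linarith
  then show "\<exists>n\<^sub>0. \<forall>i\<ge>n\<^sub>0. \<forall>j\<ge>n\<^sub>0. real k \<le> gp ((z \<circ> r) i) ((z \<circ> r) j)"
    using n\<^sub>0 by (intro exI[of _ n\<^sub>0]) auto
qed (use assms gromov_seq_in in auto)

lemma gate_subseq: "gate z v \<Longrightarrow> strict_mono r \<Longrightarrow> gate (z \<circ> r) v"
  unfolding gate_def o_def
  using eventually_subseq[of r "\<lambda>n. real (lev v) - \<delta> \<le> gp (z n) v"] by simp

lemma gromov_seq_lev:
  assumes "gromov_seq z"
  shows "\<forall>\<^sub>F n in sequentially. k \<le> lev (z n)"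
proof -
  obtain n\<^sub>0 where "\<And>i j. i \<ge> n\<^sub>0 \<Longrightarrow> j \<ge> n\<^sub>0 \<Longrightarrow> real k \<le> gp (z i) (z j)"
    using gromov_seqE[OF assms, of k] by blast
  then have "\<forall>i\<ge>n\<^sub>0. real k \<le> gp (z i) (z i)" by blast
  then show ?thesis unfolding eventually_sequentially gp_self by auto
qed

lemma gates_exist:
  assumes z: "gromov_seq z" and "k \<le> k'"
  obtains v v' where "gate z v" "gate z v'" "lev v = k" "lev v' = k'" "real k \<le> gp v v'"
proof -
  obtain n\<^sub>0 where n\<^sub>0: "\<And>i j. i \<ge> n\<^sub>0 \<Longrightarrow> j \<ge> n\<^sub>0 \<Longrightarrow> real k' \<le> gp (z i) (z j)"
    using gromov_seqE[OF z, of k'] by blast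
  define y where "y = z n\<^sub>0"
  have y: "y \<in> V" "k' \<le> lev y" using n\<^sub>0[of n\<^sub>0 n\<^sub>0] gromov_seq_in[OF z] by (auto simp: y_def)
  obtain v' where v': "v' \<in> V" "lev v' = k'" "gd v' y = lev y - k'" using ancestor_exists[OF y] .
  obtain v where v: "v \<in> V" "lev v = k" "gd v v' = lev v' - k"
    using ancestor_exists[OF v'(1), of k] v'(2) assms(2) by auto
  have "gd v y \<le> lev y - k"
    using gd_triangle[OF v(1) v'(1) y(1)] v v' y assms(2) by linarith
  then have vy: "real k \<le> gp v y" using v y assms(2) unfolding gromov_product_def by simp
  have v'y: "gp v' y = k'" using gp_ancestor[OF y(2)] v' by simp
  have "gate z u" if "u \<in> V" "lev u \<le> k'" "real (lev u) \<le> gp u y" for u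
    unfolding gate_def eventually_sequentially
  proof (intro conjI exI[of _ n\<^sub>0] allI impI that)
    fix n assume "n\<^sub>0 \<le> n"
    then have "real k' \<le> gp (z n) y" using n\<^sub>0 by (simp add: y_def)
    then show "real (lev u) - \<delta> \<le> gp (z n) u"
      using hyperbolic_ineq[OF gromov_seq_in[OF z] that(1) y(1), of n] that gp_sym[OF that(1) y(1)]
      by (simp add: min_def split: if_splits)
  qed
  then have "gate z v" "gate z v'" using v v' vy v'y assms(2) by auto
  moreover have "gp v v' = k" using gp_ancestor[of k v' v] v v' assms(2) by simp
  ultimately show ?thesis using that v v' by simp
qed

lemma countable_V: "countable V"
proof -
  have "V = (\<Union>n. {x \<in> V. lev x = n})" by auto
  moreover have "countable (\<Union>n. {x \<in> V. lev x = n})"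
    by (intro countable_UN countableI_type countable_finite finite_lev)
  ultimately show ?thesis by simp
qed

text \<open>Levels are finite, so along a subsequence the ancestors at every fixed level become constant.
  Vertices with a common ancestor at level \<open>l\<close> have Gromov product at least \<open>l - \<delta>\<close>.\<close>

lemma gromov_subsequence:
  assumes z: "\<And>n. z n \<in> V" and inf: "\<And>k. \<forall>\<^sub>F n in sequentially. k \<le> lev (z n)"
  obtains r where "strict_mono r" "gromov_seq (z \<circ> r)"
proof -
  define a where "a = (\<lambda>l y. SOME w. w \<in> V \<and> lev w = l \<and> gd w y = lev y - l)"
  have a: "a l y \<in> V" "lev (a l y) = l" "gd (a l y) y = lev y - l" if "y \<in> V" "l \<le> lev y" for l y
    using someI_ex[of "\<lambda>w. w \<in> V \<and> lev w = l \<and> gd w y = lev y - l"] ancestor_exists[OF that]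
    unfolding a_def by blast+
  define f where "f = (\<lambda>n l. if l \<le> lev (z n) then real (to_nat_on V (a l (z n))) else 0)"
  define B where "B = (\<lambda>l. real (Max (insert 0 (to_nat_on V ` {x \<in> V. lev x = l}))))"
  have "\<bar>f n l\<bar> \<le> B l" for n l
  proof (cases "l \<le> lev (z n)")
    case True
    then have "to_nat_on V (a l (z n)) \<in> to_nat_on V ` {x \<in> V. lev x = l}"
      using a[OF z True] by simp
    then have "to_nat_on V (a l (z n)) \<le> Max (insert 0 (to_nat_on V ` {x \<in> V. lev x = l}))"
      using finite_lev by (intro Max_ge) auto
    then show ?thesis using True by (simp add: f_def B_def)
  qed (simp add: f_def B_def)
  then obtain r where r: "strict_mono r" "\<And>l. convergent (\<lambda>n. f (r n) l)"
    using pointwise_convergent_subsequence[of UNIV f B] by auto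
  have "\<exists>n\<^sub>0. \<forall>i\<ge>n\<^sub>0. \<forall>j\<ge>n\<^sub>0. real k \<le> gp (z (r i)) (z (r j))" for k
  proof -
    define l where "l = k + \<delta>"
    obtain L where "(\<lambda>n. f (r n) l) \<longlonglongrightarrow> L" using r(2) by (auto simp: convergent_def)
    then have "\<forall>\<^sub>F n in sequentially. \<bar>f (r n) l - L\<bar> < 1 / 2"
      using tendstoD[of _ L sequentially "1 / 2"] by (simp add: dist_real_def)
    moreover have "\<forall>\<^sub>F n in sequentially. l \<le> lev (z (r n))"
      by (rule eventually_subseq[OF r(1) inf])
    ultimately have "\<forall>\<^sub>F n in sequentially. \<bar>f (r n) l - L\<bar> < 1 / 2 \<and> l \<le> lev (z (r n))"
      by (rule eventually_conj)
    then obtain n\<^sub>0 where n\<^sub>0: "\<And>n. n \<ge> n\<^sub>0 \<Longrightarrow> \<bar>f (r n) l - L\<bar> < 1 / 2 \<and> l \<le> lev (z (r n))"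
      unfolding eventually_sequentially by blast
    have "real k \<le> gp (z (r i)) (z (r j))" if "i \<ge> n\<^sub>0" "j \<ge> n\<^sub>0" for i j
    proof -
      have l: "l \<le> lev (z (r i))" "l \<le> lev (z (r j))" using n\<^sub>0 that by auto
      have "\<bar>f (r i) l - f (r j) l\<bar> < 1" using n\<^sub>0[OF that(1)] n\<^sub>0[OF that(2)] by linarith
      then have "to_nat_on V (a l (z (r i))) = to_nat_on V (a l (z (r j)))"
        using l by (simp add: f_def)
      then have eq: "a l (z (r i)) = a l (z (r j))"
        using a(1)[OF z l(1)] a(1)[OF z l(2)] countable_V by (simp add: to_nat_on_inj)
      have "gp (a l (z (r i))) (z (r i)) = l" "gp (a l (z (r j))) (z (r j)) = l"
        using gp_ancestor[OF l(1)] gp_ancestor[OF l(2)] a[OF z l(1)] a[OF z l(2)] by auto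
      then show ?thesis
        using hyperbolic_ineq[OF z z a(1)[OF z l(1)], of "r i" "r j"] eq gp_sym[OF z a(1)[OF z l(1)], of "r i"]
        by (simp add: l_def)
    qed
    then show ?thesis by blast
  qed
  then have "gromov_seq (z \<circ> r)" using z by (simp add: gromov_seq_def)
  with r(1) show ?thesis by (rule that)
qed

end

context hyperbolic_walk
begin

definition harmonic :: "('v \<Rightarrow> real) \<Rightarrow> bool" where
  "harmonic u \<longleftrightarrow> (\<forall>x\<in>V. 0 \<le> u x \<and> avg u x = u x)"

lemma avg_potential:
  assumes "finite A" "A \<subseteq> V" "x \<in> V"
  shows "avg (\<lambda>x. \<Sum>a\<in>A. \<mu> a * G x a) x = (\<Sum>a\<in>A. \<mu> a * G x a) - (if x \<in> A then \<mu> x else 0)"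
proof -
  have "avg (\<lambda>x. \<Sum>a\<in>A. \<mu> a * G x a) x = (\<Sum>a\<in>A. \<mu> a * avg (\<lambda>x. G x a) x)"
    by (subst avg_sum) (simp add: avg_cmult)
  also have "\<dots> = (\<Sum>a\<in>A. \<mu> a * G x a - (if x = a then \<mu> a else 0))"
    using avg_G[OF assms(3)] assms(2) by (intro sum.cong) (auto simp: right_diff_distrib)
  also have "\<dots> = (\<Sum>a\<in>A. \<mu> a * G x a) - (if x \<in> A then \<mu> x else 0)"
    using assms(1) by (simp add: sum_subtractf sum.delta)
  finally show ?thesis .
qed

lemma nonneg_harmonic_iff: "nonneg_harmonic V P u \<longleftrightarrow> harmonic u"
  unfolding nonneg_harmonic_def harmonic_def using infsum_P by simp

lemma harmonic_superharmonic: "harmonic u \<Longrightarrow> superharmonic u"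
  by (simp add: harmonic_def superharmonic_def)

lemma harmonicD: "harmonic u \<Longrightarrow> x \<in> V \<Longrightarrow> 0 \<le> u x" "harmonic u \<Longrightarrow> x \<in> V \<Longrightarrow> avg u x = u x"
  by (auto simp: harmonic_def)

abbreviation "Kr \<equiv> martin_kernel V P o\<^sub>0"

lemma Kr_eq: "Kr x y = G x y / G o\<^sub>0 y"
  by (simp add: martin_kernel_def green_eq)

lemma Kr_nonneg: "x \<in> V \<Longrightarrow> y \<in> V \<Longrightarrow> 0 \<le> Kr x y"
  unfolding Kr_eq using G_nonneg base_in by simp

lemma Kr_le:
  assumes "x \<in> V" "y \<in> V"
  shows "Kr x y \<le> (1 / \<epsilon>) ^ lev x"
proof -
  have "G x y \<le> (1 / \<epsilon>) ^ lev x * G o\<^sub>0 y"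
    using harnack_inv[OF superharmonic_G[OF assms(2)] base_in assms(1)] gd_base[OF assms(1)] by simp
  then show ?thesis unfolding Kr_eq using G_pos[OF base_in assms(2)] by (simp add: field_simps)
qed

definition martin_limit :: "(nat \<Rightarrow> 'v) \<Rightarrow> ('v \<Rightarrow> real) \<Rightarrow> bool" where
  "martin_limit z f \<longleftrightarrow> (\<forall>x\<in>V. (\<lambda>n. Kr x (z n)) \<longlonglongrightarrow> f x)"

lemma martin_limit_harmonic:
  assumes z: "gromov_seq z" and f: "martin_limit z f"
  shows "harmonic f" "f o\<^sub>0 = 1"
proof -
  have zV: "z n \<in> V" for n by (rule gromov_seq_in[OF z])
  have lim: "(\<lambda>n. Kr x (z n)) \<longlonglongrightarrow> f x" if "x \<in> V" for x using f that by (simp add: martin_limit_def)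
  show "harmonic f"
    unfolding harmonic_def
  proof (intro ballI conjI)
    fix x assume x: "x \<in> V"
    show "0 \<le> f x" by (rule LIMSEQ_le_const[OF lim[OF x]]) (use Kr_nonneg[OF x zV] in blast)
    have "(\<lambda>n. avg (\<lambda>y. Kr y (z n)) x) \<longlonglongrightarrow> avg f x"
      unfolding avg_def by (intro tendsto_sum tendsto_mult tendsto_const lim nb_in)
    moreover have "\<forall>\<^sub>F n in sequentially. avg (\<lambda>y. Kr y (z n)) x = Kr x (z n)"
      using gromov_seq_lev[OF z, of "Suc (lev x)"]
    proof eventually_elim
      case (elim n)
      then have "x \<noteq> z n" by auto
      then have "avg (\<lambda>y. G y (z n)) x = G x (z n)" using avg_G[OF x zV] by simp
      then show ?case using avg_cmult[of "1 / G o\<^sub>0 (z n)" "\<lambda>y. G y (z n)" x] by (simp add: Kr_eq)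
    qed
    ultimately have "(\<lambda>n. Kr x (z n)) \<longlonglongrightarrow> avg f x" by (rule Lim_transform_eventually)
    then show "avg f x = f x" using LIMSEQ_unique[OF _ lim[OF x]] by blast
  qed
  have "Kr o\<^sub>0 (z n) = 1" for n using G_pos[OF base_in zV, of n] by (simp add: Kr_eq)
  then have "(\<lambda>n. Kr o\<^sub>0 (z n)) \<longlonglongrightarrow> 1" by simp
  then show "f o\<^sub>0 = 1" using LIMSEQ_unique[OF lim[OF base_in]] by blast
qed

text \<open>One constant for Ancona's inequality, fixed so that the bounds for different harmonic functions
  share it.\<close>

definition sep_const :: real where
  "sep_const = (SOME C. C \<ge> 1 \<and> (\<forall>x\<in>V. \<forall>b\<in>V. \<forall>w\<in>V.
     real (lev w) - 2 * \<delta> \<le> gp b w \<and> gp x w < real (lev w) - 3 * \<delta> \<or>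
     real (lev w) - \<delta> \<le> gp b w \<and> gp x w < real (lev w) - 2 * \<delta>
     \<longrightarrow> G x b \<le> C * G x w * G w b \<and> G b x \<le> C * G b w * G w x))"

lemma sep_const:
  shows "1 \<le> sep_const"
    and "x \<in> V \<Longrightarrow> b \<in> V \<Longrightarrow> w \<in> V \<Longrightarrow>
      real (lev w) - 2 * \<delta> \<le> gp b w \<and> gp x w < real (lev w) - 3 * \<delta> \<or>
      real (lev w) - \<delta> \<le> gp b w \<and> gp x w < real (lev w) - 2 * \<delta> \<Longrightarrow>
      G x b \<le> sep_const * G x w * G w b \<and> G b x \<le> sep_const * G b w * G w x"
  using someI_ex[OF ancona_separated] unfolding sep_const_def[symmetric] by blast+

lemma martin_limit_le:
  assumes z: "gromov_seq z" and f: "martin_limit z f" and v: "gate z v"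
    and x: "x \<in> V" "gp x v < real (lev v) - 2 * \<delta>"
  shows "f x \<le> sep_const * G x v * f v"
proof (rule LIMSEQ_le)
  have vV: "v \<in> V" using v by (simp add: gate_def)
  show "(\<lambda>n. Kr x (z n)) \<longlonglongrightarrow> f x" using f x by (simp add: martin_limit_def)
  show "(\<lambda>n. sep_const * G x v * Kr v (z n)) \<longlonglongrightarrow> sep_const * G x v * f v"
    using f vV by (intro tendsto_mult_left) (simp add: martin_limit_def)
  have "\<forall>\<^sub>F n in sequentially. Kr x (z n) \<le> sep_const * G x v * Kr v (z n)"
    using v[unfolded gate_def, THEN conjunct2]
  proof eventually_elim
    case (elim n)
    have zV: "z n \<in> V" by (rule gromov_seq_in[OF z])
    have "G x (z n) \<le> sep_const * G x v * G v (z n)" using sep_const(2)[OF x(1) zV vV] elim x(2) by blast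
    then show ?case using G_pos[OF base_in zV] by (simp add: Kr_eq divide_right_mono)
  qed
  then show "\<exists>N. \<forall>n\<ge>N. Kr x (z n) \<le> sep_const * G x v * Kr v (z n)"
    by (simp add: eventually_sequentially)
qed

text \<open>Balayage onto a finite set: the infimum of all nonnegative superharmonic functions that
  dominate \<open>w\<close> on \<open>A\<close> is harmonic outside \<open>A\<close> and at most a finite sum of Green functions, so
  it is itself such a sum.\<close>

lemma finite_balayage:
  assumes w: "superharmonic w" and A: "finite A" "A \<subseteq> V"
  obtains \<mu> where "\<And>a. a \<in> A \<Longrightarrow> 0 \<le> \<mu> a" "\<And>x. x \<in> V \<Longrightarrow> (\<Sum>a\<in>A. \<mu> a * G x a) \<le> w x"
    "\<And>x. x \<in> A \<Longrightarrow> (\<Sum>a\<in>A. \<mu> a * G x a) = w x"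
proof -
  define Fam where "Fam = {v. superharmonic v \<and> (\<forall>a\<in>A. w a \<le> v a)}"
  define red where "red = (\<lambda>x. Inf ((\<lambda>v. v x) ` Fam))"
  have wF: "w \<in> Fam" using w by (simp add: Fam_def)
  have F0: "0 \<le> v x" if "v \<in> Fam" "x \<in> V" for v x
    using that superharmonicD by (auto simp: Fam_def)
  have red_le: "red x \<le> v x" if "v \<in> Fam" "x \<in> V" for v x
    unfolding red_def using that F0 by (intro cInf_lower bdd_belowI2[where m = 0]) auto
  have red_ge: "c \<le> red x" if "\<And>v. v \<in> Fam \<Longrightarrow> c \<le> v x" for c x
    unfolding red_def using wF that by (intro cInf_greatest) auto
  have red0: "0 \<le> red x" if "x \<in> V" for x using F0 that by (intro red_ge) auto
  have redA: "red a = w a" if "a \<in> A" for a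
  proof (rule antisym)
    show "red a \<le> w a" using red_le[OF wF] that A by auto
    show "w a \<le> red a" using that by (intro red_ge) (auto simp: Fam_def)
  qed
  have red_super: "avg red x \<le> red x" if "x \<in> V" for x
  proof (rule red_ge)
    fix v assume v: "v \<in> Fam"
    have "avg red x \<le> avg v x" using red_le[OF v] edge_in by (intro avg_mono) auto
    also have "\<dots> \<le> v x" using v superharmonicD(2) that by (auto simp: Fam_def)
    finally show "avg red x \<le> v x" .
  qed
  have red_harm: "red x = avg red x" if x: "x \<in> V" "x \<notin> A" for x
  proof (rule antisym[OF _ red_super[OF x(1)]])
    \<comment> \<open>lowering \<open>red\<close> to its average at the single vertex \<open>x\<close> stays in the family\<close>
    define v where "v = red(x := avg red x)"
    have v_le: "v y \<le> red y" for y using red_super[OF x(1)] by (simp add: v_def)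
    have "superharmonic v"
      unfolding superharmonic_def
    proof (intro ballI conjI)
      fix y assume y: "y \<in> V"
      show "0 \<le> v y" using red0 y avg_nonneg[of x red] edge_in by (auto simp: v_def)
      have "avg v y \<le> avg red y" by (rule avg_mono) (rule v_le)
      then show "avg v y \<le> v y" using red_super[OF y] by (auto simp: v_def)
    qed
    then have "v \<in> Fam" using redA x by (auto simp: Fam_def v_def)
    then show "red x \<le> avg red x" using red_le[OF _ x(1)] by (fastforce simp: v_def)
  qed
  define \<mu> where "\<mu> = (\<lambda>a. red a - avg red a)"
  have mu0: "0 \<le> \<mu> a" if "a \<in> A" for a using red_super that A by (auto simp: \<mu>_def)
  define U where "U = (\<lambda>x. \<Sum>a\<in>A. \<mu> a * G x a)"
  have avgU: "avg U x = U x - (if x \<in> A then \<mu> x else 0)" if "x \<in> V" for x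
    unfolding U_def by (rule avg_potential[OF A that])
  have diff_harm: "avg (\<lambda>x. red x - U x) x = red x - U x" if "x \<in> V" for x
    using avgU[OF that] red_harm[OF that] by (auto simp: avg_diff \<mu>_def)
  define g where "g = (\<lambda>x. \<Sum>a\<in>A. (w a + \<mu> a) * Gt x a)"
  have w0: "0 \<le> w a" if "a \<in> A" for a using superharmonicD[OF w] that A by auto
  have g: "t_superharmonic g"
    unfolding t_superharmonic_def
  proof (intro ballI conjI)
    fix x assume x: "x \<in> V"
    show "0 \<le> g x" unfolding g_def using A w0 mu0 Gt_nonneg[OF x] by (intro sum_nonneg) auto
    have "t * avg g x = (\<Sum>a\<in>A. (w a + \<mu> a) * (t * avg (\<lambda>x. Gt x a) x))"
      unfolding g_def by (subst avg_sum) (simp add: avg_cmult sum_distrib_left mult_ac)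
    also have "\<dots> \<le> g x"
      unfolding g_def using A w0 mu0 avg_Gt[OF x] by (intro sum_mono mult_left_mono) auto
    finally show "t * avg g x \<le> g x" .
  qed
  have GA: "(\<lambda>x. \<Sum>a\<in>A. w a * G x a) \<in> Fam"
    unfolding Fam_def superharmonic_def
  proof (intro CollectI conjI ballI)
    fix x assume x: "x \<in> V"
    show "0 \<le> (\<Sum>a\<in>A. w a * G x a)" using A w0 G_nonneg[OF x] by (intro sum_nonneg) auto
    show "avg (\<lambda>x. \<Sum>a\<in>A. w a * G x a) x \<le> (\<Sum>a\<in>A. w a * G x a)"
      using w0 unfolding avg_potential[OF A x] by simp
  next
    fix a assume a: "a \<in> A"
    have "w a * 1 \<le> w a * G a a" using w0[OF a] G_diag a A by (intro mult_left_mono) auto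
    also have "\<dots> \<le> (\<Sum>b\<in>A. w b * G a b)"
      using a A w0 G_nonneg by (intro member_le_sum) (auto intro!: mult_nonneg_nonneg simp: subset_iff)
    finally show "w a \<le> (\<Sum>b\<in>A. w b * G a b)" by simp
  qed
  have bounds: "red x \<le> 1 * g x" "U x \<le> 1 * g x" if x: "x \<in> V" for x
  proof -
    have "red x \<le> (\<Sum>a\<in>A. w a * G x a)" using red_le[OF GA x] .
    also have "\<dots> \<le> g x" unfolding g_def using A w0 mu0 G_le_Gt[OF x] G_nonneg[OF x]
      by (intro sum_mono mult_mono) auto
    finally show "red x \<le> 1 * g x" by simp
    show "U x \<le> 1 * g x" unfolding g_def U_def mult_1 using A w0 mu0 G_le_Gt[OF x] G_nonneg[OF x]
      by (intro sum_mono mult_mono) auto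
  qed
  have U0: "0 \<le> U x" if "x \<in> V" for x
    unfolding U_def using A mu0 G_nonneg[OF that] by (intro sum_nonneg) auto
  have eq: "red x = U x" if x: "x \<in> V" for x
  proof (rule antisym)
    have "red x - U x \<le> 0"
    proof (rule subharmonic_nonpos[OF _ g, of "\<lambda>x. red x - U x" 1])
      fix y assume y: "y \<in> V"
      show "red y - U y \<le> avg (\<lambda>y. max 0 (red y - U y)) y"
        using avg_mono[of y "\<lambda>y. red y - U y" "\<lambda>y. max 0 (red y - U y)"] diff_harm[OF y] by auto
      show "red y - U y \<le> 1 * g y" using bounds[OF y] U0[OF y] by linarith
    qed (rule x)
    then show "red x \<le> U x" by simp
    have "U x - red x \<le> 0"
    proof (rule subharmonic_nonpos[OF _ g, of "\<lambda>x. U x - red x" 1])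
      fix y assume y: "y \<in> V"
      have "avg (\<lambda>x. U x - red x) y = U y - red y" using diff_harm[OF y] by (simp add: avg_diff)
      then show "U y - red y \<le> avg (\<lambda>y. max 0 (U y - red y)) y"
        using avg_mono[of y "\<lambda>y. U y - red y" "\<lambda>y. max 0 (U y - red y)"] by auto
      show "U y - red y \<le> 1 * g y" using bounds[OF y] red0[OF y] by linarith
    qed (rule x)
    then show "U x \<le> red x" by simp
  qed
  show ?thesis
  proof (rule that[of \<mu>])
    show "(\<Sum>a\<in>A. \<mu> a * G x a) \<le> w x" if "x \<in> V" for x
      using eq[OF that] red_le[OF wF that] by (simp add: U_def)
    show "(\<Sum>a\<in>A. \<mu> a * G x a) = w x" if "x \<in> A" for x
      using eq[of x] redA[OF that] that A by (auto simp: U_def)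
  qed (rule mu0)
qed

text \<open>Ancona's inequality for harmonic functions that are bounded by a Martin limit. Such a function
  is, on the ball of radius \<open>n\<close>, a sum of Green functions with poles on the sphere. The terms
  with poles behind the gate \<open>v\<close> satisfy the inequality one by one. The sum of the others is bounded
  by a multiple of \<open>Gt(\<cdot>, v)\<close> that does not depend on \<open>n\<close>: behind \<open>v\<close> by Ancona's inequality, and
  elsewhere because it is bounded by \<open>C f\<close>. As it is harmonic inside the ball, it is of order
  \<open>t\<^sup>-\<^sup>n\<close> at a fixed vertex.\<close>

lemma harmonic_le_gate:
  assumes z: "gromov_seq z" and f: "martin_limit z f"
    and w: "harmonic w" "\<And>x. x \<in> V \<Longrightarrow> w x \<le> C * f x" and C: "0 \<le> C"
    and v: "gate z v" "gate z v'" "lev v + 2 * \<delta> \<le> lev v'" "real (lev v) \<le> gp v v'"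
    and x: "x \<in> V" "gp x v < real (lev v) - 3 * \<delta>"
  shows "w x \<le> sep_const * G x v * w v"
proof -
  have V: "v \<in> V" "v' \<in> V" using v by (auto simp: gate_def)
  note w0 = harmonicD(1)[OF w(1)]
  have f0: "0 \<le> f y" if "y \<in> V" for y
    using martin_limit_harmonic(1)[OF z f] that by (rule harmonicD)
  define M where "M = sep_const * w v + C * sep_const * f v' * (1 / \<epsilon>) ^ gd v v'"
  have step: "w x \<le> sep_const * G x v * w v + M * (1 / t) ^ j * Gt x v" for j
  proof -
    define n where "n = lev x + j"
    define A where "A = {b \<in> V. lev b \<le> n}"
    have A: "finite A" "A \<subseteq> V" using finite_ball by (auto simp: A_def)
    obtain \<mu> where mu: "\<And>a. a \<in> A \<Longrightarrow> 0 \<le> \<mu> a" "\<And>x. x \<in> V \<Longrightarrow> (\<Sum>a\<in>A. \<mu> a * G x a) \<le> w x"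
      "\<And>x. x \<in> A \<Longrightarrow> (\<Sum>a\<in>A. \<mu> a * G x a) = w x"
      by (rule finite_balayage[OF harmonic_superharmonic[OF w(1)] A]) blast
    define A\<^sub>1 where "A\<^sub>1 = {b \<in> A. real (lev v) - 2 * \<delta> \<le> gp b v}"
    define A\<^sub>2 where "A\<^sub>2 = A - A\<^sub>1"
    have A12: "finite A\<^sub>1" "finite A\<^sub>2" "A\<^sub>1 \<subseteq> A" "A\<^sub>2 \<subseteq> A" using A by (auto simp: A\<^sub>1_def A\<^sub>2_def)
    define w\<^sub>1 where "w\<^sub>1 = (\<lambda>x. \<Sum>a\<in>A\<^sub>1. \<mu> a * G x a)"
    define w\<^sub>2 where "w\<^sub>2 = (\<lambda>x. \<Sum>a\<in>A\<^sub>2. \<mu> a * G x a)"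
    have split: "(\<Sum>a\<in>A. \<mu> a * G y a) = w\<^sub>1 y + w\<^sub>2 y" for y
      unfolding w\<^sub>1_def w\<^sub>2_def A\<^sub>2_def using A A12 by (subst sum.subset_diff[of A\<^sub>1 A]) auto
    have nn: "0 \<le> w\<^sub>1 y" "0 \<le> w\<^sub>2 y" if "y \<in> V" for y
      unfolding w\<^sub>1_def w\<^sub>2_def using that mu(1) A A12 G_nonneg
      by (auto intro!: sum_nonneg mult_nonneg_nonneg)
    have le: "w\<^sub>1 y \<le> w y" "w\<^sub>2 y \<le> w y" if "y \<in> V" for y
      using mu(2)[OF that] split[of y] nn[OF that] by linarith+
    have "w\<^sub>1 x \<le> (\<Sum>a\<in>A\<^sub>1. \<mu> a * (sep_const * G x v * G v a))"
      unfolding w\<^sub>1_def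
    proof (intro sum_mono mult_left_mono)
      fix a assume a: "a \<in> A\<^sub>1"
      show "0 \<le> \<mu> a" using a A12 mu(1) by auto
      have aV: "a \<in> V" using a A A12 by auto
      show "G x a \<le> sep_const * G x v * G v a"
        using sep_const(2)[OF x(1) aV V(1)] a x(2) by (auto simp: A\<^sub>1_def)
    qed
    also have "\<dots> = sep_const * G x v * w\<^sub>1 v"
      by (simp add: w\<^sub>1_def sum_distrib_left mult_ac)
    also have "\<dots> \<le> sep_const * G x v * w v"
      using le[OF V(1)] sep_const(1) G_nonneg[OF x(1) V(1)] by (intro mult_left_mono) auto
    finally have part1: "w\<^sub>1 x \<le> sep_const * G x v * w v" .
    have base: "w\<^sub>2 y \<le> M * Gt y v" if y: "y \<in> V" for y
    proof (cases "real (lev v) - \<delta> \<le> gp y v")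
      case True
      have "w\<^sub>2 y \<le> (\<Sum>a\<in>A\<^sub>2. \<mu> a * (sep_const * G y v * G v a))"
        unfolding w\<^sub>2_def
      proof (intro sum_mono mult_left_mono)
        fix a assume a: "a \<in> A\<^sub>2"
        show "0 \<le> \<mu> a" using a A12 mu(1) by auto
        have aV: "a \<in> V" using a A A12 by auto
        show "G y a \<le> sep_const * G y v * G v a"
          using sep_const(2)[OF aV y V(1)] a True by (auto simp: A\<^sub>1_def A\<^sub>2_def)
      qed
      also have "\<dots> = sep_const * G y v * w\<^sub>2 v" by (simp add: w\<^sub>2_def sum_distrib_left mult_ac)
      also have "\<dots> \<le> sep_const * Gt y v * w v"
        using le[OF V(1)] nn[OF V(1)] sep_const(1) G_nonneg[OF y V(1)] G_le_Gt[OF y V(1)]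
        by (intro mult_mono) auto
      also have "\<dots> \<le> M * Gt y v"
        unfolding M_def using C f0[OF V(2)] sep_const(1) eps_pos Gt_nonneg[OF y V(1)]
        by (simp add: algebra_simps)
      finally show ?thesis .
    next
      case False
      have gv': "gp y v' < real (lev v') - 2 * \<delta>"
      proof (rule ccontr)
        assume "\<not> ?thesis"
        then have "real (lev v) \<le> gp y v'" using v(3) by linarith
        then show False using hyperbolic_ineq[OF y V(1,2)] gp_sym[OF V] v(4) False by simp
      qed
      have "w\<^sub>2 y \<le> C * f y" using le[OF y] w(2)[OF y] by linarith
      also have "\<dots> \<le> C * (sep_const * G y v' * f v')"
        using martin_limit_le[OF z f v(2) y gv'] C by (intro mult_left_mono) auto
      also have "\<dots> \<le> C * (sep_const * ((1 / \<epsilon>) ^ gd v v' * Gt y v) * f v')"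
      proof -
        have "G y v' \<le> (1 / \<epsilon>) ^ gd v v' * G y v"
          using Gs_harnack_right_inv[OF y V, of "gd v v'" 1] t_ge_1 by simp
        also have "\<dots> \<le> (1 / \<epsilon>) ^ gd v v' * Gt y v"
          using G_le_Gt[OF y V(1)] eps_pos by (intro mult_left_mono) auto
        finally show ?thesis
          using C sep_const(1) f0[OF V(2)] by (intro mult_left_mono mult_right_mono) auto
      qed
      also have "\<dots> = (C * sep_const * f v' * (1 / \<epsilon>) ^ gd v v') * Gt y v" by (simp add: mult_ac)
      also have "\<dots> \<le> M * Gt y v"
        unfolding M_def using sep_const(1) w0[OF V(1)] Gt_nonneg[OF y V(1)]
        by (intro mult_right_mono) auto
      finally show ?thesis .
    qed
    have harm2: "avg w\<^sub>2 y = w\<^sub>2 y" if y: "y \<in> V" "lev y < n" for y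
    proof -
      have yA: "y \<in> A" using y by (simp add: A_def)
      have nbA: "y' \<in> A" if "(y, y') \<in> E" for y'
        using lev_edge[OF edge_sym[OF that]] y edge_in[OF that] by (simp add: A_def)
      have "avg (\<lambda>x. \<Sum>a\<in>A. \<mu> a * G x a) y = avg w y"
        unfolding avg_def using nbA mu(3) by (intro sum.cong) auto
      then have "\<mu> y = 0" using avg_potential[OF A y(1)] mu(3)[OF yA] yA harmonicD(2)[OF w(1) y(1)] by simp
      then show ?thesis unfolding w\<^sub>2_def using avg_potential[OF A12(2) _ y(1)] A A12 by auto
    qed
    have "w\<^sub>2 y \<le> M * (1 / t) ^ i * Gt y v" if "y \<in> V" "lev y + i \<le> n" for i y
      using that
    proof (induction i arbitrary: y)
      case (Suc i)
      have "w\<^sub>2 y = avg w\<^sub>2 y" using harm2 Suc.prems by simp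
      also have "\<dots> \<le> avg (\<lambda>y. M * (1 / t) ^ i * Gt y v) y"
      proof (rule avg_mono)
        fix y' assume y': "(y, y') \<in> E"
        then show "w\<^sub>2 y' \<le> M * (1 / t) ^ i * Gt y' v"
          using Suc.IH[OF edge_in(2)[OF y']] lev_edge[OF edge_sym[OF y']] Suc.prems by linarith
      qed
      also have "\<dots> = M * (1 / t) ^ Suc i * (t * avg (\<lambda>y. Gt y v) y)"
        using t_gt_1 by (subst avg_cmult) simp
      also have "\<dots> \<le> M * (1 / t) ^ Suc i * Gt y v"
        using avg_Gt[OF Suc.prems(1) V(1)] t_gt_1 C sep_const(1) w0[OF V(1)] f0[OF V(2)] eps_pos
        by (intro mult_left_mono) (auto simp: M_def)
      finally show ?case .
    qed (use base in simp)
    then have "w\<^sub>2 x \<le> M * (1 / t) ^ j * Gt x v" using x by (simp add: n_def)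
    moreover have "w x = w\<^sub>1 x + w\<^sub>2 x" using mu(3)[of x] split[of x] x by (simp add: A_def n_def)
    ultimately show ?thesis using part1 by linarith
  qed
  have "(\<lambda>j. sep_const * G x v * w v + M * (1 / t) ^ j * Gt x v)
      \<longlonglongrightarrow> sep_const * G x v * w v + M * 0 * Gt x v"
    using t_gt_1 by (intro tendsto_intros LIMSEQ_realpow_zero) auto
  then show ?thesis using step by (intro LIMSEQ_le_const) auto
qed

text \<open>Both \<open>u\<close> and \<open>u'\<close> are compared with \<open>G(\<cdot>, v)\<close>: from one side by the hypotheses, and from the
  other because they are superharmonic.\<close>

lemma compare_at_gate:
  assumes u: "superharmonic u" "superharmonic u'" and v: "v \<in> V" and x: "x \<in> V"
    and ux: "u x \<le> sep_const * G x v * u v" and uo: "u' o\<^sub>0 \<le> sep_const * G o\<^sub>0 v * u' v"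
  shows "u x * u' o\<^sub>0 \<le> (sep_const * G_sup)\<^sup>2 * (u o\<^sub>0 * u' x)"
proof -
  note u0 = superharmonicD(1)[OF u(1)] superharmonicD(1)[OF u(2)]
  have "u x * u' o\<^sub>0 \<le> (sep_const * G x v * u v) * (sep_const * G o\<^sub>0 v * u' v)"
    using ux uo u0 v x base_in sep_const(1) G_nonneg by (intro mult_mono) auto
  also have "\<dots> = sep_const\<^sup>2 * ((G o\<^sub>0 v * u v) * (G x v * u' v))"
    by (simp add: power2_eq_square mult_ac)
  also have "\<dots> \<le> sep_const\<^sup>2 * ((G_sup * u o\<^sub>0) * (G_sup * u' x))"
    using u0 v x base_in G_nonneg G_sup_pos
    by (intro mult_left_mono mult_mono[OF superharmonic_ge_G[OF u(1) base_in v] superharmonic_ge_G[OF u(2) x v]]) auto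
  also have "\<dots> = (sep_const * G_sup)\<^sup>2 * (u o\<^sub>0 * u' x)" by (simp add: power2_eq_square mult_ac)
  finally show ?thesis .
qed

lemma sep_G_sup_ge_1: "1 \<le> (sep_const * G_sup)\<^sup>2"
proof -
  have "1 \<le> G_sup" using G_diag[OF base_in] G_diag_le[OF base_in] by linarith
  then have "1 * 1 \<le> sep_const * G_sup" using sep_const(1) by (intro mult_mono) auto
  then show ?thesis by (simp add: one_le_power)
qed

text \<open>Uniqueness at a boundary point, which is minimality at the same time. All harmonic functions
  bounded by a multiple of \<open>f\<close> are comparable, once normalised, with a constant that does not
  depend on that multiple. Applied to \<open>s f - w\<close>, this improves \<open>w \<le> s f\<close> by a fixed proportion
  of \<open>s - w(o\<^sub>0)\<close>, and iteration leads to \<open>w \<le> w(o\<^sub>0) f\<close>.\<close>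

theorem harmonic_proportional:
  assumes z: "gromov_seq z" and f: "martin_limit z f"
    and w: "harmonic w" "\<And>x. x \<in> V \<Longrightarrow> w x \<le> C * f x" and x: "x \<in> V"
  shows "w x = w o\<^sub>0 * f x"
proof -
  note fh = martin_limit_harmonic(1)[OF z f] and fo = martin_limit_harmonic(2)[OF z f]
  define Q where "Q = (sep_const * G_sup)\<^sup>2"
  have Q1: "1 \<le> Q" unfolding Q_def by (rule sep_G_sup_ge_1)
  have gate_le: "\<exists>v\<in>V. u x \<le> sep_const * G x v * u v \<and> u' o\<^sub>0 \<le> sep_const * G o\<^sub>0 v * u' v"
    if u: "harmonic u" "\<And>y. y \<in> V \<Longrightarrow> u y \<le> c * f y" "0 \<le> c"
      and u': "harmonic u'" "\<And>y. y \<in> V \<Longrightarrow> u' y \<le> c' * f y" "0 \<le> c'"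
      and x: "x \<in> V" for u u' c c' x
  proof -
    define k where "k = lev x + 3 * \<delta> + 1"
    obtain v v' where v: "gate z v" "gate z v'" "lev v = k" "lev v' = k + 2 * \<delta>" "real k \<le> gp v v'"
      using gates_exist[OF z, of k "k + 2 * \<delta>"] by auto
    have vV: "v \<in> V" using v by (simp add: gate_def)
    have "gp x v < real (lev v) - 3 * \<delta>" "gp o\<^sub>0 v < real (lev v) - 3 * \<delta>"
      using gp_le_lev(1)[OF x vV] gp_le_lev(1)[OF base_in vV] v(3) by (auto simp: k_def)
    then show ?thesis
      using harmonic_le_gate[OF z f u(1,2,3) v(1,2) _ _ x] harmonic_le_gate[OF z f u'(1,2,3) v(1,2) _ _ base_in]
        v vV by auto
  qed
  have comp: "u x * u' o\<^sub>0 \<le> Q * (u o\<^sub>0 * u' x)"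
    if u: "harmonic u" "\<And>y. y \<in> V \<Longrightarrow> u y \<le> c * f y" "0 \<le> c"
      and u': "harmonic u'" "\<And>y. y \<in> V \<Longrightarrow> u' y \<le> c' * f y" "0 \<le> c'"
      and x: "x \<in> V" for u u' c c' x
    using gate_le[OF that] compare_at_gate[OF harmonic_superharmonic[OF u(1)] harmonic_superharmonic[OF u'(1)] _ x]
    unfolding Q_def by blast
  have f0: "0 \<le> f y" if "y \<in> V" for y using harmonicD[OF fh] that by auto
  define q where "q = w o\<^sub>0"
  have q: "0 \<le> q" "q \<le> C" using harmonicD(1)[OF w(1) base_in] w(2)[OF base_in] fo by (auto simp: q_def)
  have diff: "harmonic (\<lambda>y. s * f y - w y)" if "\<And>y. y \<in> V \<Longrightarrow> w y \<le> s * f y" for s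
    using that harmonicD[OF fh] harmonicD[OF w(1)] by (simp add: harmonic_def avg_diff avg_cmult)
  have bound: "w y \<le> (q + (C - q) * (1 - 1 / Q) ^ n) * f y" if "y \<in> V" for n y
    using that
  proof (induction n arbitrary: y)
    case (Suc n)
    define s where "s = q + (C - q) * (1 - 1 / Q) ^ n"
    have s: "0 \<le> s" using q Q1 by (simp add: s_def)
    have IH: "w y \<le> s * f y" if "y \<in> V" for y using Suc.IH[OF that] by (simp add: s_def)
    have "f y * (s * f o\<^sub>0 - w o\<^sub>0) \<le> Q * (f o\<^sub>0 * (s * f y - w y))"
      using w q harmonicD(1)[OF w(1)] s
      by (intro comp[OF fh _ _ diff[OF IH] _ _ Suc.prems, of 1 s]) auto
    then have "f y * (s - q) / Q \<le> s * f y - w y" using Q1 fo by (simp add: q_def field_simps)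
    then have "w y \<le> (q + (s - q) * (1 - 1 / Q)) * f y" by (simp add: algebra_simps)
    then show ?case by (simp add: s_def mult_ac)
  qed (use w in auto)
  have wq: "w y \<le> q * f y" if y: "y \<in> V" for y
  proof -
    have "(\<lambda>n. (q + (C - q) * (1 - 1 / Q) ^ n) * f y) \<longlonglongrightarrow> (q + (C - q) * 0) * f y"
      using Q1 by (intro tendsto_intros LIMSEQ_realpow_zero) auto
    then show ?thesis using bound[OF y] by (intro LIMSEQ_le_const) auto
  qed
  have "(q * f x - w x) * f o\<^sub>0 \<le> Q * ((q * f o\<^sub>0 - w o\<^sub>0) * f x)"
    using harmonicD(1)[OF w(1)] q by (intro comp[OF diff[OF wq] _ _ fh _ _ x, of q 1]) auto
  then show ?thesis using fo wq[OF x] by (simp add: q_def)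
qed

text \<open>Limits along two subsequences are comparable, because both are comparable to \<open>G(\<cdot>, v)\<close> up to
  the gates \<open>v\<close>. So they are proportional, and both are \<open>1\<close> at the root.\<close>

theorem martin_kernel_converges:
  assumes z: "gromov_seq z"
  obtains f where "martin_limit z f"
proof -
  have zV: "z n \<in> V" for n by (rule gromov_seq_in[OF z])
  have sub: "\<exists>r f. strict_mono r \<and> martin_limit (z \<circ> s \<circ> r) f" if "strict_mono s" for s :: "nat \<Rightarrow> nat"
  proof -
    have "\<bar>Kr x (z (s n))\<bar> \<le> (1 / \<epsilon>) ^ lev x" if "x \<in> V" for x n
      using Kr_nonneg[OF that zV] Kr_le[OF that zV] by simp
    then obtain r where r: "strict_mono r" "\<And>x. x \<in> V \<Longrightarrow> convergent (\<lambda>n. Kr x (z (s (r n))))"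
      using pointwise_convergent_subsequence[of V "\<lambda>n x. Kr x (z (s n))" "\<lambda>x. (1 / \<epsilon>) ^ lev x"]
        countable_V by auto
    then have "martin_limit (z \<circ> s \<circ> r) (\<lambda>x. lim (\<lambda>n. Kr x (z (s (r n)))))"
      by (simp add: martin_limit_def convergent_LIMSEQ_iff)
    then show ?thesis using r by blast
  qed
  obtain r f where r: "strict_mono r" and f: "martin_limit (z \<circ> r) f"
    using sub[of id] by (auto simp: strict_mono_def)
  note zr = gromov_seq_subseq[OF z r]
  have "(\<lambda>n. Kr x (z n)) \<longlonglongrightarrow> f x" if x: "x \<in> V" for x
  proof (rule ccontr)
    assume "\<not> ?thesis"
    then obtain e where e: "0 < e" "\<not> (\<forall>\<^sub>F n in sequentially. dist (Kr x (z n)) (f x) < e)"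
      by (auto simp: tendsto_iff)
    then have "infinite {n. \<not> dist (Kr x (z n)) (f x) < e}"
      by (simp add: eventually_cofinite[symmetric] cofinite_eq_sequentially)
    then obtain s :: "nat \<Rightarrow> nat" where s: "strict_mono s" "\<And>n. s n \<in> {n. \<not> dist (Kr x (z n)) (f x) < e}"
      using infinite_enumerate by blast
    obtain r' f' where r': "strict_mono r'" and f': "martin_limit (z \<circ> s \<circ> r') f'"
      using sub[OF s(1)] by blast
    have zs: "gromov_seq (z \<circ> s \<circ> r')" by (intro gromov_seq_subseq z s r')
    have le: "f' y \<le> (sep_const * G_sup)\<^sup>2 * f y" if y: "y \<in> V" for y
    proof -
      define k where "k = lev y + 2 * \<delta> + 1"
      obtain v where v: "gate z v" "lev v = k" using gates_exist[OF z, of k k] by auto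
      have vV: "v \<in> V" using v by (simp add: gate_def)
      have "gp y v < real (lev v) - 2 * \<delta>" "gp o\<^sub>0 v < real (lev v) - 2 * \<delta>"
        using gp_le_lev(1)[OF y vV] gp_le_lev(1)[OF base_in vV] v(2) by (auto simp: k_def)
      then have "f' y * f o\<^sub>0 \<le> (sep_const * G_sup)\<^sup>2 * (f' o\<^sub>0 * f y)"
        using martin_limit_harmonic(1)[OF zs f'] martin_limit_harmonic(1)[OF zr f]
        by (intro compare_at_gate[OF _ _ vV y] martin_limit_le[OF zs f' _ y] martin_limit_le[OF zr f _ base_in]
            harmonic_superharmonic gate_subseq v(1) r s r') auto
      then show ?thesis
        using martin_limit_harmonic(2)[OF zs f'] martin_limit_harmonic(2)[OF zr f] by simp
    qed
    have "f' x = f' o\<^sub>0 * f x"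
      by (rule harmonic_proportional[OF zr f martin_limit_harmonic(1)[OF zs f'] le x])
    then have "f' x = f x" using martin_limit_harmonic(2)[OF zs f'] by simp
    then have "(\<lambda>n. Kr x (z (s (r' n)))) \<longlonglongrightarrow> f x"
      using f'[unfolded martin_limit_def, rule_format, OF x] by (simp add: o_def)
    then have "\<forall>\<^sub>F n in sequentially. dist (Kr x (z (s (r' n)))) (f x) < e" using e by (simp add: tendsto_iff)
    then show False using s(2) by (auto simp: eventually_sequentially)
  qed
  then show ?thesis by (intro that[of f]) (simp add: martin_limit_def)
qed

theorem martin_limit_minimal:
  assumes z: "gromov_seq z" and f: "martin_limit z f"
  shows "minimal_harmonic V P o\<^sub>0 f"
  unfolding minimal_harmonic_def nonneg_harmonic_iff
proof (intro conjI allI impI)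
  fix w assume w: "harmonic w \<and> (\<forall>x\<in>V. w x \<le> f x)"
  have "w x = w o\<^sub>0 * f x" if "x \<in> V" for x
    using w by (intro harmonic_proportional[OF z f _ _ that, of w 1]) auto
  then show "\<exists>c. \<forall>x\<in>V. w x = c * f x" by blast
qed (use martin_limit_harmonic[OF z f] in auto)

text \<open>A common Martin limit at two distinct boundary points would be bounded by a multiple of
  \<open>G(\<cdot>, v) + G(\<cdot>, v')\<close> for gates \<open>v\<close>, \<open>v'\<close> of the two, hence vanish.\<close>

theorem martin_limit_separates:
  assumes z: "gromov_seq z" "gromov_seq z'" and f: "martin_limit z f" "martin_limit z' f"
  shows "\<exists>n. real k \<le> gp (z n) (z' n)"
proof (rule ccontr)
  assume no: "\<not> ?thesis"
  define l where "l = k + 5 * \<delta>"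
  obtain v where v: "gate z v" "lev v = l" using gates_exist[OF z(1), of l l] by auto
  obtain v' where v': "gate z' v'" "lev v' = l" using gates_exist[OF z(2), of l l] by auto
  have V: "v \<in> V" "v' \<in> V" using v v' by (auto simp: gate_def)
  have "\<forall>\<^sub>F n in sequentially. real l - \<delta> \<le> gp (z n) v \<and> real l - \<delta> \<le> gp (z' n) v'"
    using v v' by (auto simp: gate_def intro: eventually_conj)
  then obtain n where n: "real l - \<delta> \<le> gp (z n) v" "real l - \<delta> \<le> gp (z' n) v'"
    by (auto simp: eventually_sequentially)
  have zV: "z n \<in> V" "z' n \<in> V" using z gromov_seq_in by auto
  have vv: "gp v v' < real l - 3 * \<delta>"
  proof (rule ccontr)
    assume "\<not> ?thesis"
    then have "real l - 4 * \<delta> \<le> gp (z n) v'"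
      using hyperbolic_ineq[OF zV(1) V(2,1)] n by linarith
    then have "real l - 5 * \<delta> \<le> gp (z n) (z' n)"
      using hyperbolic_ineq[OF zV V(2)] n gp_sym[OF zV(2) V(2)] by linarith
    then show False using no by (simp add: l_def)
  qed
  note fh = martin_limit_harmonic[OF z(1) f(1)]
  have f0: "0 \<le> f y" if "y \<in> V" for y using harmonicD[OF fh(1)] that by auto
  define M where "M = sep_const * (f v + f v')"
  have bound: "f y \<le> M * (Gt y v + Gt y v')" if y: "y \<in> V" for y
  proof -
    have g: "gp y v < real l - 2 * \<delta> \<or> gp y v' < real l - 2 * \<delta>"
      using hyperbolic_ineq[OF V y] vv gp_sym[OF y V(1)] by linarith
    have "f y \<le> sep_const * G y u * f u \<Longrightarrow> u \<in> {v, v'} \<Longrightarrow> f y \<le> M * (Gt y v + Gt y v')" for u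
    proof -
      assume u: "f y \<le> sep_const * G y u * f u" "u \<in> {v, v'}"
      have "sep_const * f u * G y u \<le> M * (Gt y v + Gt y v')"
        unfolding M_def using u(2) f0 V sep_const(1) G_le_Gt[OF y] Gt_nonneg[OF y] G_nonneg[OF y]
        by (intro mult_mono) (auto intro: add_increasing add_increasing2)
      then show "f y \<le> M * (Gt y v + Gt y v')" using u by (simp add: mult_ac)
    qed
    then show ?thesis
      using g martin_limit_le[OF z(1) f(1) v(1) y] martin_limit_le[OF z(2) f(2) v'(1) y] v v' by auto
  qed
  have "f o\<^sub>0 \<le> 0"
  proof (rule subharmonic_nonpos[where g = "\<lambda>y. Gt y v + Gt y v'" and C = M])
    show "t_superharmonic (\<lambda>y. Gt y v + Gt y v')"
      using t_superharmonic_Gt[OF V(1)] t_superharmonic_Gt[OF V(2)]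
      by (auto simp: t_superharmonic_def avg_add distrib_left intro: add_mono)
    show "f y \<le> avg (\<lambda>y. max 0 (f y)) y" if "y \<in> V" for y
      using avg_mono[of y f "\<lambda>y. max 0 (f y)"] harmonicD(2)[OF fh(1) that] by auto
  qed (use bound base_in in auto)
  then show False using fh(2) by simp
qed

end

section \<open>Compactifications determined by functions\<close>

lemma openin_isolated:
  assumes "Hausdorff_space T" "T closure_of S = topspace T" "openin T U" "U \<inter> S = {a}"
  shows "openin T {a}"
proof -
  have a: "a \<in> U" "a \<in> topspace T" using assms openin_subset by fastforce+
  have op: "openin T (U - {a})"
    using assms a closedin_Hausdorff_singleton by (intro openin_diff) auto
  have "U - {a} = {}"
  proof (rule ccontr)
    assume "U - {a} \<noteq> {}"
    then have "S \<inter> (U - {a}) \<noteq> {}" using op assms(2) unfolding dense_intersects_open by blast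
    then show False using assms(4) by auto
  qed
  then have "U = {a}" using a by auto
  then show ?thesis using assms(3) by simp
qed

lemma compactification_dense:
  assumes "compactification V T e"
  shows "inj_on e V" "e ` V \<subseteq> topspace T" "T closure_of (e ` V) = topspace T" "compact_space T"
    "Hausdorff_space T" "\<And>x. x \<in> V \<Longrightarrow> openin T {e x}"
proof -
  have c: "T closure_of (e ` V) = topspace T" "compact_space T" "Hausdorff_space T"
    and emb: "homeomorphic_map (discrete_topology V) (subtopology T (e ` V)) e"
    using assms by (auto simp: compactification_def embedding_map_def)
  show inj: "inj_on e V" using homeomorphic_imp_injective_map[OF emb] by simp
  show sub: "e ` V \<subseteq> topspace T"
    using homeomorphic_imp_surjective_map[OF emb, unfolded topspace_discrete_topology topspace_subtopology]
    by blast
  show "T closure_of (e ` V) = topspace T" "compact_space T" "Hausdorff_space T" by (fact c)+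
  fix x assume x: "x \<in> V"
  have "openin (subtopology T (e ` V)) (e ` {x})"
    using homeomorphic_imp_open_map[OF emb] x unfolding open_map_def by auto
  then obtain U where "openin T U" "{e x} = U \<inter> e ` V" by (auto simp: openin_subtopology)
  then show "openin T {e x}" using openin_isolated[OF c(3,1)] by metis
qed

lemma embedding_map_isolated:
  assumes "inj_on e V" "\<And>x. x \<in> V \<Longrightarrow> openin T {e x}"
  shows "embedding_map (discrete_topology V) T e"
  unfolding embedding_map_def topspace_discrete_topology
proof (rule bijective_open_imp_homeomorphic_map)
  have sub: "e ` V \<subseteq> topspace T" using assms(2) openin_subset by fastforce
  show "open_map (discrete_topology V) (subtopology T (e ` V)) e"
    unfolding open_map_def
  proof (intro allI impI)
    fix U assume "openin (discrete_topology V) U"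
    then have U: "U \<subseteq> V" by simp
    have "openin T (\<Union>x\<in>U. {e x})" using assms(2) U by (intro openin_Union) auto
    moreover have "e ` U = (\<Union>x\<in>U. {e x}) \<inter> e ` V" using U by auto
    ultimately show "openin (subtopology T (e ` V)) (e ` U)" unfolding openin_subtopology by metis
  qed
  show "continuous_map (discrete_topology V) (subtopology T (e ` V)) e"
    using sub by (auto simp: continuous_map_in_subtopology)
qed (use assms openin_subset in \<open>fastforce+\<close>)

lemma continuous_map_indicator_singleton:
  assumes "openin T {a}" "closedin T {a}"
  shows "continuous_map T euclideanreal (\<lambda>y. if y = a then 1 else 0)"
  unfolding continuous_map_def
proof (intro conjI allI impI)
  fix U :: "real set" assume "openin euclideanreal U"
  let ?S = "{y \<in> topspace T. (if y = a then 1 else 0) \<in> U}"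
  have a: "a \<in> topspace T" using assms(1) openin_subset by fastforce
  have op: "openin T (topspace T - {a})" using assms(2) by (simp add: closedin_def)
  consider "1 \<in> U" "0 \<in> U" | "1 \<in> U" "0 \<notin> U" | "1 \<notin> U" "0 \<in> U" | "1 \<notin> U" "0 \<notin> U" by blast
  then show "openin T ?S"
  proof cases
    case 1 then have "?S = topspace T" by auto then show ?thesis by simp
  next
    case 2 then have "?S = {a}" using a by auto then show ?thesis using assms by simp
  next
    case 3 then have "?S = topspace T - {a}" by auto then show ?thesis using op by simp
  next
    case 4 then have "?S = {}" by auto then show ?thesis by (simp only: openin_empty)
  qed
qed auto

text \<open>The coordinates \<open>Inr\<close> tell the points of \<open>V\<close> from each other and from the boundary.\<close>

definition signature :: "'v set \<Rightarrow> ('v \<Rightarrow> 'c) \<Rightarrow> ('v \<Rightarrow> 'c \<Rightarrow> real) \<Rightarrow> 'c \<Rightarrow> 'v + 'v \<Rightarrow> real" where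
  "signature V e f y = (\<lambda>i. case i of Inl x \<Rightarrow> if x \<in> V then f x y else 0
                                    | Inr x \<Rightarrow> if x \<in> V \<and> y = e x then 1 else 0)"

abbreviation signature_space :: "('v + 'v \<Rightarrow> real) topology" where
  "signature_space \<equiv> product_topology (\<lambda>_. euclideanreal) UNIV"

lemma Hausdorff_signature_space: "Hausdorff_space signature_space"
  by (simp add: Hausdorff_space_product_topology)

lemma continuous_signature:
  assumes "\<And>x. x \<in> V \<Longrightarrow> continuous_map T euclideanreal (f x)"
    and "Hausdorff_space T" "\<And>x. x \<in> V \<Longrightarrow> openin T {e x}"
  shows "continuous_map T signature_space (signature V e f)"
  unfolding continuous_map_componentwise_UNIV
proof
  fix i :: "'a + 'a"
  show "continuous_map T euclideanreal (\<lambda>y. signature V e f y i)"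
  proof (cases i)
    case (Inl x)
    then show ?thesis using assms(1)[of x] by (cases "x \<in> V") (auto simp: signature_def)
  next
    case (Inr x)
    show ?thesis
    proof (cases "x \<in> V")
      case True
      then have "e x \<in> topspace T" using assms(3) openin_subset by fastforce
      then have "continuous_map T euclideanreal (\<lambda>y. if y = e x then 1 else 0)"
        using assms(2,3) True closedin_Hausdorff_singleton by (intro continuous_map_indicator_singleton) auto
      then show ?thesis using Inr True by (simp add: signature_def)
    qed (use Inr in \<open>simp add: signature_def\<close>)
  qed
qed

lemma signature_vertex:
  assumes "x \<in> V" "signature V e f y = signature V e f (e x)"
  shows "y = e x"
proof -
  have "signature V e f y (Inr x) = signature V e f (e x) (Inr x)" using assms by simp
  then show ?thesis using assms(1) by (simp add: signature_def split: if_splits)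
qed

lemma compact_image_eq_closure:
  assumes "compact_space T" "T closure_of (e ` V) = topspace T" "continuous_map T Z F"
    "e ` V \<subseteq> topspace T" "Hausdorff_space Z"
  shows "F ` topspace T = Z closure_of (F ` e ` V)"
proof
  show "F ` topspace T \<subseteq> Z closure_of (F ` e ` V)"
    using continuous_map_image_closure_subset[OF assms(3), of "e ` V"] assms(2) by simp
  have "compactin Z (F ` topspace T)"
    using image_compactin[OF _ assms(3)] assms(1) by (simp add: compact_space_def)
  then have "closedin Z (F ` topspace T)" by (rule compactin_imp_closedin[OF assms(5)])
  then show "Z closure_of (F ` e ` V) \<subseteq> F ` topspace T"
    using assms(4) by (intro closure_of_minimal) auto
qed

text \<open>Two compactifications that embed into the same space compatibly on \<open>V\<close> have the same image,
  namely the closure of the image of \<open>V\<close>.\<close>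

lemma compactifications_homeomorphic:
  assumes T\<^sub>1: "compact_space T\<^sub>1" "T\<^sub>1 closure_of (e\<^sub>1 ` V) = topspace T\<^sub>1"
      "continuous_map T\<^sub>1 Z F\<^sub>1" "inj_on F\<^sub>1 (topspace T\<^sub>1)" "e\<^sub>1 ` V \<subseteq> topspace T\<^sub>1"
    and T\<^sub>2: "compact_space T\<^sub>2" "T\<^sub>2 closure_of (e\<^sub>2 ` V) = topspace T\<^sub>2"
      "continuous_map T\<^sub>2 Z F\<^sub>2" "inj_on F\<^sub>2 (topspace T\<^sub>2)" "e\<^sub>2 ` V \<subseteq> topspace T\<^sub>2"
    and Z: "Hausdorff_space Z" and eq: "\<And>x. x \<in> V \<Longrightarrow> F\<^sub>1 (e\<^sub>1 x) = F\<^sub>2 (e\<^sub>2 x)"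
  obtains \<phi> where "homeomorphic_map T\<^sub>1 T\<^sub>2 \<phi>" "\<And>x. x \<in> V \<Longrightarrow> \<phi> (e\<^sub>1 x) = e\<^sub>2 x"
proof -
  have W: "F\<^sub>1 ` e\<^sub>1 ` V = F\<^sub>2 ` e\<^sub>2 ` V" unfolding image_image using eq by (intro image_cong) auto
  have im: "F\<^sub>2 ` topspace T\<^sub>2 = F\<^sub>1 ` topspace T\<^sub>1"
    using compact_image_eq_closure[OF T\<^sub>1(1,2,3,5) Z] compact_image_eq_closure[OF T\<^sub>2(1,2,3,5) Z] W by simp
  define Z' where "Z' = subtopology Z (F\<^sub>1 ` topspace T\<^sub>1)"
  have Z': "Hausdorff_space Z'" unfolding Z'_def by (rule Hausdorff_space_subtopology[OF Z])
  have h1: "homeomorphic_map T\<^sub>1 Z' F\<^sub>1"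
    using T\<^sub>1 continuous_map_image_subset_topspace[OF T\<^sub>1(3)]
    by (intro continuous_imp_homeomorphic_map[OF _ _ Z']) (auto simp: Z'_def continuous_map_in_subtopology)
  have h2: "homeomorphic_map T\<^sub>2 Z' F\<^sub>2"
    using T\<^sub>2 continuous_map_image_subset_topspace[OF T\<^sub>2(3)] im
    by (intro continuous_imp_homeomorphic_map[OF _ _ Z']) (auto simp: Z'_def continuous_map_in_subtopology)
  obtain g where g: "homeomorphic_maps T\<^sub>2 Z' F\<^sub>2 g" using h2 homeomorphic_map_maps by blast
  have "homeomorphic_map T\<^sub>1 T\<^sub>2 (g \<circ> F\<^sub>1)"
    using homeomorphic_map_compose[OF h1] g homeomorphic_maps_map homeomorphic_maps_sym by metis
  moreover have "(g \<circ> F\<^sub>1) (e\<^sub>1 x) = e\<^sub>2 x" if "x \<in> V" for x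
    using g eq[OF that] T\<^sub>2(5) that by (auto simp: homeomorphic_maps_def)
  ultimately show ?thesis using that by blast
qed

lemma canonical_boundary_homeomorphismI:
  assumes \<phi>: "homeomorphic_map T\<^sub>1 T\<^sub>2 \<phi>" "\<And>x. x \<in> V \<Longrightarrow> \<phi> (e\<^sub>1 x) = e\<^sub>2 x"
    and sub: "e\<^sub>1 ` V \<subseteq> topspace T\<^sub>1" "e\<^sub>2 ` V \<subseteq> topspace T\<^sub>2"
  shows "canonical_boundary_homeomorphism V T\<^sub>1 e\<^sub>1 T\<^sub>2 e\<^sub>2 \<phi>"
  unfolding canonical_boundary_homeomorphism_def
proof (intro conjI ballI)
  have inj: "inj_on \<phi> (topspace T\<^sub>1)" and surj: "\<phi> ` topspace T\<^sub>1 = topspace T\<^sub>2"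
    using \<phi>(1) homeomorphic_imp_injective_map homeomorphic_imp_surjective_map by blast+
  have "\<phi> ` e\<^sub>1 ` V = e\<^sub>2 ` V" unfolding image_image using \<phi>(2) by (intro image_cong) auto
  then have "\<phi> ` boundary_set V T\<^sub>1 e\<^sub>1 = boundary_set V T\<^sub>2 e\<^sub>2"
    unfolding boundary_set_def using inj_on_image_set_diff[OF inj _ sub(1)] surj by auto
  moreover have "boundary_set V T\<^sub>1 e\<^sub>1 \<subseteq> topspace T\<^sub>1" "boundary_set V T\<^sub>2 e\<^sub>2 \<subseteq> topspace T\<^sub>2"
    by (auto simp: boundary_set_def)
  ultimately show "homeomorphic_map (boundary_space V T\<^sub>1 e\<^sub>1) (boundary_space V T\<^sub>2 e\<^sub>2) \<phi>"
    unfolding boundary_space_def using \<phi>(1) by (intro homeomorphic_map_subtopologies) (simp_all add: Int_absorb1)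
qed (use \<phi> homeomorphic_imp_continuous_map in auto)

lemma extended_kernel_eq:
  assumes T: "Hausdorff_space T" "T closure_of (e ` V) = topspace T"
    and f: "extends_continuously V T e (k x) f" and \<xi>: "\<xi> \<in> topspace T"
  shows "extended_kernel V k T e x \<xi> = f \<xi>"
  unfolding extended_kernel_def
proof (rule the_equality)
  show "\<exists>f'. extends_continuously V T e (k x) f' \<and> f \<xi> = f' \<xi>" using f by blast
  fix s assume "\<exists>f'. extends_continuously V T e (k x) f' \<and> s = f' \<xi>"
  then obtain f' where f': "extends_continuously V T e (k x) f'" "s = f' \<xi>" by blast
  have "\<xi> \<in> T closure_of (e ` V)" unfolding T(2) by (rule \<xi>)
  then have "f' \<xi> = f \<xi>"
  proof (rule forall_in_closure_of_eq)
    show "continuous_map T euclideanreal f'" "continuous_map T euclideanreal f"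
      using f f'(1) by (simp_all add: extends_continuously_def)
    show "f' y = f y" if "y \<in> e ` V" for y
      using f f'(1) that by (auto simp: extends_continuously_def)
  qed simp
  then show "s = f \<xi>" using f'(2) by simp
qed

text \<open>Minimality of the Martin compactification means that the extended kernels separate its boundary
  points. If they did not, identifying the points with equal kernels would give a smaller
  compactification, and one that lives on a set of representatives in the same type.\<close>

lemma martin_compactification_separates:
  assumes M: "martin_compactification V k T e"
    and f: "\<And>x. x \<in> V \<Longrightarrow> extends_continuously V T e (k x) (f x)"
  shows "inj_on (signature V e f) (topspace T)"
proof -
  have K: "kernel_compactification V k T e" using M by (simp add: martin_compactification_def)
  then have c: "compactification V T e" by (simp add: kernel_compactification_def)
  note T = compactification_dense[OF c]
  define F where "F = signature V e f"
  have F: "continuous_map T signature_space F"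
    unfolding F_def using f T by (intro continuous_signature) (auto simp: extends_continuously_def)
  define rep where "rep = (\<lambda>y. SOME y'. y' \<in> topspace T \<and> F y' = F y)"
  have rep: "rep y \<in> topspace T" "F (rep y) = F y" if "y \<in> topspace T" for y
    using someI[of "\<lambda>y'. y' \<in> topspace T \<and> F y' = F y" y] that by (auto simp: rep_def)
  have rep_eq: "rep y = rep y'" if "F y = F y'" for y y'
    using that by (simp add: rep_def)
  have rep_e: "rep (e x) = e x" if "x \<in> V" for x
    using signature_vertex[OF that, of e f "rep (e x)"] rep(2)[of "e x"] T(2) that by (auto simp: F_def)
  define R where "R = rep ` topspace T"
  define T' where "T' = pullback_topology R F signature_space"
  have tT': "topspace T' = R" by (auto simp: T'_def topspace_pullback_topology)
  have injR: "inj_on F R"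
  proof (rule inj_onI)
    fix a b assume ab: "a \<in> R" "b \<in> R" "F a = F b"
    then obtain y y' where y: "y \<in> topspace T" "a = rep y" "y' \<in> topspace T" "b = rep y'"
      by (auto simp: R_def)
    then have "F y = F y'" using ab rep by simp
    then have "rep y = rep y'" by (rule rep_eq)
    then show "a = b" using y by simp
  qed
  have FT': "continuous_map T' signature_space F"
    using continuous_map_pullback[of signature_space signature_space id R F] by (simp add: T'_def)
  have cr: "continuous_map T T' rep"
    unfolding T'_def
  proof (rule continuous_map_pullback')
    show "continuous_map T signature_space (F \<circ> rep)"
      by (rule continuous_map_eq[OF F]) (simp add: rep)
  qed (auto simp: R_def)
  have H': "Hausdorff_space T'"
    by (rule Hausdorff_space_injective_preimage[OF Hausdorff_signature_space FT']) (simp add: tT' injR)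
  have "compactin T' (rep ` topspace T)"
    using image_compactin[OF _ cr] T(4) by (simp add: compact_space_def)
  then have C': "compact_space T'" by (simp add: compact_space_def tT' R_def)
  have eR: "e x \<in> R" if "x \<in> V" for x
    using rep_e[OF that] T(2) that unfolding R_def by (metis image_eqI image_subset_iff)
  have iso: "openin T' {e x}" if x: "x \<in> V" for x
  proof -
    have "openin T' {y \<in> topspace T'. F y (Inr x) \<in> {1/2<..}}"
      using FT' unfolding continuous_map_componentwise_UNIV
      by (intro openin_continuous_map_preimage[of T' euclideanreal]) auto
    moreover have "{y \<in> topspace T'. F y (Inr x) \<in> {1/2<..}} = {e x}"
      using x eR[OF x] by (auto simp: tT' F_def signature_def split: if_splits)
    ultimately show ?thesis by simp
  qed
  have dense': "T' closure_of (e ` V) = topspace T'"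
  proof (rule antisym[OF closure_of_subset_topspace])
    have "rep ` (T closure_of (e ` V)) \<subseteq> T' closure_of (rep ` e ` V)"
      by (rule continuous_map_image_closure_subset[OF cr])
    moreover have "rep ` e ` V = e ` V" unfolding image_image using rep_e by (intro image_cong) auto
    ultimately show "topspace T' \<subseteq> T' closure_of (e ` V)" using T(3) by (simp add: tT' R_def)
  qed
  have "extends_continuously V T' e (k x) (f x)" if x: "x \<in> V" for x
    unfolding extends_continuously_def
  proof
    have "continuous_map T' euclideanreal (\<lambda>y. F y (Inl x))"
      using FT' unfolding continuous_map_componentwise_UNIV by blast
    then show "continuous_map T' euclideanreal (f x)" using x by (simp add: F_def signature_def)
  qed (use f[OF x] in \<open>simp add: extends_continuously_def\<close>)
  then have "kernel_compactification V k T' e"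
    unfolding kernel_compactification_def compactification_def
    using C' H' dense' embedding_map_isolated[OF T(1) iso] by blast
  then obtain q where q: "continuous_map T' T q" "\<forall>x\<in>V. q (e x) = e x"
    using M unfolding martin_compactification_def by blast
  have qr: "(q \<circ> rep) y = id y" if y: "y \<in> topspace T" for y
  proof (rule forall_in_closure_of_eq[of y T "e ` V" T "q \<circ> rep" id])
    show "Hausdorff_space T" by (rule T(5))
    show "y \<in> T closure_of (e ` V)" unfolding T(3) by (rule y)
    show "continuous_map T T (q \<circ> rep)" by (rule continuous_map_compose[OF cr q(1)])
    show "continuous_map T T id" by (rule continuous_map_id)
    show "(q \<circ> rep) y = id y" if y': "y \<in> e ` V" for y
    proof -
      obtain x where "x \<in> V" "y = e x" using y' by blast
      then show ?thesis using q(2) rep_e[of x] by simp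
    qed
  qed
  show ?thesis
  proof (rule inj_onI)
    fix y y' assume y: "y \<in> topspace T" "y' \<in> topspace T" "signature V e f y = signature V e f y'"
    then have "rep y = rep y'" by (intro rep_eq) (simp add: F_def)
    then show "y = y'" using qr[OF y(1)] qr[OF y(2)] by simp
  qed
qed

section \<open>The hyperbolic compactification\<close>

locale completed_graph = hyperbolic_graph V E lev o\<^sub>0 \<delta> + Metric_space Y D
  for V :: "'v set" and E :: "('v \<times> 'v) set" and lev :: "'v \<Rightarrow> nat" and o\<^sub>0 :: 'v and \<delta> :: nat
    and Y :: "'b set" and D :: "'b \<Rightarrow> 'b \<Rightarrow> real" +
  fixes eH :: "'v \<Rightarrow> 'b" and a C\<^sub>D :: real
  assumes a_pos: "0 < a" and complete: "mcomplete" and eH_in: "eH ` V \<subseteq> Y"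
    and eH_dense: "mtopology closure_of (eH ` V) = Y" and C\<^sub>D_pos: "0 < C\<^sub>D"
    and D_lower: "x \<in> V \<Longrightarrow> y \<in> V \<Longrightarrow> visual_rho E lev a x y / C\<^sub>D \<le> D (eH x) (eH y)"
    and D_upper: "x \<in> V \<Longrightarrow> y \<in> V \<Longrightarrow> D (eH x) (eH y) \<le> C\<^sub>D * visual_rho E lev a x y"
begin

lemma D_le_exp:
  assumes "x \<in> V" "y \<in> V" "k \<le> gp x y"
  shows "D (eH x) (eH y) \<le> C\<^sub>D * exp (- a * k)"
proof -
  have "visual_rho E lev a x y \<le> exp (- a * k)" using assms a_pos by (auto simp: visual_rho_def)
  then have "C\<^sub>D * visual_rho E lev a x y \<le> C\<^sub>D * exp (- a * k)" using C\<^sub>D_pos by (intro mult_left_mono) auto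
  then show ?thesis using D_upper[OF assms(1,2)] by linarith
qed

lemma gp_large_of_D:
  assumes "x \<in> V" "y \<in> V" "D (eH x) (eH y) < exp (- a * k) / C\<^sub>D" "x \<noteq> y"
  shows "k < gp x y"
proof -
  have "visual_rho E lev a x y / C\<^sub>D < exp (- a * k) / C\<^sub>D" using D_lower[OF assms(1,2)] assms(3) by linarith
  then show ?thesis using C\<^sub>D_pos a_pos assms(4) by (simp add: visual_rho_def divide_strict_right_mono field_simps)
qed

lemma eH_eq:
  assumes "x \<in> V" "y \<in> V" "D (eH x) (eH y) < exp (- a * lev x) / C\<^sub>D"
  shows "x = y"
  using gp_large_of_D[OF assms] gp_le_lev(1)[OF assms(1,2)] by fastforce

lemma inj_eH: "inj_on eH V"
proof (rule inj_onI)
  fix x y assume xy: "x \<in> V" "y \<in> V" "eH x = eH y"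
  then have "D (eH x) (eH y) = 0" using eH_in by auto
  then show "x = y" using eH_eq[OF xy(1,2)] C\<^sub>D_pos by simp
qed

lemma open_vertex:
  assumes "x \<in> V"
  shows "openin mtopology {eH x}"
proof -
  define r where "r = exp (- a * lev x) / C\<^sub>D"
  have "r > 0" using C\<^sub>D_pos by (simp add: r_def)
  have "eH y = eH x" if "y \<in> V" "eH y \<in> mball (eH x) r" for y
    using eH_eq[OF assms that(1)] that(2) by (simp add: r_def in_mball)
  then have "mball (eH x) r \<inter> eH ` V = {eH x}"
    using eH_in assms \<open>r > 0\<close> by auto
  then show ?thesis
    using eH_dense by (intro openin_isolated[OF Hausdorff_space_mtopology, of "eH ` V" "mball (eH x) r"]) auto
qed

lemma MCauchy_gromov:
  assumes z: "gromov_seq z"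
  shows "MCauchy (\<lambda>n. eH (z n))"
  unfolding MCauchy_def
proof (intro conjI allI impI)
  show "range (\<lambda>n. eH (z n)) \<subseteq> Y" using gromov_seq_in[OF z] eH_in by auto
  fix r :: real assume "r > 0"
  have "(\<lambda>k. C\<^sub>D * exp (- a * real k)) \<longlonglongrightarrow> 0"
  proof -
    have "(\<lambda>k. exp (- a) ^ k) \<longlonglongrightarrow> 0" using a_pos by (intro LIMSEQ_realpow_zero) auto
    then have "(\<lambda>k. C\<^sub>D * exp (- a) ^ k) \<longlonglongrightarrow> C\<^sub>D * 0" by (rule tendsto_mult_left)
    then show ?thesis by (simp add: exp_of_nat_mult[symmetric] mult.commute)
  qed
  then have "\<forall>\<^sub>F k in sequentially. C\<^sub>D * exp (- a * real k) < r" using \<open>r > 0\<close> by (rule order_tendstoD)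
  then obtain k where k: "C\<^sub>D * exp (- a * real k) < r" by (auto simp: eventually_sequentially)
  obtain N where N: "\<And>i j. i \<ge> N \<Longrightarrow> j \<ge> N \<Longrightarrow> real k \<le> gp (z i) (z j)" using gromov_seqE[OF z, of k] by blast
  have "D (eH (z i)) (eH (z j)) < r" if "N \<le> i" "N \<le> j" for i j
    using D_le_exp[OF gromov_seq_in[OF z] gromov_seq_in[OF z] N[OF that]] k by linarith
  then show "\<exists>N. \<forall>n n'. N \<le> n \<longrightarrow> N \<le> n' \<longrightarrow> D (eH (z n)) (eH (z n')) < r" by blast
qed

lemma MCauchy_vertices:
  assumes z: "\<And>n. z n \<in> V" and C: "MCauchy (\<lambda>n. eH (z n))"
  shows "gromov_seq z \<or> (\<exists>x\<in>V. \<forall>\<^sub>F n in sequentially. z n = x)"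
proof (rule disjCI)
  assume no: "\<not> (\<exists>x\<in>V. \<forall>\<^sub>F n in sequentially. z n = x)"
  have "\<exists>N. \<forall>i\<ge>N. \<forall>j\<ge>N. real k \<le> gp (z i) (z j)" for k
  proof -
    have "0 < exp (- a * real k) / C\<^sub>D" using C\<^sub>D_pos by simp
    then obtain N where N: "\<And>i j. i \<ge> N \<Longrightarrow> j \<ge> N \<Longrightarrow> D (eH (z i)) (eH (z j)) < exp (- a * real k) / C\<^sub>D"
      using C unfolding MCauchy_def by blast
    have lev: "k \<le> lev (z i)" if i: "i \<ge> N" for i
    proof (rule ccontr)
      assume "\<not> k \<le> lev (z i)"
      then have lt: "lev (z i) < k" by simp
      have "z j = z i" if "j \<ge> N" for j
      proof (rule ccontr)
        assume "z j \<noteq> z i"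
        then have "real k < gp (z i) (z j)" using gp_large_of_D[OF z z N[OF i that]] by auto
        then show False using gp_le_lev(1)[OF z z, of i j] lt by simp
      qed
      then have "\<forall>\<^sub>F n in sequentially. z n = z i" by (auto simp: eventually_sequentially)
      then show False using no z by blast
    qed
    have "real k \<le> gp (z i) (z j)" if "i \<ge> N" "j \<ge> N" for i j
      using gp_large_of_D[OF z z N[OF that]] lev[OF that(1)] by (cases "z i = z j") auto
    then show ?thesis by blast
  qed
  then show "gromov_seq z" using z by (simp add: gromov_seq_def)
qed

lemma boundary_approx:
  assumes "\<xi> \<in> boundary_set V mtopology eH"
  obtains z where "gromov_seq z" "limitin mtopology (\<lambda>n. eH (z n)) \<xi> sequentially"
proof -
  have \<xi>: "\<xi> \<in> Y" "\<xi> \<notin> eH ` V" using assms by (auto simp: boundary_set_def)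
  then have "\<xi> \<in> mtopology closure_of (eH ` V)" using eH_dense by simp
  then obtain \<sigma> where \<sigma>: "range \<sigma> \<subseteq> eH ` V" "limitin mtopology \<sigma> \<xi> sequentially"
    unfolding closure_of_sequentially by auto
  have "\<forall>n. \<exists>x. x \<in> V \<and> \<sigma> n = eH x" using \<sigma>(1) by blast
  then obtain z where z: "\<And>n. z n \<in> V" "\<And>n. \<sigma> n = eH (z n)" by metis
  then have \<sigma>z: "\<sigma> = (\<lambda>n. eH (z n))" by auto
  have "MCauchy (\<lambda>n. eH (z n))"
    using convergent_imp_MCauchy[OF _ \<sigma>(2)] \<sigma>(1) eH_in unfolding \<sigma>z by blast
  then consider "gromov_seq z" | x where "x \<in> V" "\<forall>\<^sub>F n in sequentially. z n = x"
    using MCauchy_vertices[of z, OF z(1)] by blast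
  then show ?thesis
  proof cases
    case 1
    then show ?thesis using that \<sigma>(2) \<sigma>z by blast
  next
    case 2
    then have "\<forall>\<^sub>F n in sequentially. \<sigma> n = eH x" using z(2) by (auto elim: eventually_mono)
    then have "limitin mtopology \<sigma> (eH x) sequentially"
      using 2(1) eH_in by (auto simp: limitin_def elim: eventually_mono)
    then have "\<xi> = eH x" using limitin_metric_unique[OF \<sigma>(2)] by simp
    then show ?thesis using \<xi>(2) 2(1) by blast
  qed
qed

lemma gromov_limit:
  assumes z: "gromov_seq z"
  obtains \<xi> where "\<xi> \<in> boundary_set V mtopology eH" "limitin mtopology (\<lambda>n. eH (z n)) \<xi> sequentially"
proof -
  obtain \<xi> where \<xi>: "limitin mtopology (\<lambda>n. eH (z n)) \<xi> sequentially"
    using complete MCauchy_gromov[OF z] unfolding mcomplete_def by blast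
  have "\<xi> \<noteq> eH x" if x: "x \<in> V" for x
  proof
    assume "\<xi> = eH x"
    then have "\<forall>\<^sub>F n in sequentially. eH (z n) \<in> {eH x}"
      using \<xi> open_vertex[OF x] unfolding limitin_def by blast
    then have "\<forall>\<^sub>F n in sequentially. eH (z n) \<in> {eH x} \<and> Suc (lev x) \<le> lev (z n)"
      using gromov_seq_lev[OF z] by (rule eventually_conj)
    then obtain n where "eH (z n) = eH x" "Suc (lev x) \<le> lev (z n)" by (auto simp: eventually_sequentially)
    then show False using inj_onD[OF inj_eH _ gromov_seq_in[OF z] x] by fastforce
  qed
  then show ?thesis using that \<xi> limitin_topspace[OF \<xi>] by (auto simp: boundary_set_def)
qed

lemma compact_completion: "compact_space mtopology"
proof -
  have "mtotally_bounded (eH ` V)"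
    unfolding mtotally_bounded_sequentially
  proof (intro conjI allI impI eH_in)
    fix \<sigma> :: "nat \<Rightarrow> 'b" assume "range \<sigma> \<subseteq> eH ` V"
    then have "\<forall>n. \<exists>x. x \<in> V \<and> \<sigma> n = eH x" by blast
    then obtain z where z: "\<And>n. z n \<in> V" "\<And>n. \<sigma> n = eH (z n)" by metis
    then have \<sigma>z: "\<sigma> = (\<lambda>n. eH (z n))" by auto
    show "\<exists>r. strict_mono r \<and> MCauchy (\<sigma> \<circ> r)"
    proof (cases "\<forall>k. \<forall>\<^sub>F n in sequentially. k \<le> lev (z n)")
      case True
      then obtain r where "strict_mono r" "gromov_seq (z \<circ> r)" using gromov_subsequence[of z] z(1) by blast
      then show ?thesis using MCauchy_gromov[of "z \<circ> r"] by (auto simp: \<sigma>z o_def)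
    next
      case False
      then obtain k where "\<not> (\<forall>\<^sub>F n in sequentially. k \<le> lev (z n))" by blast
      then have inf: "infinite {n. \<not> k \<le> lev (z n)}"
        by (simp add: eventually_cofinite[symmetric] cofinite_eq_sequentially)
      have "z ` {n. \<not> k \<le> lev (z n)} \<subseteq> {x \<in> V. lev x \<le> k}" using z by auto
      then have "finite (z ` {n. \<not> k \<le> lev (z n)})" using finite_ball finite_subset by blast
      then obtain n\<^sub>0 where n\<^sub>0: "infinite {n \<in> {n. \<not> k \<le> lev (z n)}. z n = z n\<^sub>0}"
        using pigeonhole_infinite[OF inf] by blast
      then obtain r :: "nat \<Rightarrow> nat" where r: "strict_mono r" "\<And>n. r n \<in> {n \<in> {n. \<not> k \<le> lev (z n)}. z n = z n\<^sub>0}"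
        using infinite_enumerate[OF n\<^sub>0] by blast
      have "\<sigma> \<circ> r = (\<lambda>n. eH (z n\<^sub>0))" using r(2) by (auto simp: \<sigma>z)
      moreover have "eH (z n\<^sub>0) \<in> Y" using z(1) eH_in by blast
      ultimately show ?thesis using r(1) by (auto intro!: exI[of _ r])
    qed
  qed
  then have "mtotally_bounded (mtopology closure_of (eH ` V))" by (rule mtotally_bounded_closure_of)
  then show ?thesis using complete eH_dense compact_space_eq_mcomplete_mtotally_bounded by simp
qed

lemma boundary_eqI:
  assumes z: "gromov_seq z" "limitin mtopology (\<lambda>n. eH (z n)) \<xi> sequentially"
    and z': "gromov_seq z'" "limitin mtopology (\<lambda>n. eH (z' n)) \<eta> sequentially"
    and close: "\<And>k n\<^sub>0. \<exists>n\<ge>n\<^sub>0. real k \<le> gp (z n) (z' n)"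
  shows "\<xi> = \<eta>"
proof -
  have \<xi>\<eta>: "\<xi> \<in> Y" "\<eta> \<in> Y" using limitin_topspace[OF z(2)] limitin_topspace[OF z'(2)] by auto
  have "D \<xi> \<eta> < 3 * r" if r: "0 < r" for r
  proof -
    obtain n\<^sub>1 where n\<^sub>1: "\<And>n. n \<ge> n\<^sub>1 \<Longrightarrow> D (eH (z n)) \<xi> < r"
      using z(2) r unfolding limitin_metric eventually_sequentially by blast
    obtain n\<^sub>2 where n\<^sub>2: "\<And>n. n \<ge> n\<^sub>2 \<Longrightarrow> D (eH (z' n)) \<eta> < r"
      using z'(2) r unfolding limitin_metric eventually_sequentially by blast
    have "(\<lambda>k. C\<^sub>D * exp (- a) ^ k) \<longlonglongrightarrow> C\<^sub>D * 0"
      using a_pos by (intro tendsto_mult_left LIMSEQ_realpow_zero) auto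
    then have "\<forall>\<^sub>F k in sequentially. C\<^sub>D * exp (- a) ^ k < r" using r by (intro order_tendstoD) auto
    then obtain k where k: "C\<^sub>D * exp (- a) ^ k < r" by (auto simp: eventually_sequentially)
    obtain n where n: "n \<ge> max n\<^sub>1 n\<^sub>2" "real k \<le> gp (z n) (z' n)" using close by blast
    have zV: "z n \<in> V" "z' n \<in> V" using gromov_seq_in z z' by auto
    have zY: "eH (z n) \<in> Y" "eH (z' n) \<in> Y" using zV eH_in by auto
    have "D (eH (z n)) (eH (z' n)) < r"
      using D_le_exp[OF zV n(2)] k by (simp add: exp_of_nat_mult[symmetric] mult.commute)
    moreover have "D (eH (z n)) \<xi> < r" "D (eH (z' n)) \<eta> < r" using n\<^sub>1[of n] n\<^sub>2[of n] n(1) by auto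
    ultimately show ?thesis
      using triangle[of \<xi> "eH (z n)" \<eta>] triangle[of "eH (z n)" "eH (z' n)" \<eta>] commute[of \<xi>] \<xi>\<eta> zY by auto
  qed
  from this[of "D \<xi> \<eta> / 3"] have "D \<xi> \<eta> \<le> 0" by (cases "0 < D \<xi> \<eta>") auto
  then have "D \<xi> \<eta> = 0" using nonneg[of \<xi> \<eta>] by linarith
  then show ?thesis using zero[OF \<xi>\<eta>] by simp
qed

text \<open>A Cauchy sequence of vertices is a Gromov sequence or eventually constant, so the hypothesis says
  that \<open>f\<close> maps Cauchy sequences to Cauchy sequences.\<close>

lemma extend_to_completion:
  fixes f :: "'v \<Rightarrow> 'm::complete_space"
  assumes "\<And>z. gromov_seq z \<Longrightarrow> Cauchy (\<lambda>n. f (z n))"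
  obtains g where "continuous_map mtopology euclidean g" "\<And>x. x \<in> V \<Longrightarrow> g (eH x) = f x"
proof -
  define f' where "f' = f \<circ> inv_into V eH"
  have f': "f' (eH x) = f x" if "x \<in> V" for x using inj_eH that by (simp add: f'_def)
  have mY: "mspace (metric (Y, D)) = Y" "mdist (metric (Y, D)) = D" by simp_all
  have "Cauchy_continuous_map (submetric (metric (Y, D)) (eH ` V)) euclidean_metric f'"
    unfolding Cauchy_continuous_map_def
  proof (intro allI impI)
    fix \<sigma> assume "Metric_space.MCauchy (mspace (submetric (metric (Y, D)) (eH ` V)))
      (mdist (submetric (metric (Y, D)) (eH ` V))) \<sigma>"
    then have ms: "Metric_space.MCauchy (Y \<inter> eH ` V) D \<sigma>" by (simp add: Int_commute)
    have sub: "Metric_space (Y \<inter> eH ` V) D" by (rule subspace) auto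
    have \<sigma>: "range \<sigma> \<subseteq> eH ` V" "MCauchy \<sigma>"
      using ms unfolding Metric_space.MCauchy_def[OF sub] MCauchy_def by auto
    have "\<forall>n. \<exists>x. x \<in> V \<and> \<sigma> n = eH x" using \<sigma>(1) by blast
    then obtain z where z: "\<And>n. z n \<in> V" "\<And>n. \<sigma> n = eH (z n)" by metis
    then have \<sigma>z: "\<sigma> = (\<lambda>n. eH (z n))" by auto
    have f\<sigma>: "f' \<circ> \<sigma> = (\<lambda>n. f (z n))" using f' z by auto
    have "Cauchy (\<lambda>n. f (z n))"
    proof (cases "gromov_seq z")
      case False
      then obtain x where "\<forall>\<^sub>F n in sequentially. z n = x"
        using MCauchy_vertices[of z, OF z(1)] \<sigma>(2) \<sigma>z by auto
      then have "\<forall>\<^sub>F n in sequentially. f (z n) = f x" by (auto elim: eventually_mono)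
      then have "(\<lambda>n. f (z n)) \<longlonglongrightarrow> f x" by (rule tendsto_eventually)
      then show ?thesis by (rule LIMSEQ_imp_Cauchy)
    qed (rule assms)
    then show "Metric_space.MCauchy (mspace euclidean_metric) (mdist euclidean_metric) (f' \<circ> \<sigma>)"
      by (simp add: f\<sigma>)
  qed
  moreover have "mcomplete_of (euclidean_metric :: 'm metric)"
    by (simp add: mcomplete_of_def complete_UNIV)
  ultimately obtain g where g: "continuous_map (subtopology (mtopology_of (metric (Y, D)))
        (mtopology_of (metric (Y, D)) closure_of (eH ` V))) (mtopology_of euclidean_metric) g"
      "\<And>y. y \<in> eH ` V \<Longrightarrow> g y = f' y"
    using Cauchy_continuous_map_extends_to_continuous_closure_of by blast
  have "mtopology_of (metric (Y, D)) = mtopology" by (simp add: mtopology_of_def)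
  then have "continuous_map mtopology euclidean g" using g(1) eH_dense by simp
  then show ?thesis using that g(2) f' by auto
qed

end

section \<open>Martin boundary and hyperbolic boundary\<close>

context hyperbolic_walk
begin

lemma martin_limit_subseq:
  assumes "martin_limit z f" "strict_mono r"
  shows "martin_limit (z \<circ> r) f"
  unfolding martin_limit_def
proof
  fix x assume "x \<in> V"
  then have "(\<lambda>n. Kr x (z n)) \<longlonglongrightarrow> f x" using assms(1) by (simp add: martin_limit_def)
  from LIMSEQ_subseq_LIMSEQ[OF this assms(2)]
  show "(\<lambda>n. Kr x ((z \<circ> r) n)) \<longlonglongrightarrow> f x" by (simp add: o_def)
qed

text \<open>The kernel at a boundary point is the limit of the kernels at some vertices \<open>z\<^sub>n\<close>, one sequence for
  all arguments since the tree is countable. A subsequence of \<open>z\<^sub>n\<close> is a Gromov sequence.\<close>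

theorem martin_boundary_minimal:
  assumes M: "martin_compactification V Kr T e"
  shows "boundary_set V T e = minimal_martin_boundary V P o\<^sub>0 T e"
proof -
  have K: "kernel_compactification V Kr T e" using M by (simp add: martin_compactification_def)
  then have c: "compactification V T e" by (simp add: kernel_compactification_def)
  note T = compactification_dense[OF c]
  have "\<forall>x\<in>V. \<exists>g. extends_continuously V T e (Kr x) g" using K by (simp add: kernel_compactification_def)
  then obtain f where f: "\<And>x. x \<in> V \<Longrightarrow> extends_continuously V T e (Kr x) (f x)" by metis
  have "minimal_harmonic V P o\<^sub>0 (\<lambda>x. extended_kernel V Kr T e x \<xi>)" if \<xi>: "\<xi> \<in> boundary_set V T e" for \<xi>
  proof -
    have \<xi>': "\<xi> \<in> topspace T" "\<xi> \<notin> e ` V" using \<xi> by (auto simp: boundary_set_def)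
    define X where "X = (\<lambda>n. from_nat_into V ` {..n::nat})"
    have XV: "X n \<subseteq> V" "finite (X n)" "X n \<noteq> {}" for n
      using from_nat_into[of V] base_in by (auto simp: X_def)
    have "\<exists>y\<in>V. n \<le> lev y \<and> (\<forall>x\<in>X n. dist (f x (e y)) (f x \<xi>) < 1 / real (Suc n))" for n
    proof -
      define B where "B = e ` {x \<in> V. lev x \<le> n}"
      define U where "U = (\<Inter>x\<in>X n. {y \<in> topspace T. f x y \<in> ball (f x \<xi>) (1 / real (Suc n))}) - B"
      have "finite B" "B \<subseteq> topspace T" using finite_ball T(2) by (auto simp: B_def)
      then have "closedin T B"
        using Hausdorff_imp_t1_space[OF T(5)] by (simp add: t1_space_closedin_finite)
      moreover have "openin T (\<Inter>x\<in>X n. {y \<in> topspace T. f x y \<in> ball (f x \<xi>) (1 / real (Suc n))})"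
      proof (rule openin_INT2)
        fix x assume "x \<in> X n"
        then have "x \<in> V" using XV(1) by blast
        then have "continuous_map T euclideanreal (f x)" using f by (simp add: extends_continuously_def)
        then show "openin T {y \<in> topspace T. f x y \<in> ball (f x \<xi>) (1 / real (Suc n))}"
          by (rule openin_continuous_map_preimage) simp
      qed (use XV in auto)
      ultimately have "openin T U" unfolding U_def by (intro openin_diff)
      moreover have "\<xi> \<in> U" using \<xi>' by (auto simp: U_def B_def)
      ultimately have "e ` V \<inter> U \<noteq> {}" using T(3) unfolding dense_intersects_open by blast
      then obtain y where y: "y \<in> V" "e y \<in> U" by blast
      then have "\<forall>x\<in>X n. dist (f x (e y)) (f x \<xi>) < 1 / real (Suc n)"
        by (auto simp: U_def dist_commute)
      moreover have "n \<le> lev y" using y by (auto simp: U_def B_def)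
      ultimately show ?thesis using y(1) by blast
    qed
    then obtain z where z: "\<And>n. z n \<in> V" "\<And>n. n \<le> lev (z n)"
      "\<And>n x. x \<in> X n \<Longrightarrow> dist (f x (e (z n))) (f x \<xi>) < 1 / real (Suc n)" by metis
    have lim: "(\<lambda>n. Kr x (z n)) \<longlonglongrightarrow> f x \<xi>" if x: "x \<in> V" for x
    proof -
      obtain i where i: "from_nat_into V i = x" using from_nat_into_surj[OF countable_V x] by blast
      have "\<forall>\<^sub>F n in sequentially. dist (Kr x (z n)) (f x \<xi>) \<le> inverse (real (Suc n))"
        unfolding eventually_sequentially
      proof (intro exI[of _ i] allI impI)
        fix n assume "i \<le> n"
        then have "x \<in> X n" using i by (auto simp: X_def)
        then show "dist (Kr x (z n)) (f x \<xi>) \<le> inverse (real (Suc n))"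
          using z(3)[of x n] f[OF x] z(1) by (simp add: extends_continuously_def inverse_eq_divide)
      qed
      then have "(\<lambda>n. dist (Kr x (z n)) (f x \<xi>)) \<longlonglongrightarrow> 0"
        by (intro tendsto_sandwich[OF _ _ tendsto_const LIMSEQ_inverse_real_of_nat]) auto
      then show ?thesis by (simp add: tendsto_dist_iff[symmetric])
    qed
    have "\<forall>\<^sub>F n in sequentially. k \<le> lev (z n)" for k
      using z(2) order_trans by (auto simp: eventually_sequentially intro!: exI[of _ k])
    then obtain r where r: "strict_mono r" "gromov_seq (z \<circ> r)" using gromov_subsequence[of z] z(1) by blast
    have "martin_limit (z \<circ> r) (\<lambda>x. f x \<xi>)"
      using lim r(1) by (intro martin_limit_subseq) (simp_all add: martin_limit_def)
    then have min: "minimal_harmonic V P o\<^sub>0 (\<lambda>x. f x \<xi>)" by (rule martin_limit_minimal[OF r(2)])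
    have eq: "extended_kernel V Kr T e x \<xi> = f x \<xi>" if "x \<in> V" for x
      by (rule extended_kernel_eq[OF T(5,3) _ \<xi>'(1)]) (rule f[OF that])
    have "nonneg_harmonic V P (\<lambda>x. extended_kernel V Kr T e x \<xi>) \<longleftrightarrow> nonneg_harmonic V P (\<lambda>x. f x \<xi>)"
      unfolding nonneg_harmonic_def using eq by (intro ball_cong conj_cong arg_cong2[where f = "(=)"] infsum_cong) auto
    then show ?thesis using min eq base_in by (auto simp: minimal_harmonic_def)
  qed
  then show ?thesis by (auto simp: minimal_martin_boundary_def)
qed

end

locale completed_walk = hyperbolic_walk V E lev o\<^sub>0 \<delta> P m h \<epsilon> \<theta> t +
    completed_graph V E lev o\<^sub>0 \<delta> Y D eH a C\<^sub>D
  for V :: "'v set" and E :: "('v \<times> 'v) set" and lev :: "'v \<Rightarrow> nat" and o\<^sub>0 :: 'v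
    and \<delta> :: nat and P :: "'v \<Rightarrow> 'v \<Rightarrow> real" and m h :: "'v \<Rightarrow> real" and \<epsilon> \<theta> t :: real
    and Y :: "'b set" and D :: "'b \<Rightarrow> 'b \<Rightarrow> real" and eH :: "'v \<Rightarrow> 'b" and a C\<^sub>D :: real
begin

text \<open>The signatures of both compactifications are continuous and injective. For the hyperbolic one,
  continuity is convergence of the Martin kernels, and injectivity is separation of the limits.\<close>

theorem martin_homeomorphic_hyperbolic:
  assumes M: "martin_compactification V Kr T e"
  shows "\<exists>\<phi>. canonical_boundary_homeomorphism V mtopology eH T e \<phi>"
proof -
  have K: "kernel_compactification V Kr T e" using M by (simp add: martin_compactification_def)
  then have c: "compactification V T e" by (simp add: kernel_compactification_def)
  note T = compactification_dense[OF c]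
  have "\<forall>x\<in>V. \<exists>g. extends_continuously V T e (Kr x) g" using K by (simp add: kernel_compactification_def)
  then obtain f where f: "\<And>x. x \<in> V \<Longrightarrow> extends_continuously V T e (Kr x) (f x)" by metis
  have "\<exists>g. continuous_map mtopology euclideanreal g \<and> (\<forall>y\<in>V. g (eH y) = Kr x y)" if x: "x \<in> V" for x
  proof -
    have "Cauchy (\<lambda>n. Kr x (z n))" if "gromov_seq z" for z
      using martin_kernel_converges[OF that] x LIMSEQ_imp_Cauchy unfolding martin_limit_def by blast
    then show ?thesis using extend_to_completion[of "Kr x"] by metis
  qed
  then obtain g where g: "\<And>x. x \<in> V \<Longrightarrow> continuous_map mtopology euclideanreal (g x)"
    "\<And>x y. x \<in> V \<Longrightarrow> y \<in> V \<Longrightarrow> g x (eH y) = Kr x y" by metis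
  have lim: "martin_limit z (\<lambda>x. g x \<xi>)"
    if "gromov_seq z" "limitin mtopology (\<lambda>n. eH (z n)) \<xi> sequentially" for z \<xi>
    unfolding martin_limit_def
  proof
    fix x assume x: "x \<in> V"
    have "limitin euclideanreal (g x \<circ> (\<lambda>n. eH (z n))) (g x \<xi>) sequentially"
      by (rule continuous_map_limit[OF g(1)[OF x] that(2)])
    then show "(\<lambda>n. Kr x (z n)) \<longlonglongrightarrow> g x \<xi>" using g(2)[OF x gromov_seq_in[OF that(1)]] by (simp add: o_def)
  qed
  have inj: "inj_on (signature V eH g) (topspace mtopology)"
  proof (rule inj_onI)
    fix \<xi> \<eta> assume \<xi>\<eta>: "\<xi> \<in> topspace mtopology" "\<eta> \<in> topspace mtopology"
      and eq: "signature V eH g \<xi> = signature V eH g \<eta>"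
    show "\<xi> = \<eta>"
    proof (cases "\<xi> \<in> eH ` V \<or> \<eta> \<in> eH ` V")
      case True
      then consider x where "x \<in> V" "\<xi> = eH x" | x where "x \<in> V" "\<eta> = eH x" by blast
      then show ?thesis
      proof cases
        case 1
        then show ?thesis using signature_vertex[of x V eH g \<eta>] eq by simp
      next
        case 2
        then show ?thesis using signature_vertex[of x V eH g \<xi>] eq by simp
      qed
    next
      case False
      then have b: "\<xi> \<in> boundary_set V mtopology eH" "\<eta> \<in> boundary_set V mtopology eH"
        using \<xi>\<eta> by (auto simp: boundary_set_def)
      obtain z where z: "gromov_seq z" "limitin mtopology (\<lambda>n. eH (z n)) \<xi> sequentially"
        using boundary_approx[OF b(1)] .
      obtain z' where z': "gromov_seq z'" "limitin mtopology (\<lambda>n. eH (z' n)) \<eta> sequentially"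
        using boundary_approx[OF b(2)] .
      have geq: "g x \<xi> = g x \<eta>" if "x \<in> V" for x
        using fun_cong[OF eq, of "Inl x"] that by (simp add: signature_def)
      show ?thesis
      proof (rule boundary_eqI[OF z z'])
        fix k n\<^sub>0 :: nat
        define s where "s = (\<lambda>n. n + n\<^sub>0)"
        have s: "strict_mono s" by (simp add: s_def strict_mono_def)
        have "martin_limit (z \<circ> s) (\<lambda>x. g x \<xi>)" "martin_limit (z' \<circ> s) (\<lambda>x. g x \<xi>)"
          using martin_limit_subseq[OF lim[OF z] s] martin_limit_subseq[OF lim[OF z'] s] geq
          by (simp_all add: martin_limit_def)
        from martin_limit_separates[OF gromov_seq_subseq[OF z(1) s] gromov_seq_subseq[OF z'(1) s] this]
        obtain n where "real k \<le> gp (z (s n)) (z' (s n))" by auto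
        then show "\<exists>n\<ge>n\<^sub>0. real k \<le> gp (z n) (z' n)" by (intro exI[of _ "s n"]) (simp add: s_def)
      qed
    qed
  qed
  have eH_top: "eH ` V \<subseteq> topspace mtopology" "mtopology closure_of (eH ` V) = topspace mtopology"
    using eH_in eH_dense by auto
  obtain \<phi> where "homeomorphic_map mtopology T \<phi>" "\<And>x. x \<in> V \<Longrightarrow> \<phi> (eH x) = e x"
  proof (rule compactifications_homeomorphic[OF compact_completion eH_top(2) _ inj eH_top(1) T(4,3) _ _ T(2)
        Hausdorff_signature_space])
    show "continuous_map mtopology signature_space (signature V eH g)"
      using g open_vertex by (intro continuous_signature Hausdorff_space_mtopology) auto
    show "continuous_map T signature_space (signature V e f)"
      using f T by (intro continuous_signature) (auto simp: extends_continuously_def)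
    show "inj_on (signature V e f) (topspace T)" by (rule martin_compactification_separates[OF M f])
    show "signature V eH g (eH x) = signature V e f (e x)" if x: "x \<in> V" for x
    proof
      fix i
      show "signature V eH g (eH x) i = signature V e f (e x) i"
        using x g(2)[OF _ x] f T(1) inj_eH
        by (auto simp: signature_def extends_continuously_def inj_on_def split: sum.split)
    qed
  qed auto
  then show ?thesis using canonical_boundary_homeomorphismI[of mtopology T \<phi> V eH e] eH_top(1) T(2) by blast
qed

end

section \<open>Spectral radius\<close>

lemma limsup_root_const:
  assumes "0 \<le> q" "0 < c"
  shows "limsup (\<lambda>n. ereal (q * root n c)) = ereal q"
proof (rule lim_imp_Limsup)
  have "(\<lambda>n. q * root n c) \<longlonglongrightarrow> q * 1"
    using assms by (intro tendsto_mult tendsto_const LIMSEQ_root_const)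
  then show "(\<lambda>n. ereal (q * root n c)) \<longlonglongrightarrow> ereal q" by simp
qed simp

text \<open>If \<open>q\<close> exceeds the right-hand side, then \<open>a(n) \<le> q\<^sup>n q\<^sup>j/c\<close> for large \<open>n\<close>, and the roots of the
  constant \<open>q\<^sup>j/c\<close> tend to \<open>1\<close>.\<close>

lemma limsup_root_shift_le:
  fixes a b :: "nat \<Rightarrow> real"
  assumes a: "\<And>n. 0 \<le> a n" and b: "\<And>n. 0 \<le> b n" and c: "0 < c" and le: "\<And>n. c * a n \<le> b (n + j)"
  shows "limsup (\<lambda>n. ereal (root n (a n))) \<le> limsup (\<lambda>n. ereal (root n (b n)))"
proof (rule ccontr)
  assume "\<not> ?thesis"
  then obtain q where q: "limsup (\<lambda>n. ereal (root n (b n))) < ereal q"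
    "ereal q < limsup (\<lambda>n. ereal (root n (a n)))"
    using ereal_dense2 by (meson not_le)
  have ev: "\<forall>\<^sub>F n in sequentially. ereal (root n (b n)) < ereal q" by (rule Limsup_lessD[OF q(1)])
  then obtain N where N: "\<And>n. n \<ge> N \<Longrightarrow> root n (b n) < q" by (auto simp: eventually_sequentially)
  have q0: "0 < q" using N[of "Suc N"] b[of "Suc N"] real_root_ge_zero[of "b (Suc N)" "Suc N"] by linarith
  have "\<forall>\<^sub>F n in sequentially. ereal (root n (a n)) \<le> ereal (q * root n (q ^ j / c))"
    unfolding eventually_sequentially
  proof (intro exI[of _ "Suc N"] allI impI)
    fix n assume n: "Suc N \<le> n"
    have "b (n + j) = root (n + j) (b (n + j)) ^ (n + j)" using n b by (simp add: real_root_pow_pos2)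
    also have "\<dots> \<le> q ^ (n + j)" using N[of "n + j"] n b by (intro power_mono real_root_ge_zero) auto
    finally have "c * a n \<le> q ^ (n + j)" using le[of n] by linarith
    then have "a n \<le> q ^ n * (q ^ j / c)" using c by (simp add: power_add field_simps)
    then have "root n (a n) \<le> root n (q ^ n * (q ^ j / c))" using n by (intro real_root_le_mono) auto
    also have "\<dots> = root n (q ^ n) * root n (q ^ j / c)" by (rule real_root_mult)
    also have "root n (q ^ n) = q" using n q0 by (simp add: real_root_power_cancel)
    finally show "ereal (root n (a n)) \<le> ereal (q * root n (q ^ j / c))" by simp
  qed
  then have "limsup (\<lambda>n. ereal (root n (a n))) \<le> limsup (\<lambda>n. ereal (q * root n (q ^ j / c)))"
    by (rule Limsup_mono)
  also have "\<dots> = ereal q" using q0 c by (intro limsup_root_const) auto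
  finally show False using q(2) by simp
qed

context transient_walk
begin

lemma nstep_1: "(x, y) \<in> E \<Longrightarrow> P x y \<le> p 1 x y"
  using avg_ge_term[of x y "\<lambda>z. p 0 z y"] edge_in nstep_Suc[of x 0 y] by auto

lemma walk_uniformly_irreducible: "uniformly_irreducible V E P"
  unfolding uniformly_irreducible_def
proof (intro exI conjI)
  show "\<forall>(x, y)\<in>E. \<exists>k\<le>1. \<epsilon> \<le> p k x y"
    using nstep_1 P_edge by (intro ballI) (fastforce intro: exI[of _ "1::nat"])
qed (rule eps_pos)

lemma walk_bounded_range: "bounded_range V E P"
  unfolding bounded_range_def
proof (rule bdd_aboveI[of _ 1])
  fix n assume "n \<in> {gd x y |x y. x \<in> V \<and> y \<in> V \<and> P x y > 0}"
  then obtain x y where "n = gd x y" "x \<in> V" "y \<in> V" "P x y > 0" by blast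
  then show "n \<le> 1" using P_nonedge[of x y] gd_edge[of x y] by fastforce
qed

theorem spectral_radius_lt_1: "\<exists>s<1. has_spectral_radius V P s"
proof -
  define ls where "ls = (\<lambda>x y. limsup (\<lambda>n. ereal (root n (p n x y))))"
  have le: "ls x y \<le> ls x' y'" if V: "x \<in> V" "y \<in> V" "x' \<in> V" "y' \<in> V" for x y x' y'
  proof -
    obtain k where k: "0 < p k x' x" using nstep_positive V by blast
    obtain l where l: "0 < p l y y'" using nstep_positive V by blast
    have "(p k x' x * p l y y') * p n x y \<le> p (n + (k + l)) x' y'" for n
    proof -
      have "(p k x' x * p l y y') * p n x y = p k x' x * (p n x y * p l y y')" by simp
      also have "\<dots> \<le> p k x' x * p (n + l) x y'"
        using nstep_compose_le[of "{y}" x n l y'] V k by (intro mult_left_mono) auto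
      also have "\<dots> \<le> p (k + (n + l)) x' y'" using nstep_compose_le[of "{x}" x' k "n + l" y'] V by simp
      finally show ?thesis by (simp add: add_ac)
    qed
    then show ?thesis
      unfolding ls_def using V k l nstep_nonneg by (intro limsup_root_shift_le[where c = "p k x' x * p l y y'"]) auto
  qed
  have "ls o\<^sub>0 o\<^sub>0 \<le> ereal \<theta>"
  proof -
    have "\<forall>\<^sub>F n in sequentially. ereal (root n (p n o\<^sub>0 o\<^sub>0)) \<le> ereal (\<theta> * root n 1)"
      unfolding eventually_sequentially
    proof (intro exI[of _ 1] allI impI)
      fix n :: nat assume n: "1 \<le> n"
      have "p n o\<^sub>0 o\<^sub>0 \<le> \<theta> ^ n" using nstep_bound[OF base_in base_in, of n] h_pos[OF base_in] by simp
      then have "root n (p n o\<^sub>0 o\<^sub>0) \<le> root n (\<theta> ^ n)" using n by (intro real_root_le_mono) auto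
      then show "ereal (root n (p n o\<^sub>0 o\<^sub>0)) \<le> ereal (\<theta> * root n 1)"
        using n theta_pos by (simp add: real_root_power_cancel)
    qed
    then have "ls o\<^sub>0 o\<^sub>0 \<le> limsup (\<lambda>n. ereal (\<theta> * root n 1))" unfolding ls_def by (rule Limsup_mono)
    also have "\<dots> = ereal \<theta>" using theta_pos by (intro limsup_root_const) auto
    finally show ?thesis .
  qed
  moreover have "0 \<le> ls o\<^sub>0 o\<^sub>0"
    unfolding ls_def using nstep_nonneg[OF base_in]
    by (intro le_Limsup) (auto simp: eventually_sequentially intro!: exI[of _ 1] real_root_ge_zero)
  ultimately obtain s where s: "ls o\<^sub>0 o\<^sub>0 = ereal s" "s \<le> \<theta>" by (cases "ls o\<^sub>0 o\<^sub>0") auto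
  have "ls x y = ereal s" if "x \<in> V" "y \<in> V" for x y
    using le[OF that base_in base_in] le[OF base_in base_in that] s(1) by simp
  then show ?thesis
    using s(2) theta_lt_1 unfolding has_spectral_radius_def ls_def by (intro exI[of _ s]) auto
qed

end

section \<open>The tree of words\<close>

lemma word_prod_simps [simp]:
  "word_prod w [] = 1" "word_prod w (i # x) = w i * word_prod w x"
  "word_prod w (x @ y) = word_prod w x * word_prod w y"
  by (simp_all add: word_prod_def)

locale word_tree =
  fixes N :: nat and \<rho> :: "nat \<Rightarrow> real"
  assumes N_ge_2: "2 \<le> N" and ratio: "i \<in> {1..N} \<Longrightarrow> 0 < \<rho> i" "i \<in> {1..N} \<Longrightarrow> \<rho> i < 1"
begin

abbreviation "r \<equiv> min_ratio N \<rho>"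
abbreviation "J \<equiv> word_level_set N \<rho>"
abbreviation "V \<equiv> tree_vertices N \<rho>"
abbreviation "lv \<equiv> level N \<rho>"
abbreviation "par \<equiv> parent N \<rho>"
abbreviation "rp \<equiv> word_prod \<rho>"

lemma min_ratio_le: "i \<in> {1..N} \<Longrightarrow> r \<le> \<rho> i"
  unfolding min_ratio_def by (intro Min_le) auto

lemma min_ratio_attained: obtains i where "i \<in> {1..N}" "r = \<rho> i"
proof -
  have "r \<in> \<rho> ` {1..N}" unfolding min_ratio_def using N_ge_2 by (intro Min_in) auto
  then show ?thesis using that by blast
qed

lemma r_pos: "0 < r" and r_lt_1: "r < 1"
  using min_ratio_attained ratio by metis+

lemma word_prod_pos:
  assumes "\<And>i. i \<in> {1..N} \<Longrightarrow> 0 < w i" "x \<in> lists {1..N}"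
  shows "0 < word_prod w x"
  using assms(2) by induction (auto simp: assms(1))

lemma rp_pos: "x \<in> lists {1..N} \<Longrightarrow> 0 < rp x"
  using ratio by (intro word_prod_pos) auto

lemma rp_le_1: "x \<in> lists {1..N} \<Longrightarrow> rp x \<le> 1"
proof (induction x rule: lists.induct)
  case (Cons i x)
  then show ?case using ratio[of i] rp_pos[of x] by (simp add: mult_le_one)
qed simp

lemma ratio_uniform: obtains q where "0 < q" "q < 1" "\<And>x. x \<in> lists {1..N} \<Longrightarrow> rp x \<le> q ^ length x"
proof -
  define q where "q = Max (\<rho> ` {1..N})"
  have "q \<in> \<rho> ` {1..N}" unfolding q_def using N_ge_2 by (intro Max_in) auto
  then have q: "0 < q" "q < 1" using ratio by auto
  have qi: "\<rho> i \<le> q" if "i \<in> {1..N}" for i unfolding q_def using that by (intro Max_ge) auto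
  have "rp x \<le> q ^ length x" if "x \<in> lists {1..N}" for x
    using that
  proof (induction x rule: lists.induct)
    case (Cons i x)
    then show ?case using qi[of i] ratio[of i] rp_pos[of x] q by (auto intro!: mult_mono)
  qed simp
  then show ?thesis using that q by blast
qed

lemma length_bound:
  assumes "0 < e"
  obtains M where "\<And>x. x \<in> lists {1..N} \<Longrightarrow> e < rp x \<Longrightarrow> length x < M"
proof -
  obtain q where q: "0 < q" "q < 1" "\<And>x. x \<in> lists {1..N} \<Longrightarrow> rp x \<le> q ^ length x" using ratio_uniform by blast
  obtain M where M: "q ^ M < e" using real_arch_pow_inv[OF assms q(2)] by blast
  have "length x < M" if "x \<in> lists {1..N}" "e < rp x" for x
  proof (rule ccontr)
    assume "\<not> length x < M"
    then have "q ^ length x \<le> q ^ M" using q by (intro power_decreasing) auto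
    then show False using q(3)[OF that(1)] that(2) M by linarith
  qed
  then show ?thesis using that by blast
qed

lemma level_bounds:
  assumes "x \<in> J n"
  shows "x \<in> lists {1..N}" "rp x \<le> r ^ n" "r ^ Suc n < rp x"
proof -
  have "x \<in> lists {1..N} \<and> rp x \<le> r ^ n \<and> r ^ Suc n < rp x"
  proof (cases "n = 0")
    case True
    then show ?thesis using assms r_lt_1 by (simp add: word_level_set_def)
  next
    case False
    then have x: "x \<in> lists {1..N}" "x \<noteq> []" "rp x \<le> r ^ n" "r ^ n < rp (butlast x)"
      using assms by (auto simp: word_level_set_def)
    have bl: "rp x = rp (butlast x) * \<rho> (last x)" "last x \<in> {1..N}"
      using x word_prod_simps(3)[of \<rho> "butlast x" "[last x]"] last_in_set[OF x(2)] by (auto simp: in_lists_conv_set)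
    have "r ^ n * r < rp (butlast x) * \<rho> (last x)"
      using x(4) min_ratio_le[OF bl(2)] r_pos by (intro mult_less_le_imp_less) auto
    then show ?thesis using x bl by (simp add: mult.commute)
  qed
  then show "x \<in> lists {1..N}" "rp x \<le> r ^ n" "r ^ Suc n < rp x" by auto
qed

lemma J_0 [simp]: "J 0 = {[]}" by (simp add: word_level_set_def)

lemma level_unique:
  assumes "x \<in> J n" "x \<in> J k"
  shows "n = k"
proof -
  have "\<not> n < k" if "x \<in> J n" "x \<in> J k" for n k
  proof
    assume "n < k"
    then have "r ^ k \<le> r ^ Suc n" using r_pos r_lt_1 by (intro power_decreasing) auto
    then show False using level_bounds[OF that(1)] level_bounds[OF that(2)] by linarith
  qed
  then show ?thesis using assms by (meson nat_neq_iff)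
qed

lemma level_eq: "x \<in> J n \<Longrightarrow> lv x = n"
  unfolding level_def using level_unique by blast

lemma vertex_iff: "x \<in> V \<longleftrightarrow> x \<in> J (lv x)"
  unfolding tree_vertices_def using level_eq by auto

lemma J_in_V: "x \<in> J n \<Longrightarrow> x \<in> V"
  unfolding tree_vertices_def by auto

lemma level_set_eq: "{x \<in> V. lv x = n} = J n"
  using vertex_iff level_eq J_in_V by blast

lemma root_in_V: "[] \<in> V" by (rule J_in_V[of _ 0]) simp

lemma level_eq_0_iff: "x \<in> V \<Longrightarrow> lv x = 0 \<longleftrightarrow> x = []"
  using vertex_iff[of x] level_eq[of "[]" 0] by auto

lemma level_antichain:
  assumes "v \<in> J n" "v' \<in> J n" "prefix v v'"
  shows "v = v'"
proof (rule ccontr)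
  assume ne: "v \<noteq> v'"
  have n: "n \<noteq> 0"
  proof
    assume "n = 0"
    then show False using assms ne by simp
  qed
  obtain w where w: "v' = v @ w" "w \<noteq> []" using assms ne by (auto simp: prefix_def)
  then have "butlast v' = v @ butlast w" by (simp add: butlast_append)
  moreover have "set (butlast w) \<subseteq> {1..N}"
    using level_bounds(1)[OF assms(2)] w in_set_butlastD by (fastforce simp: in_lists_conv_set)
  ultimately have "rp (butlast v') \<le> rp v"
    using rp_le_1[of "butlast w"] rp_pos[OF level_bounds(1)[OF assms(1)]]
    by (simp add: in_lists_conv_set subset_iff mult_left_le)
  then show False using assms n level_bounds(2)[OF assms(1)] by (auto simp: word_level_set_def)
qed

lemma prefix_in_level:
  assumes "u \<in> lists {1..N}" "rp u \<le> r ^ n"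
  shows "\<exists>v. prefix v u \<and> v \<in> J n"
proof (cases "n = 0")
  case False
  show ?thesis
    using assms
  proof (induction u rule: rev_induct)
    case Nil
    then show ?case using False r_pos r_lt_1 power_less_one_iff[of r n] by auto
  next
    case (snoc i u)
    show ?case
    proof (cases "rp u \<le> r ^ n")
      case True
      then obtain v where "prefix v u" "v \<in> J n" using snoc by auto
      then show ?thesis by (auto intro: prefix_append[THEN iffD2])
    next
      case False
      then have "u @ [i] \<in> J n" using snoc \<open>n \<noteq> 0\<close> by (auto simp: word_level_set_def)
      then show ?thesis by blast
    qed
  qed
qed simp

lemma parent_eq:
  assumes "x \<in> J (Suc n)" "u \<in> J n" "prefix u x"
  shows "par x = u"
  unfolding parent_def
proof (rule the_equality)
  show "prefix u x \<and> u \<in> J (lv x - 1)" using assms level_eq[OF assms(1)] by simp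
  fix v assume "prefix v x \<and> v \<in> J (lv x - 1)"
  then have v: "prefix v x" "v \<in> J n" using level_eq[OF assms(1)] by auto
  then have "prefix u v \<or> prefix v u" using assms(3) prefix_same_cases by blast
  then show "v = u" using level_antichain v assms(2) by blast
qed

lemma parent_props:
  assumes "x \<in> J (Suc n)"
  shows "par x \<in> J n" "prefix (par x) x"
proof -
  have "r ^ Suc n \<le> r ^ n" using r_pos r_lt_1 by (intro power_decreasing) auto
  then obtain u where "prefix u x" "u \<in> J n"
    using prefix_in_level[of x n] level_bounds[OF assms] by auto
  then show "par x \<in> J n" "prefix (par x) x" using parent_eq[OF assms] by auto
qed

lemma vertex_cases:
  assumes "x \<in> V"
  obtains "x = []" | n where "x \<in> J (Suc n)" "lv x = Suc n" "par x \<in> J n" "lv (par x) = n" "x \<noteq> []"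
proof (cases "lv x")
  case 0
  then show ?thesis using that(1) level_eq_0_iff[OF assms] by simp
next
  case (Suc n)
  then have "x \<in> J (Suc n)" using assms vertex_iff by metis
  then show ?thesis using that(2)[of n] parent_props[of x n] level_eq Suc level_eq_0_iff[OF assms] by auto
qed

lemma finite_level: "finite (J n)"
proof -
  obtain M where M: "\<And>x. x \<in> lists {1..N} \<Longrightarrow> r ^ Suc n < rp x \<Longrightarrow> length x < M"
    using length_bound[of "r ^ Suc n"] r_pos by auto
  have "J n \<subseteq> {xs. set xs \<subseteq> {1..N} \<and> length xs \<le> M}"
    using M level_bounds by (fastforce simp: in_lists_conv_set)
  then show ?thesis using finite_lists_length_le[of "{1..N}" M] finite_subset by auto
qed

text \<open>The words of a level form a complete prefix code, so they split the weight of a shorter word.\<close>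

lemma sum_weights_level:
  assumes p: "(\<Sum>i=1..N. w i) = (1::real)" and n: "0 < n"
    and u: "u \<in> lists {1..N}" "u \<in> J n \<or> r ^ n < rp u"
  shows "(\<Sum>y\<in>{y \<in> J n. prefix u y}. word_prod w y) = word_prod w u"
proof -
  obtain M where M: "\<And>x. x \<in> lists {1..N} \<Longrightarrow> r ^ n < rp x \<Longrightarrow> length x < M"
    using length_bound[of "r ^ n"] r_pos by auto
  show ?thesis
    using u
  proof (induction "M - length u" arbitrary: u rule: less_induct)
    case less
    show ?case
    proof (cases "u \<in> J n")
      case True
      then have "{y \<in> J n. prefix u y} = {u}" using level_antichain by auto
      then show ?thesis by simp
    next
      case False
      then have ru: "r ^ n < rp u" using less.prems by simp
      have split: "{y \<in> J n. prefix u y} = (\<Union>i\<in>{1..N}. {y \<in> J n. prefix (u @ [i]) y})"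
      proof (intro equalityI subsetI)
        fix y assume "y \<in> {y \<in> J n. prefix u y}"
        then obtain v where y: "y \<in> J n" "y = u @ v" by (auto simp: prefix_def)
        then obtain i v' where v: "v = i # v'" using False by (cases v) auto
        then have "i \<in> {1..N}" using level_bounds(1)[OF y(1)] y by (auto simp: in_lists_conv_set)
        then show "y \<in> (\<Union>i\<in>{1..N}. {y \<in> J n. prefix (u @ [i]) y})" using y v by (auto simp: prefix_def)
      qed (auto dest: append_prefixD)
      have "(\<Sum>y\<in>{y \<in> J n. prefix u y}. word_prod w y)
          = (\<Sum>i\<in>{1..N}. \<Sum>y\<in>{y \<in> J n. prefix (u @ [i]) y}. word_prod w y)"
        unfolding split using finite_level
        by (intro sum.UNION_disjoint) (auto simp: prefix_def)
      also have "\<dots> = (\<Sum>i\<in>{1..N}. word_prod w (u @ [i]))"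
      proof (rule sum.cong)
        fix i assume i: "i \<in> {1..N}"
        have "length u < M" by (rule M[OF less.prems(1) ru])
        moreover have "u @ [i] \<in> lists {1..N}" using i less.prems(1) by auto
        moreover have "u @ [i] \<in> J n \<or> r ^ n < rp (u @ [i])"
          using i less.prems(1) ru n by (auto simp: word_level_set_def)
        ultimately show "(\<Sum>y\<in>{y \<in> J n. prefix (u @ [i]) y}. word_prod w y) = word_prod w (u @ [i])"
          by (intro less.hyps) auto
      qed simp
      also have "\<dots> = word_prod w u" using p by (simp add: sum_distrib_left[symmetric])
      finally show ?thesis .
    qed
  qed
qed

definition children :: "nat list \<Rightarrow> nat list set" where
  "children x = {y \<in> V. y \<noteq> [] \<and> par y = x}"

lemma children_eq:
  assumes "x \<in> J n"
  shows "children x = {y \<in> J (Suc n). prefix x y}"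
proof (intro equalityI subsetI)
  fix y assume "y \<in> children x"
  then have y: "y \<in> V" "y \<noteq> []" "par y = x" by (auto simp: children_def)
  from y(1) show "y \<in> {y \<in> J (Suc n). prefix x y}"
  proof (cases rule: vertex_cases)
    case (2 k)
    then have "k = n" using y(3) assms level_unique by blast
    then show ?thesis using 2 y(3) parent_props(2) by auto
  qed (use y in auto)
next
  fix y assume "y \<in> {y \<in> J (Suc n). prefix x y}"
  then have y: "y \<in> J (Suc n)" "prefix x y" by auto
  then show "y \<in> children x"
    using parent_eq[OF y(1) assms y(2)] J_in_V[OF y(1)] level_eq[OF y(1)] level_eq[of "[]" 0] by (auto simp: children_def)
qed

lemma sum_children:
  assumes "x \<in> J n" "(\<Sum>i=1..N. w i) = (1::real)"
  shows "(\<Sum>y\<in>children x. word_prod w y) = word_prod w x"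
  unfolding children_eq[OF assms(1)]
  using level_bounds[OF assms(1)] by (intro sum_weights_level[OF assms(2)]) auto

lemma child_suffix_length:
  obtains M where "\<And>x y n. x \<in> J n \<Longrightarrow> y \<in> children x \<Longrightarrow>
    \<exists>v. y = x @ v \<and> v \<in> lists {1..N} \<and> length v < M"
proof -
  obtain M where M: "\<And>x. x \<in> lists {1..N} \<Longrightarrow> r ^ 2 < rp x \<Longrightarrow> length x < M"
    using length_bound[of "r ^ 2"] r_pos by auto
  have "\<exists>v. y = x @ v \<and> v \<in> lists {1..N} \<and> length v < M" if x: "x \<in> J n" and y: "y \<in> children x" for x y n
  proof -
    have yJ: "y \<in> J (Suc n)" and "prefix x y" using y children_eq[OF x] by auto
    then obtain v where v: "y = x @ v" by (auto simp: prefix_def)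
    have vN: "v \<in> lists {1..N}" using level_bounds(1)[OF yJ] v by simp
    have "r ^ 2 * rp x \<le> r ^ 2 * r ^ n" using level_bounds(2)[OF x] r_pos by (intro mult_left_mono) auto
    also have "\<dots> = r ^ Suc (Suc n)" by (simp add: power2_eq_square)
    also have "\<dots> < rp y" by (rule level_bounds(3)[OF yJ])
    finally have "r ^ 2 < rp v" using v rp_pos[OF level_bounds(1)[OF x]] by (simp add: mult.commute)
    then show ?thesis using M[OF vN] v vN by blast
  qed
  then show ?thesis using that by blast
qed

end

section \<open>Quasi-natural random walks\<close>

locale pre_augmented_word_tree = word_tree N \<rho> for N :: nat and \<rho> :: "nat \<Rightarrow> real" +
  fixes Eh :: "(nat list \<times> nat list) set"
  assumes pre_augmented: "pre_augmented_tree N \<rho> Eh"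
begin

abbreviation "E \<equiv> tree_edges N \<rho> Eh"

lemma horizontal:
  assumes "(x, y) \<in> Eh"
  shows "x \<in> V" "y \<in> V" "lv x = lv y" "(y, x) \<in> Eh" "x \<noteq> y" "x \<noteq> []"
proof -
  have *: "x \<in> V" "y \<in> V" "lv x = lv y" "(y, x) \<in> Eh" "x \<noteq> y"
    using pre_augmented assms unfolding pre_augmented_tree_def by (auto dest: symD irreflD)
  then show "x \<in> V" "y \<in> V" "lv x = lv y" "(y, x) \<in> Eh" "x \<noteq> y" by auto
  show "x \<noteq> []" using * level_eq_0_iff by metis
qed

lemma edge_iff:
  "(x, y) \<in> E \<longleftrightarrow> (x, y) \<in> Eh \<or> x \<in> V \<and> y \<in> V \<and> (y \<noteq> [] \<and> x = par y \<or> x \<noteq> [] \<and> y = par x)"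
  unfolding tree_edges_def vertical_edges_def by auto

lemma level_parent: "x \<in> V \<Longrightarrow> x \<noteq> [] \<Longrightarrow> Suc (lv (par x)) = lv x"
  by (cases rule: vertex_cases) auto

lemma parent_in_V: "x \<in> V \<Longrightarrow> x \<noteq> [] \<Longrightarrow> par x \<in> V"
  by (cases rule: vertex_cases) (auto intro: J_in_V)

sublocale level_graph V E lv "[]"
proof
  show "E \<subseteq> V \<times> V" using horizontal by (auto simp: edge_iff)
  show "sym E" using horizontal by (auto simp: edge_iff intro!: symI)
  show "[] \<in> V" by (rule root_in_V)
  show "lv x = 0 \<longleftrightarrow> x = []" if "x \<in> V" for x using level_eq_0_iff[OF that] .
  show "lv x \<le> Suc (lv y)" if "(x, y) \<in> E" for x y
    using that horizontal level_parent[of x] level_parent[of y] by (auto simp: edge_iff)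
  show "\<exists>y. (x, y) \<in> E \<and> Suc (lv y) = lv x" if "x \<in> V" "x \<noteq> []" for x
    using that level_parent parent_in_V by (auto simp: edge_iff intro!: exI[of _ "par x"])
  show "finite {x \<in> V. lv x = n}" for n unfolding level_set_eq by (rule finite_level)
qed

lemma neighbours:
  assumes "x \<in> V"
  shows "E `` {x} = (if x = [] then {} else {par x}) \<union> children x \<union> Eh `` {x}"
  using assms parent_in_V by (auto simp: edge_iff children_def dest: horizontal)

lemma sum_neighbours:
  assumes "x \<in> V"
  shows "(\<Sum>z\<in>E `` {x}. f z) = (if x = [] then 0 else f (par x)) + (\<Sum>z\<in>children x. f z) + (\<Sum>z\<in>Eh `` {x}. f z)"
proof -
  have fin: "finite (children x)" "finite (Eh `` {x})"
    using finite_nb[of x] unfolding neighbours[OF assms] by auto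
  have "lv z = Suc (lv x)" if "z \<in> children x" for z
    using that level_parent[of z] by (auto simp: children_def)
  moreover have "lv z = lv x" if "z \<in> Eh `` {x}" for z using that horizontal by auto
  moreover have "Suc (lv (par x)) = lv x" if "x \<noteq> []" using level_parent[OF assms that] .
  ultimately have disj: "children x \<inter> Eh `` {x} = {}" "x \<noteq> [] \<Longrightarrow> par x \<notin> children x \<union> Eh `` {x}"
    by fastforce+
  show ?thesis
  proof (cases "x = []")
    case True
    then show ?thesis unfolding neighbours[OF assms] using fin disj by (simp add: sum.union_disjoint)
  next
    case False
    then have "(\<Sum>z\<in>E `` {x}. f z) = f (par x) + (\<Sum>z\<in>children x \<union> Eh `` {x}. f z)"
      unfolding neighbours[OF assms] using fin disj by (simp add: sum.insert)
    then show ?thesis using False fin disj by (simp add: sum.union_disjoint add.assoc)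
  qed
qed

text \<open>The conductances make the walk drift away from the root: the children of \<open>x\<close> carry \<open>1/\<lambda>\<close> times
  the conductance of the edge to the parent. For the vertical part of the walk, \<open>b\<close> to the power of
  the level is therefore harmonic away from the root if \<open>b = 1\<close> or \<open>b = \<lambda>\<close>, and strictly
  superharmonic for values of \<open>b\<close> in between, such as \<open>\<surd>\<lambda>\<close>. Horizontal edges do not change this
  function, and bounded degree limits their share of the total conductance.\<close>

lemma walk_transient:
  assumes lam: "0 < lam" "lam < 1" and walk: "quasi_natural_walk N \<rho> Eh lam P" and bd: "bounded_degree V E"
  obtains m h \<epsilon> \<theta> t where "transient_walk V E lv [] P m h \<epsilon> \<theta> t"
proof -
  obtain c p where wk: "\<forall>x\<in>V. \<forall>y\<in>V. P x y = c x y / (\<Sum>\<^sub>\<infinity>z\<in>V. c x z)"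
    "\<forall>x\<in>V. \<forall>y\<in>V. c x y = c y x \<and> 0 \<le> c x y"
    "\<forall>m\<ge>1. \<forall>x\<in>J m. c x (par x) = word_prod p x * (1 / lam) ^ m"
    "\<forall>x\<in>V. \<forall>y\<in>V. (x, y) \<notin> E \<longrightarrow> c x y = 0"
    and p0: "\<forall>i\<in>{1..N}. 0 < p i" "(\<Sum>i=1..N. p i) = 1"
    and "\<exists>A>0. \<exists>B>0. \<forall>(x, y)\<in>Eh. A * c x (par x) \<le> c x y \<and> c x y \<le> B * c x (par x)"
    using walk unfolding quasi_natural_walk_def Let_def by blast
  then obtain A B where AB0: "A > 0" "B > 0"
    "\<forall>(x, y)\<in>Eh. A * c x (par x) \<le> c x y \<and> c x y \<le> B * c x (par x)"
    by (elim exE conjE)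
  have P: "P x y = c x y / (\<Sum>\<^sub>\<infinity>z\<in>V. c x z)" if "x \<in> V" "y \<in> V" for x y
    using wk(1) that by simp
  have c: "\<And>x y. x \<in> V \<Longrightarrow> y \<in> V \<Longrightarrow> c x y = c y x" "\<And>x y. x \<in> V \<Longrightarrow> y \<in> V \<Longrightarrow> 0 \<le> c x y"
    using wk(2) by blast+
  have p: "\<And>i. i \<in> {1..N} \<Longrightarrow> 0 < p i" "(\<Sum>i=1..N. p i) = 1" using p0 by auto
  have cp: "c x (par x) = word_prod p x * (1 / lam) ^ n" if "n \<ge> 1" "x \<in> J n" for n x
    using wk(3) that by blast
  have AB: "A > 0" "B > 0" "\<And>x y. (x, y) \<in> Eh \<Longrightarrow> A * c x (par x) \<le> c x y \<and> c x y \<le> B * c x (par x)"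
    using AB0 by auto
  have c0: "c x y = 0" if "x \<in> V" "y \<in> V" "(x, y) \<notin> E" for x y
    using wk(4) that by blast
  obtain Dg where Dg: "\<And>x. x \<in> V \<Longrightarrow> card (E `` {x}) \<le> Dg" using bd by (auto simp: bounded_degree_def)
  define W where "W = (\<lambda>x. word_prod p x * (1 / lam) ^ lv x)"
  have W_pos: "0 < W x" if "x \<in> V" for x
    using that lam word_prod_pos[of p x] p level_bounds(1)[of x "lv x"] vertex_iff[of x] by (auto simp: W_def)
  have cW: "c x (par x) = W x" if "x \<in> V" "x \<noteq> []" for x
  proof -
    have "1 \<le> lv x" using level_eq_0_iff[OF that(1)] that(2) by simp
    then show ?thesis using cp vertex_iff that(1) by (simp add: W_def)
  qed
  have cch: "c x z = W z" if "x \<in> V" "z \<in> children x" for x z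
    using that cW[of z] c(1)[of x z] by (auto simp: children_def)
  have lv_child: "lv z = Suc (lv x)" if "z \<in> children x" for x z
    using that level_parent[of z] by (auto simp: children_def)
  have Wch: "(\<Sum>z\<in>children x. W z) = W x / lam" if "x \<in> V" for x
  proof -
    have "(\<Sum>z\<in>children x. W z) = (\<Sum>z\<in>children x. word_prod p z * (1 / lam) ^ Suc (lv x))"
      by (intro sum.cong refl) (simp only: W_def lv_child)
    also have "\<dots> = word_prod p x * (1 / lam) ^ Suc (lv x)"
      unfolding sum_distrib_right[symmetric] using sum_children[of x "lv x" p] that p vertex_iff by auto
    finally show ?thesis by (simp add: W_def)
  qed
  define m where "m = (\<lambda>x. \<Sum>z\<in>E `` {x}. c x z)"
  define H where "H = (\<lambda>x. \<Sum>z\<in>Eh `` {x}. c x z)"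
  have m_inf: "(\<Sum>\<^sub>\<infinity>z\<in>V. c x z) = m x" if "x \<in> V" for x
  proof -
    have "(\<Sum>\<^sub>\<infinity>z\<in>V. c x z) = (\<Sum>\<^sub>\<infinity>z\<in>E `` {x}. c x z)"
      using that c0 edge_in by (intro infsum_cong_neutral) auto
    then show ?thesis using finite_nb by (simp add: m_def)
  qed
  have csum: "(\<Sum>z\<in>E `` {x}. c x z * b ^ lv z)
      = (if x = [] then 0 else W x * b ^ (lv x - 1)) + W x / lam * b ^ Suc (lv x) + H x * b ^ lv x"
    if x: "x \<in> V" for x and b :: real
  proof -
    have "(\<Sum>z\<in>children x. c x z * b ^ lv z) = (\<Sum>z\<in>children x. W z * b ^ Suc (lv x))"
      by (intro sum.cong refl) (simp only: cch[OF x] lv_child)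
    also have "\<dots> = W x / lam * b ^ Suc (lv x)" using Wch[OF x] by (simp only: sum_distrib_right[symmetric])
    finally have ch: "(\<Sum>z\<in>children x. c x z * b ^ lv z) = W x / lam * b ^ Suc (lv x)" .
    have hz: "(\<Sum>z\<in>Eh `` {x}. c x z * b ^ lv z) = H x * b ^ lv x"
      unfolding H_def sum_distrib_right using horizontal(3) by (intro sum.cong) auto
    have up: "(if x = [] then 0 else c x (par x) * b ^ lv (par x)) = (if x = [] then 0 else W x * b ^ (lv x - 1))"
    proof (cases "x = []")
      case False
      then show ?thesis using cW[OF x] level_parent[OF x False] by (metis diff_Suc_1)
    qed simp
    show ?thesis unfolding sum_neighbours[OF x] ch hz up by (rule refl)
  qed
  have m_eq: "m x = (if x = [] then 0 else W x) + W x / lam + H x" if "x \<in> V" for x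
    using csum[OF that, of 1] by (simp add: m_def)
  define M where "M = 1 + 1 / lam + real Dg * B"
  have H0: "0 \<le> H x" "H x \<le> real Dg * B * W x" if x: "x \<in> V" for x
  proof -
    have Hz: "0 \<le> c x z" "c x z \<le> B * W x" if "z \<in> Eh `` {x}" for z
      using that AB(3)[of x z] c(2)[of x z] cW[of x] horizontal[of x z] by auto
    then show "0 \<le> H x" unfolding H_def by (intro sum_nonneg)
    have "Eh `` {x} \<subseteq> E `` {x}" by (auto simp: edge_iff)
    then have "card (Eh `` {x}) \<le> Dg"
      using card_mono[OF finite_nb] Dg[OF x] order_trans by blast
    then have "real (card (Eh `` {x})) * (B * W x) \<le> real Dg * (B * W x)"
      using AB W_pos[OF x] by (intro mult_right_mono) auto
    moreover have "H x \<le> real (card (Eh `` {x})) * (B * W x)"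
      unfolding H_def using Hz by (intro sum_bounded_above) auto
    ultimately show "H x \<le> real Dg * B * W x" by simp
  qed
  have W_le: "W x \<le> W x / lam" if "x \<in> V" for x
    using W_pos[OF that] lam by (simp add: field_simps)
  have m_bounds: "W x \<le> m x" "m x \<le> M * W x" if "x \<in> V" for x
    using m_eq[OF that] H0[OF that] W_pos[OF that] W_le[OF that] by (auto simp: M_def distrib_right)
  have m_pos: "0 < m x" if "x \<in> V" for x using m_bounds(1)[OF that] W_pos[OF that] by linarith
  have M1: "1 \<le> M" using lam AB by (simp add: M_def)
  define b where "b = sqrt lam"
  have b: "0 < b" "b < 1" "b * b = lam" using lam by (auto simp: b_def real_sqrt_lt_1_iff)
  define \<theta> where "\<theta> = max b (1 - (1 / b - 1)\<^sup>2 / M)"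
  have "1 < 1 / b" using b by (simp add: field_simps)
  then have th: "0 < \<theta>" "\<theta> < 1" using b M1 by (auto simp: \<theta>_def)
  have contract: "(\<Sum>z\<in>E `` {x}. c x z * b ^ lv z) \<le> \<theta> * (m x * b ^ lv x)" if x: "x \<in> V" for x
  proof (cases "x = []")
    case True
    have "Eh `` {[]} = {}" using horizontal(6) by auto
    then have "H x = 0" using True by (simp add: H_def)
    moreover have "lv x = 0" using level_eq_0_iff[OF x] True by simp
    ultimately have "(\<Sum>z\<in>E `` {x}. c x z * b ^ lv z) = b * (m x * b ^ lv x)"
      using csum[OF x, of b] m_eq[OF x] True by simp
    also have "\<dots> \<le> \<theta> * (m x * b ^ lv x)"
      using m_pos[OF x] b by (intro mult_right_mono) (auto simp: \<theta>_def)
    finally show ?thesis .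
  next
    case False
    then obtain k where k: "lv x = Suc k" using level_eq_0_iff[OF x] not0_implies_Suc by blast
    have "(1 / b - 1)\<^sup>2 / M * m x \<le> (1 / b - 1)\<^sup>2 * W x"
    proof -
      have "(1 / b - 1)\<^sup>2 / M * m x \<le> (1 / b - 1)\<^sup>2 / M * (M * W x)"
        using m_bounds(2)[OF x] M1 by (intro mult_left_mono) auto
      then show ?thesis using M1 by simp
    qed
    moreover have "(1 / b - 1)\<^sup>2 * W x = W x / lam - 2 * W x / b + W x"
      using b by (simp add: power2_eq_square field_simps b(3)[symmetric])
    ultimately have "2 * W x / b + H x \<le> (1 - (1 / b - 1)\<^sup>2 / M) * m x"
      using m_eq[OF x] False by (simp add: left_diff_distrib)
    also have "\<dots> \<le> \<theta> * m x" using m_pos[OF x] by (intro mult_right_mono) (auto simp: \<theta>_def)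
    finally have "(2 * W x / b + H x) * b ^ lv x \<le> \<theta> * m x * b ^ lv x"
      using b by (intro mult_right_mono) auto
    moreover have "(\<Sum>z\<in>E `` {x}. c x z * b ^ lv z) = (2 * W x / b + H x) * b ^ lv x"
      unfolding csum[OF x] using False k b by (simp add: field_simps b(3)[symmetric])
    ultimately show ?thesis by simp
  qed
  have Pm: "P x y = c x y / m x" if "x \<in> V" "y \<in> V" for x y using P[OF that] m_inf that by simp
  \<comment> \<open>\<open>pm ^ L\<close> is a lower bound for the weight of a suffix that leads from a vertex to a child\<close>
  obtain L where L: "\<And>x y n. x \<in> J n \<Longrightarrow> y \<in> children x \<Longrightarrow> \<exists>v. y = x @ v \<and> v \<in> lists {1..N} \<and> length v < L"
    using child_suffix_length by blast
  define pm where "pm = Min (p ` {1..N})"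
  have pm_le: "pm \<le> p i" if "i \<in> {1..N}" for i unfolding pm_def using that by (intro Min_le) auto
  have "pm \<in> p ` {1..N}" unfolding pm_def using N_ge_2 by (intro Min_in) auto
  then have pm: "0 < pm" using p by auto
  have "p 1 \<le> (\<Sum>i=1..N. p i)"
    using p(1) N_ge_2 by (intro member_le_sum) (auto intro: less_imp_le)
  then have pm1: "pm \<le> 1" using pm_le[of 1] p(2) N_ge_2 by auto
  have pm_pow: "pm ^ L \<le> word_prod p v" if "v \<in> lists {1..N}" "length v < L" for v
  proof -
    have "pm ^ length v \<le> word_prod p v" using that(1)
    proof (induction v rule: lists.induct)
      case (Cons i v)
      then show ?case using pm_le[of i] pm by (auto intro!: mult_mono)
    qed simp
    moreover have "pm ^ L \<le> pm ^ length v" using that pm pm1 by (intro power_decreasing) auto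
    ultimately show ?thesis by linarith
  qed
  define \<kappa> where "\<kappa> = min A (pm ^ L)"
  have kap: "0 < \<kappa>" "\<kappa> \<le> 1" using AB pm pm1 power_le_one[of pm L] by (auto simp: \<kappa>_def)
  have cW_lower: "\<kappa> * W x \<le> c x y" if e: "(x, y) \<in> E" for x y
  proof -
    have V: "x \<in> V" "y \<in> V" using e edge_in by auto
    then consider "x \<noteq> []" "y = par x" | "y \<in> children x" | "(x, y) \<in> Eh"
      using e unfolding edge_iff children_def by auto
    then show ?thesis
    proof cases
      case 1
      then show ?thesis using cW[OF V(1)] kap W_pos[OF V(1)] by simp
    next
      case 2
      then obtain v where v: "y = x @ v" "v \<in> lists {1..N}" "length v < L"
        using L[of x "lv x" y] V vertex_iff by blast
      have "\<kappa> \<le> word_prod p v" using pm_pow[OF v(2,3)] by (simp add: \<kappa>_def)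
      then have "\<kappa> * W x \<le> word_prod p v * W x" using W_pos[OF V(1)] by (intro mult_right_mono) auto
      also have "\<dots> \<le> word_prod p v * (W x / lam)"
        using W_le[OF V(1)] less_imp_le[OF word_prod_pos[where w = p, OF p(1) v(2)]] by (intro mult_left_mono)
      also have "\<dots> = W y"
      proof -
        have "lv y = Suc (lv x)" by (rule lv_child[OF 2])
        then show ?thesis using v(1) by (simp add: W_def)
      qed
      finally show ?thesis using cch[OF V(1) 2] by simp
    next
      case 3
      have "\<kappa> * W x \<le> A * W x" using W_pos[OF V(1)] by (intro mult_right_mono) (auto simp: \<kappa>_def)
      then show ?thesis using AB(3)[OF 3] cW[OF V(1) horizontal(6)[OF 3]] by simp
    qed
  qed
  define t where "t = (1 + 1 / \<theta>) / 2"
  have "transient_walk V E lv [] P m (\<lambda>x. b ^ lv x) (\<kappa> / M) \<theta> t"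
  proof
    show "0 < \<kappa> / M" "\<kappa> / M \<le> 1" using kap M1 by auto
    show "\<kappa> / M \<le> P x y" if "(x, y) \<in> E" for x y
    proof -
      have V: "x \<in> V" "y \<in> V" using that edge_in by auto
      have "\<kappa> * m x \<le> \<kappa> * (M * W x)" using m_bounds(2)[OF V(1)] kap by (intro mult_left_mono) auto
      also have "\<dots> \<le> M * c x y" using cW_lower[OF that] M1 by simp
      finally have "\<kappa> * m x / M \<le> c x y" using M1 by (simp add: pos_divide_le_eq mult.commute)
      then show ?thesis unfolding Pm[OF V] using m_pos[OF V(1)] by (simp add: pos_le_divide_eq)
    qed
    show "P x y = 0" if "x \<in> V" "y \<in> V" "(x, y) \<notin> E" for x y using c0[OF that] Pm[OF that(1,2)] by simp
    show "0 < m x" if "x \<in> V" for x by (rule m_pos[OF that])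
    show "m x * P x y = m y * P y x" if "x \<in> V" "y \<in> V" for x y
      using Pm that m_pos[of x] m_pos[of y] c(1)[OF that] by simp
    show "0 < b ^ lv x" for x using b by simp
    show "(\<Sum>y\<in>E `` {x}. P x y * b ^ lv y) \<le> \<theta> * b ^ lv x" if x: "x \<in> V" for x
    proof -
      have "(\<Sum>y\<in>E `` {x}. P x y * b ^ lv y) = (\<Sum>z\<in>E `` {x}. c x z * b ^ lv z) / m x"
        unfolding sum_divide_distrib using Pm[OF x] edge_in by (intro sum.cong) auto
      then show ?thesis using contract[OF x] m_pos[OF x] by (simp add: pos_divide_le_eq mult_ac)
    qed
    show "0 < \<theta>" by (rule th)
    show "1 < t" "t * \<theta> < 1" using th by (auto simp: t_def field_simps)
  qed
  then show ?thesis by (rule that)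
qed

lemma hyperbolic_graphI:
  assumes "hyperbolic V E lv"
  obtains \<delta> where "hyperbolic_graph V E lv [] \<delta>"
proof -
  obtain d where d: "delta_hyperbolic V E lv d" using assms by (auto simp: hyperbolic_def)
  have "hyperbolic_graph V E lv [] (nat \<lceil>d\<rceil>)"
  proof
    fix x y z assume "x \<in> V" "y \<in> V" "z \<in> V"
    then have "min (gp x z) (gp z y) - d \<le> gp x y" using d by (auto simp: delta_hyperbolic_def)
    moreover have "d \<le> real (nat \<lceil>d\<rceil>)" by linarith
    ultimately show "min (gp x z) (gp z y) - real (nat \<lceil>d\<rceil>) \<le> gp x y" by linarith
  qed
  then show ?thesis by (rule that)
qed

lemma walk_hyperbolic:
  assumes "0 < lam" "lam < 1" "quasi_natural_walk N \<rho> Eh lam P" "bounded_degree V E" "hyperbolic V E lv"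
  obtains \<delta> m h \<epsilon> \<theta> t where "hyperbolic_walk V E lv [] \<delta> P m h \<epsilon> \<theta> t"
proof -
  obtain m h \<epsilon> \<theta> t where "transient_walk V E lv [] P m h \<epsilon> \<theta> t" using walk_transient[OF assms(1-4)] .
  moreover obtain \<delta> where "hyperbolic_graph V E lv [] \<delta>" using hyperbolic_graphI[OF assms(5)] .
  ultimately show ?thesis using that by (auto simp: hyperbolic_walk_def)
qed

lemma completed_graphI:
  assumes "hyperbolic_graph V E lv [] \<delta>" "admissible_exponent V E lv a" "hyperbolic_completion V E lv a Y D eH"
  obtains C where "completed_graph V E lv [] \<delta> Y D eH a C"
proof -
  obtain C where "C > 0" "\<forall>x\<in>V. \<forall>y\<in>V. visual_rho E lv a x y / C \<le> D (eH x) (eH y) \<and>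
      D (eH x) (eH y) \<le> C * visual_rho E lv a x y"
    using assms(3) by (auto simp: hyperbolic_completion_def)
  then have "completed_graph V E lv [] \<delta> Y D eH a C"
    using assms by (auto simp: completed_graph_def completed_graph_axioms_def hyperbolic_completion_def
        admissible_exponent_def)
  then show ?thesis by (rule that)
qed

theorem walk_boundary:
  assumes lam: "0 < lam" "lam < 1" and walk: "quasi_natural_walk N \<rho> Eh lam P"
    and bd: "bounded_degree V E" and hyp: "hyperbolic V E lv"
  shows "uniformly_irreducible V E P \<and> bounded_range V E P \<and> (\<exists>s<1. has_spectral_radius V P s)"
    and "martin_compactification V (martin_kernel V P []) TM eM \<Longrightarrow>
      boundary_set V TM eM = minimal_martin_boundary V P [] TM eM"
    and "martin_compactification V (martin_kernel V P []) TM eM \<Longrightarrow>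
      admissible_exponent V E lv a \<Longrightarrow> hyperbolic_completion V E lv a Y D eH \<Longrightarrow>
      \<exists>\<phi>. canonical_boundary_homeomorphism V (Metric_space.mtopology Y D) eH TM eM \<phi>"
proof -
  obtain \<delta> m h \<epsilon> \<theta> t where hw: "hyperbolic_walk V E lv [] \<delta> P m h \<epsilon> \<theta> t"
    using walk_hyperbolic[OF lam walk bd hyp] .
  then interpret W: hyperbolic_walk V E lv "[]" \<delta> P m h \<epsilon> \<theta> t .
  show "uniformly_irreducible V E P \<and> bounded_range V E P \<and> (\<exists>s<1. has_spectral_radius V P s)"
    using W.walk_uniformly_irreducible W.walk_bounded_range W.spectral_radius_lt_1 by blast
  show "boundary_set V TM eM = minimal_martin_boundary V P [] TM eM"
    if "martin_compactification V (martin_kernel V P []) TM eM"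
    by (rule W.martin_boundary_minimal[OF that])
  assume M: "martin_compactification V (martin_kernel V P []) TM eM"
    and Y: "admissible_exponent V E lv a" "hyperbolic_completion V E lv a Y D eH"
  obtain C where C: "completed_graph V E lv [] \<delta> Y D eH a C"
    using completed_graphI[OF W.hyperbolic_graph_axioms Y] .
  interpret completed_walk V E lv "[]" \<delta> P m h \<epsilon> \<theta> t Y D eH a C
    using hw C by (simp add: completed_walk_def)
  show "\<exists>\<phi>. canonical_boundary_homeomorphism V (Metric_space.mtopology Y D) eH TM eM \<phi>"
    by (rule martin_homeomorphic_hyperbolic[OF M])
qed

end

section \<open>Self-similar sets\<close>

text \<open>The ball is covered by finitely many balls of radius \<open>s/2\<close>, each with at most one point of \<open>Y\<close>.\<close>

lemma separated_subset_card:
  fixes R s :: real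
  assumes "0 < s"
  obtains B where "\<And>Y :: 'a::euclidean_space set. Y \<subseteq> cball 0 R \<Longrightarrow>
    (\<And>a b. a \<in> Y \<Longrightarrow> b \<in> Y \<Longrightarrow> a \<noteq> b \<Longrightarrow> s \<le> dist a b) \<Longrightarrow> finite Y \<and> card Y \<le> B"
proof -
  obtain k :: "'a set" where k: "finite k" "cball 0 R \<subseteq> (\<Union>x\<in>k. ball x (s / 2))"
    using compact_eq_totally_bounded[of "cball (0::'a) R"] compact_cball assms by (metis half_gt_zero)
  have "finite Y \<and> card Y \<le> card k"
    if Y: "Y \<subseteq> cball 0 R" "\<And>a b. a \<in> Y \<Longrightarrow> b \<in> Y \<Longrightarrow> a \<noteq> b \<Longrightarrow> s \<le> dist a b" for Y :: "'a set"
  proof -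
    have "\<forall>y\<in>Y. \<exists>x\<in>k. y \<in> ball x (s / 2)" using Y(1) k(2) by blast
    then obtain c where c: "\<And>y. y \<in> Y \<Longrightarrow> c y \<in> k \<and> y \<in> ball (c y) (s / 2)" by metis
    have inj: "inj_on c Y"
    proof (rule inj_onI, rule ccontr)
      fix y y' assume yy: "y \<in> Y" "y' \<in> Y" "c y = c y'" "y \<noteq> y'"
      then have "dist y y' < s" using c[of y] c[of y'] dist_triangle_half_r[of "c y" y s y'] by auto
      then show False using Y(2)[of y y'] yy by simp
    qed
    then show ?thesis
      using c k(1) inj_on_finite[OF inj] card_inj_on_le[OF inj] by (metis image_subsetI)
  qed
  then show ?thesis using that by blast
qed

text \<open>After rescaling, \<open>f\<close> is an isometry of a Euclidean space into itself and hence surjective.\<close>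

lemma similitude_ball:
  fixes f :: "'a::euclidean_space \<Rightarrow> 'a"
  assumes f: "\<And>u v. dist (f u) (f v) = c * dist u v" and c: "0 < c"
  shows "ball (f u) (c * e) \<subseteq> f ` ball u e"
proof
  fix y assume y: "y \<in> ball (f u) (c * e)"
  define g where "g = (\<lambda>v. (1 / c) *\<^sub>R (f (u + v) - f u))"
  have "dist (g v) (g w) = dist v w" for v w
  proof -
    have "dist (g v) (g w) = (1 / c) * dist (f (u + v)) (f (u + w))"
      using c by (simp add: g_def dist_norm scaleR_diff_right[symmetric])
    then show ?thesis using c f by simp
  qed
  then have "orthogonal_transformation g"
    unfolding orthogonal_transformation_isometry by (simp add: g_def)
  then have "surj g" by (rule orthogonal_transformation_surj)
  then obtain v where "g v = (1 / c) *\<^sub>R (y - f u)" by (metis surjD)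
  then have fv: "f (u + v) = y" using c by (simp add: g_def)
  have "c * dist u (u + v) < c * e" using y f[of u "u + v"] fv by simp
  then have "u + v \<in> ball u e" using c by simp
  then show "y \<in> f ` ball u e" using fv by blast
qed

lemma word_map_Nil [simp]: "word_map S [] = id"
  by (simp add: word_map_def)

lemma word_map_append: "word_map S (x @ y) = word_map S x \<circ> word_map S y"
  by (induction x) (auto simp: word_map_def)

lemma word_map_singleton [simp]: "word_map S [i] = S i"
  by (simp add: word_map_def)

locale self_similar = word_tree N \<rho> for N :: nat and \<rho> :: "nat \<Rightarrow> real" +
  fixes S :: "nat \<Rightarrow> 'a::euclidean_space \<Rightarrow> 'a" and K :: "'a set"
  assumes similitude: "i \<in> {1..N} \<Longrightarrow> dist (S i u) (S i v) = \<rho> i * dist u v"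
    and attractor: "is_attractor N S K"
begin

abbreviation "wm \<equiv> word_map S"

lemma K_props: "compact K" "K \<noteq> {}" "K = (\<Union>i\<in>{1..N}. S i ` K)"
  using attractor by (auto simp: is_attractor_def)

lemma dist_word_map:
  assumes "x \<in> lists {1..N}"
  shows "dist (wm x u) (wm x v) = rp x * dist u v"
  using assms
proof (induction x rule: lists.induct)
  case (Cons i x)
  then show ?case using word_map_append[of S "[i]" x] similitude[of i] by simp
qed simp

lemma inj_word_map:
  assumes "x \<in> lists {1..N}"
  shows "inj (wm x)"
proof (rule injI)
  fix u v assume "wm x u = wm x v"
  then show "u = v" using dist_word_map[OF assms, of u v] rp_pos[OF assms] by simp
qed

lemma word_map_image_subset:
  assumes "\<And>i. i \<in> {1..N} \<Longrightarrow> S i ` U \<subseteq> U" "x \<in> lists {1..N}"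
  shows "wm x ` U \<subseteq> U"
  using assms(2)
proof (induction x rule: lists.induct)
  case (Cons i x)
  then show ?case using word_map_append[of S "[i]" x] assms(1)[of i] by (auto simp: image_subset_iff)
qed simp

lemma cell_subset_K: "x \<in> lists {1..N} \<Longrightarrow> wm x ` K \<subseteq> K"
proof (rule word_map_image_subset)
  fix i assume "i \<in> {1..N}"
  then have "S i ` K \<subseteq> (\<Union>i\<in>{1..N}. S i ` K)" by blast
  then show "S i ` K \<subseteq> K" using K_props(3) by simp
qed

lemma cell_mono:
  assumes "prefix x y" "y \<in> lists {1..N}"
  shows "wm y ` K \<subseteq> wm x ` K"
proof -
  obtain v where v: "y = x @ v" using assms(1) by (auto simp: prefix_def)
  then have "wm v ` K \<subseteq> K" using assms(2) by (intro cell_subset_K) auto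
  then show ?thesis using v by (auto simp: word_map_append image_comp[symmetric])
qed

lemma compact_cell:
  assumes "x \<in> lists {1..N}"
  shows "compact (wm x ` K)"
proof (rule compact_continuous_image[OF _ K_props(1)])
  have "(rp x)-lipschitz_on K (wm x)"
    using dist_word_map[OF assms] rp_pos[OF assms] by (auto intro!: lipschitz_onI)
  then show "continuous_on K (wm x)" by (rule lipschitz_on_continuous_on)
qed

definition "diam = diameter K"

lemma diam_nonneg: "0 \<le> diam"
  unfolding diam_def using diameter_ge_0[OF compact_imp_bounded[OF K_props(1)]] .

lemma cell_diam:
  assumes "x \<in> J n" "u \<in> wm x ` K" "v \<in> wm x ` K"
  shows "dist u v \<le> diam * r ^ n"
proof -
  obtain u' v' where uv: "u' \<in> K" "v' \<in> K" "u = wm x u'" "v = wm x v'" using assms by blast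
  have "dist u' v' \<le> diam"
    unfolding diam_def using uv compact_imp_bounded[OF K_props(1)] by (intro diameter_bounded_bound) auto
  then have "rp x * dist u' v' \<le> r ^ n * diam"
    using level_bounds[OF assms(1)] rp_pos[of x] r_pos by (intro mult_mono) auto
  then show ?thesis using uv dist_word_map[OF level_bounds(1)[OF assms(1)]] by (simp add: mult.commute)
qed

lemma cell_refine:
  assumes u: "u \<in> lists {1..N}" "r ^ n < rp u" and n: "0 < n" and \<kappa>: "\<kappa> \<in> wm u ` K"
  shows "\<exists>y\<in>J n. prefix u y \<and> \<kappa> \<in> wm y ` K"
proof -
  obtain M where M: "\<And>x. x \<in> lists {1..N} \<Longrightarrow> r ^ n < rp x \<Longrightarrow> length x < M"
    using length_bound[of "r ^ n"] r_pos by auto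
  show ?thesis
    using u \<kappa>
  proof (induction "M - length u" arbitrary: u rule: less_induct)
    case less
    obtain k where k: "k \<in> K" "\<kappa> = wm u k" using less.prems by blast
    have "k \<in> (\<Union>i\<in>{1..N}. S i ` K)" using k(1) K_props(3) by simp
    then obtain i k' where i: "i \<in> {1..N}" "k' \<in> K" "k = S i k'" by blast
    have \<kappa>i: "\<kappa> \<in> wm (u @ [i]) ` K" using i k by (auto simp: word_map_append)
    have ui: "u @ [i] \<in> lists {1..N}" using less.prems(1) i by auto
    show ?case
    proof (cases "r ^ n < rp (u @ [i])")
      case True
      have "length u < M" by (rule M[OF less.prems(1,2)])
      then have "M - length (u @ [i]) < M - length u" by simp
      then obtain y where "y \<in> J n" "prefix (u @ [i]) y" "\<kappa> \<in> wm y ` K"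
        using less.hyps[OF _ ui True \<kappa>i] by blast
      then show ?thesis using append_prefixD by blast
    next
      case False
      then have "u @ [i] \<in> J n" using ui less.prems(2) n by (auto simp: word_level_set_def)
      then show ?thesis using \<kappa>i by (intro bexI[of _ "u @ [i]"]) auto
    qed
  qed
qed

lemma address_exists:
  assumes "\<kappa> \<in> K"
  obtains x where "\<And>n. x n \<in> J n" "\<And>n. prefix (x n) (x (Suc n))" "\<And>n. \<kappa> \<in> wm (x n) ` K"
proof -
  have "\<exists>x. \<forall>n. (x n \<in> J n \<and> \<kappa> \<in> wm (x n) ` K) \<and> prefix (x n) (x (Suc n))"
  proof (rule dependent_nat_choice)
    show "\<exists>x. x \<in> J 0 \<and> \<kappa> \<in> wm x ` K" using assms by auto
    fix x n assume x: "x \<in> J n \<and> \<kappa> \<in> wm x ` K"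
    then show "\<exists>y. (y \<in> J (Suc n) \<and> \<kappa> \<in> wm y ` K) \<and> prefix x y"
      using cell_refine[of x "Suc n" \<kappa>] level_bounds[of x n] by auto
  qed
  then show ?thesis using that by blast
qed

definition "base_pt = (SOME k. k \<in> K)"
definition pt :: "nat list \<Rightarrow> 'a" where "pt x = wm x base_pt"

lemma base_pt: "base_pt \<in> K"
  unfolding base_pt_def using K_props(2) by (auto intro: someI)

lemma pt_in_cell: "pt x \<in> wm x ` K"
  unfolding pt_def using base_pt by blast

end

section \<open>Augmented trees\<close>

locale augmented = self_similar N \<rho> S K
  for N :: nat and \<rho> :: "nat \<Rightarrow> real" and S :: "nat \<Rightarrow> 'a::euclidean_space \<Rightarrow> 'a" and K :: "'a set" +
  fixes \<gamma> :: real
  assumes gamma_pos: "0 < \<gamma>"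
begin

abbreviation "Eh \<equiv> augmented_edges N \<rho> S K \<gamma>"

lemma augmented_edge_iff:
  "(x, y) \<in> Eh \<longleftrightarrow> x \<in> V \<and> y \<in> V \<and> x \<noteq> y \<and> lv x = lv y \<and> setdist (wm x ` K) (wm y ` K) \<le> \<gamma> * r ^ lv x"
  by (simp add: augmented_edges_def)

sublocale pre_augmented_word_tree N \<rho> Eh
proof
  have "par x = par y \<or> (par x, par y) \<in> Eh" if e: "(x, y) \<in> Eh" for x y
  proof (rule disjCI)
    assume ne: "\<not> (par x, par y) \<in> Eh"
    have xy: "x \<in> V" "y \<in> V" "x \<noteq> y" "lv x = lv y" "setdist (wm x ` K) (wm y ` K) \<le> \<gamma> * r ^ lv x"
      using e by (auto simp: augmented_edge_iff)
    then have "lv x \<noteq> 0" using level_eq_0_iff by metis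
    then obtain n where n: "lv x = Suc n" using not0_implies_Suc by blast
    then have J: "x \<in> J (Suc n)" "y \<in> J (Suc n)" using xy vertex_iff by metis+
    note px = parent_props[OF J(1)] and py = parent_props[OF J(2)]
    have sub: "wm x ` K \<subseteq> wm (par x) ` K" "wm y ` K \<subseteq> wm (par y) ` K"
      using cell_mono px py level_bounds(1) J by blast+
    have "setdist (wm (par x) ` K) (wm (par y) ` K) \<le> setdist (wm x ` K) (wm (par y) ` K)"
      using sub K_props(2) by (intro setdist_subset_left) auto
    also have "\<dots> \<le> setdist (wm x ` K) (wm y ` K)"
      using sub K_props(2) by (intro setdist_subset_right) auto
    also have "\<dots> \<le> \<gamma> * r ^ Suc n" using xy n by simp
    also have "\<dots> \<le> \<gamma> * r ^ n"
      using gamma_pos r_pos r_lt_1 by (intro mult_left_mono power_decreasing) auto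
    finally show "par x = par y"
      using ne px py J_in_V level_eq by (auto simp: augmented_edge_iff)
  qed
  then have "\<forall>(x, y)\<in>Eh. lv x = lv y \<and> (par x = par y \<or> (par x, par y) \<in> Eh)"
    using augmented_edge_iff by blast
  moreover have "sym Eh"
  proof (rule symI)
    fix x y assume "(x, y) \<in> Eh"
    then show "(y, x) \<in> Eh" using setdist_sym[of "wm x ` K"] by (auto simp: augmented_edge_iff)
  qed
  moreover have "irrefl Eh" "Eh \<subseteq> V \<times> V" by (auto simp: augmented_edge_iff intro: irreflI)
  ultimately show "pre_augmented_tree N \<rho> Eh" unfolding pre_augmented_tree_def by blast
qed

text \<open>The open set condition makes the points \<open>S\<^sub>x u\<^sub>0\<close> of one level separated, where \<open>u\<^sub>0\<close> is a point
  of the open set; after rescaling, those of the horizontal neighbours of a vertex lie in a ball of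
  fixed size.\<close>

lemma augmented_bounded_degree:
  assumes "open_set_condition N S"
  shows "bounded_degree V E"
proof -
  obtain U where U0: "open U" "U \<noteq> {}" "\<forall>i\<in>{1..N}. S i ` U \<subseteq> U"
    "\<forall>i\<in>{1..N}. \<forall>j\<in>{1..N}. i \<noteq> j \<longrightarrow> S i ` U \<inter> S j ` U = {}"
    using assms unfolding open_set_condition_def by blast
  have U: "open U" "U \<noteq> {}" "\<And>i. i \<in> {1..N} \<Longrightarrow> S i ` U \<subseteq> U"
    "\<And>i j. i \<in> {1..N} \<Longrightarrow> j \<in> {1..N} \<Longrightarrow> i \<noteq> j \<Longrightarrow> S i ` U \<inter> S j ` U = {}"
    using U0 by blast+
  obtain u\<^sub>0 where u0: "u\<^sub>0 \<in> U" using U(2) by blast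
  then obtain e where e: "0 < e" "ball u\<^sub>0 e \<subseteq> U" using U(1) open_contains_ball by blast
  have disj: "wm x ` U \<inter> wm y ` U = {}" if xy: "x \<in> J n" "y \<in> J n" "x \<noteq> y" for x y n
  proof -
    have "parallel x y" using level_antichain xy by (auto intro!: parallelI)
    then obtain u b x' c y' where d: "b \<noteq> c" "x = u @ b # x'" "y = u @ c # y'"
      using parallel_decomp by blast
    have N: "u \<in> lists {1..N}" "b \<in> {1..N}" "c \<in> {1..N}" "x' \<in> lists {1..N}" "y' \<in> lists {1..N}"
      using level_bounds(1)[OF xy(1)] level_bounds(1)[OF xy(2)] d by auto
    have "wm x ` U \<subseteq> wm u ` S b ` U" "wm y ` U \<subseteq> wm u ` S c ` U"
      using word_map_image_subset[OF U(3) N(4)] word_map_image_subset[OF U(3) N(5)]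
        word_map_append[of S u "b # x'"] word_map_append[of S "[b]" x']
        word_map_append[of S u "c # y'"] word_map_append[of S "[c]" y'] d
      by (auto simp: image_subset_iff)
    moreover have "wm u ` S b ` U \<inter> wm u ` S c ` U = {}"
      using U(4)[OF N(2,3) d(1)] inj_word_map[OF N(1)] by (simp add: image_Int[symmetric])
    ultimately show ?thesis by blast
  qed
  have sep: "e * r * r ^ n \<le> dist (wm x u\<^sub>0) (wm y u\<^sub>0)" if xy: "x \<in> J n" "y \<in> J n" "x \<noteq> y" for x y n
  proof (rule ccontr)
    assume "\<not> ?thesis"
    then have "dist (wm x u\<^sub>0) (wm y u\<^sub>0) < e * r ^ Suc n" by (simp add: mult.assoc)
    also have "\<dots> \<le> rp x * e" using level_bounds(3)[OF xy(1)] e by (simp add: mult.commute)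
    finally have "wm y u\<^sub>0 \<in> ball (wm x u\<^sub>0) (rp x * e)" by simp
    also have "\<dots> \<subseteq> wm x ` ball u\<^sub>0 e"
      using level_bounds(1)[OF xy(1)] by (intro similitude_ball dist_word_map rp_pos) auto
    also have "\<dots> \<subseteq> wm x ` U" using e by blast
    finally show False using disj[OF xy] u0 by blast
  qed
  obtain B\<^sub>0 where B\<^sub>0: "\<And>k. k \<in> K \<Longrightarrow> dist u\<^sub>0 k \<le> B\<^sub>0"
    using compact_imp_bounded[OF K_props(1)] unfolding bounded_any_center[where a = u\<^sub>0] by blast
  have near: "dist (wm x u\<^sub>0) (wm y u\<^sub>0) \<le> (\<gamma> + 2 * B\<^sub>0) * r ^ lv x" if xy: "(x, y) \<in> Eh" for x y
  proof -
    have V: "x \<in> J (lv x)" "y \<in> J (lv x)" using xy vertex_iff by (auto simp: augmented_edge_iff)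
    have cpt: "compact (wm x ` K)" "compact (wm y ` K)" using compact_cell level_bounds(1) V by blast+
    obtain k k' where k: "k \<in> K" "k' \<in> K" "dist (wm x k) (wm y k') = setdist (wm x ` K) (wm y ` K)"
      using setdist_compact_closed[OF cpt(1) compact_imp_closed[OF cpt(2)]] K_props(2) by blast
    have bd: "dist (wm z u\<^sub>0) (wm z k) \<le> B\<^sub>0 * r ^ lv x" if "z \<in> J (lv x)" "k \<in> K" for z k
    proof -
      have "rp z * dist u\<^sub>0 k \<le> r ^ lv x * B\<^sub>0"
        using level_bounds[OF that(1)] B\<^sub>0[OF that(2)] rp_pos[of z] r_pos by (intro mult_mono) auto
      then show ?thesis using dist_word_map[OF level_bounds(1)[OF that(1)]] by (simp add: mult.commute)
    qed
    have sd: "dist (wm x k) (wm y k') \<le> \<gamma> * r ^ lv x"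
      using xy unfolding k(3) augmented_edge_iff by blast
    have "dist (wm x u\<^sub>0) (wm y u\<^sub>0)
        \<le> dist (wm x u\<^sub>0) (wm x k) + dist (wm x k) (wm y k') + dist (wm y k') (wm y u\<^sub>0)"
      using dist_triangle[of "wm x u\<^sub>0" "wm y u\<^sub>0" "wm x k"] dist_triangle[of "wm x k" "wm y u\<^sub>0" "wm y k'"] by linarith
    then show ?thesis
      using bd[OF V(1) k(1)] bd[OF V(2) k(2)] sd dist_commute[of "wm y k'" "wm y u\<^sub>0"]
      by (simp add: algebra_simps)
  qed
  have er: "0 < e * r" using e r_pos by simp
  obtain B where B: "\<And>Y :: 'a set. Y \<subseteq> cball 0 (\<gamma> + 2 * B\<^sub>0) \<Longrightarrow>
      (\<And>a b. a \<in> Y \<Longrightarrow> b \<in> Y \<Longrightarrow> a \<noteq> b \<Longrightarrow> e * r \<le> dist a b) \<Longrightarrow> finite Y \<and> card Y \<le> B"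
    using separated_subset_card[OF er] by blast
  have Eh_card: "card (Eh `` {x}) \<le> B" if x: "x \<in> V" for x
  proof -
    define n where "n = lv x"
    have rn: "0 < r ^ n" using r_pos by simp
    define \<phi> where "\<phi> = (\<lambda>y. (1 / r ^ n) *\<^sub>R (wm y u\<^sub>0 - wm x u\<^sub>0))"
    have dist\<phi>: "dist (\<phi> y) (\<phi> z) = dist (wm y u\<^sub>0) (wm z u\<^sub>0) / r ^ n" for y z
      using rn by (simp add: \<phi>_def dist_norm scaleR_diff_right[symmetric])
    have YJ: "y \<in> J n" if "y \<in> Eh `` {x}" for y
      using that vertex_iff by (auto simp: augmented_edge_iff n_def)
    have s: "e * r \<le> dist (\<phi> y) (\<phi> z)" if "y \<in> Eh `` {x}" "z \<in> Eh `` {x}" "y \<noteq> z" for y z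
      using sep[OF YJ[OF that(1)] YJ[OF that(2)] that(3)] rn unfolding dist\<phi> by (simp add: pos_le_divide_eq)
    have "\<phi> ` (Eh `` {x}) \<subseteq> cball 0 (\<gamma> + 2 * B\<^sub>0)"
    proof
      fix a assume "a \<in> \<phi> ` (Eh `` {x})"
      then obtain y where y: "(x, y) \<in> Eh" "a = \<phi> y" by auto
      have "\<phi> x = 0" by (simp add: \<phi>_def)
      then have "dist 0 a = dist (wm x u\<^sub>0) (wm y u\<^sub>0) / r ^ n" using dist\<phi>[of x y] y(2) by simp
      also have "\<dots> \<le> \<gamma> + 2 * B\<^sub>0" using near[OF y(1)] rn by (simp add: n_def pos_divide_le_eq)
      finally show "a \<in> cball 0 (\<gamma> + 2 * B\<^sub>0)" by simp
    qed
    then have "card (\<phi> ` (Eh `` {x})) \<le> B" using B s by blast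
    moreover have "inj_on \<phi> (Eh `` {x})"
    proof (rule inj_onI, rule ccontr)
      fix y z assume "y \<in> Eh `` {x}" "z \<in> Eh `` {x}" "\<phi> y = \<phi> z" "y \<noteq> z"
      then show False using s[of y z] er by simp
    qed
    ultimately show ?thesis by (simp add: card_image)
  qed
  obtain L where L: "\<And>x y n. x \<in> J n \<Longrightarrow> y \<in> children x \<Longrightarrow> \<exists>v. y = x @ v \<and> v \<in> lists {1..N} \<and> length v < L"
    using child_suffix_length by blast
  define F where "F = {v. set v \<subseteq> {1..N} \<and> length v \<le> L}"
  have F: "finite F" unfolding F_def by (intro finite_lists_length_le) simp
  have ch_card: "card (children x) \<le> card F" if x: "x \<in> V" for x
  proof -
    have "children x \<subseteq> (\<lambda>v. x @ v) ` F"
      using L[of x "lv x"] x vertex_iff by (fastforce simp: F_def in_lists_conv_set)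
    then have "card (children x) \<le> card ((\<lambda>v. x @ v) ` F)" using F by (intro card_mono) auto
    also have "\<dots> \<le> card F" using F by (rule card_image_le)
    finally show ?thesis .
  qed
  have "card (E `` {x}) \<le> 1 + card F + B" if x: "x \<in> V" for x
  proof -
    have "card (E `` {x}) \<le> card ((if x = [] then {} else {par x}) \<union> children x) + card (Eh `` {x})"
      unfolding neighbours[OF x] by (rule card_Un_le)
    also have "\<dots> \<le> card (if x = [] then {} else {par x}) + card (children x) + card (Eh `` {x})"
      using card_Un_le by (intro add_right_mono)
    also have "\<dots> \<le> 1 + card F + B" using ch_card[OF x] Eh_card[OF x] by (intro add_mono) auto
    finally show ?thesis .
  qed
  then show ?thesis unfolding bounded_degree_def using finite_nb by blast
qed

subsection \<open>The Gromov product and distances in the attractor\<close>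

text \<open>Gromov products are half-integers, hence powers of \<open>r\<close> are needed for real exponents \<open>s\<close>: this is
  \<open>scale s\<close>.\<close>

definition decay :: real where "decay = - ln r"

abbreviation scale :: "real \<Rightarrow> real" where "scale s \<equiv> exp (- decay * s)"

lemma decay_pos: "0 < decay"
  using r_pos r_lt_1 by (simp add: decay_def)

lemma scale_nat: "scale (real n) = r ^ n"
  using r_pos by (simp add: decay_def ln_realpow[symmetric] mult.commute)

lemma scale_diff: "scale (s - 1) = scale s / r"
proof -
  have "scale (s - 1) = scale s * exp decay" by (simp add: exp_add[symmetric] algebra_simps)
  then show ?thesis using r_pos by (simp add: decay_def exp_minus field_simps)
qed

lemma scale_antimono: "s \<le> s' \<Longrightarrow> scale s' \<le> scale s"
  using decay_pos by simp

lemma pt_edge: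
  assumes "(x, y) \<in> E"
  shows "dist (pt x) (pt y) \<le> (\<gamma> + 2 * diam) * scale (real (lv x) - 1)"
proof -
  have V: "x \<in> V" "y \<in> V" using assms edge_in by auto
  have up: "dist (pt u) (pt w) \<le> diam * scale (real (lv u))" if "u \<in> V" "w \<in> V" "w \<noteq> []" "par w = u" for u w
  proof -
    have w: "w \<in> J (Suc (lv u))" using level_parent[OF that(2,3)] that vertex_iff by metis
    then have "prefix u w" "u \<in> J (lv u)" using parent_props[of w "lv u"] that(4) by auto
    then have "pt w \<in> wm u ` K" using cell_mono[of u w] level_bounds(1)[OF w] pt_in_cell by blast
    then have "dist (pt u) (pt w) \<le> diam * r ^ lv u" using cell_diam[OF \<open>u \<in> J (lv u)\<close> pt_in_cell] by blast
    then show ?thesis by (simp only: scale_nat)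
  qed
  have c: "diam \<le> \<gamma> + 2 * diam" using gamma_pos diam_nonneg by simp
  consider "(x, y) \<in> Eh" | "y \<noteq> []" "x = par y" | "x \<noteq> []" "y = par x" using assms unfolding edge_iff by blast
  then show ?thesis
  proof cases
    case 1
    then have J: "x \<in> J (lv x)" "y \<in> J (lv x)" using V vertex_iff by (auto simp: augmented_edge_iff)
    have cpt: "compact (wm x ` K)" "compact (wm y ` K)" using compact_cell level_bounds(1) J by blast+
    obtain a b where ab: "a \<in> wm x ` K" "b \<in> wm y ` K" "dist a b = setdist (wm x ` K) (wm y ` K)"
      using setdist_compact_closed[OF cpt(1) compact_imp_closed[OF cpt(2)]] K_props(2) by blast
    have sd: "dist a b \<le> \<gamma> * r ^ lv x" using 1 unfolding ab(3) augmented_edge_iff by blast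
    have "dist (pt x) (pt y) \<le> dist (pt x) a + dist a b + dist b (pt y)"
      using dist_triangle[of "pt x" "pt y" a] dist_triangle[of a "pt y" b] by linarith
    also have "\<dots> \<le> (\<gamma> + 2 * diam) * r ^ lv x"
      using cell_diam[OF J(1) pt_in_cell ab(1)] cell_diam[OF J(2) ab(2) pt_in_cell] sd
      by (simp add: algebra_simps)
    also have "\<dots> \<le> (\<gamma> + 2 * diam) * scale (real (lv x) - 1)"
      using scale_antimono[of "real (lv x) - 1" "real (lv x)"] gamma_pos diam_nonneg
      unfolding scale_nat[symmetric] by (intro mult_left_mono) auto
    finally show ?thesis .
  next
    case 2
    have "dist (pt x) (pt y) \<le> diam * scale (real (lv x))" using up[OF V 2(1)] 2(2) by simp
    also have "\<dots> \<le> (\<gamma> + 2 * diam) * scale (real (lv x) - 1)"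
      using c scale_antimono[of "real (lv x) - 1" "real (lv x)"] diam_nonneg gamma_pos by (intro mult_mono) auto
    finally show ?thesis .
  next
    case 3
    have "dist (pt x) (pt y) \<le> diam * scale (real (lv y))" using up[OF V(2,1) 3(1)] 3(2) dist_commute by metis
    also have "real (lv y) = real (lv x) - 1" using level_parent[OF V(1) 3(1)] 3(2) by simp
    also have "diam * scale (real (lv x) - 1) \<le> (\<gamma> + 2 * diam) * scale (real (lv x) - 1)"
      using c by (intro mult_right_mono) auto
    finally show ?thesis .
  qed
qed

text \<open>After \<open>i\<close> steps from \<open>x\<close>, the level is at least \<open>|x| - i\<close>, so the displacement is bounded by a
  geometric sum; the subtracted term makes the induction close.\<close>

lemma pt_walk:
  assumes "(x, z) \<in> E ^^ n"
  shows "dist (pt x) (pt z) \<le> (\<gamma> + 2 * diam) / (1 - r) * (scale (real (lv x) - n) - scale (real (lv x)))"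
  using assms
proof (induction n arbitrary: x)
  case (Suc n)
  from relpow_Suc_E2[OF Suc.prems] obtain y where y: "(x, y) \<in> E" "(y, z) \<in> E ^^ n" .
  define C where "C = (\<gamma> + 2 * diam) / (1 - r)"
  have C: "0 \<le> C" "C * (1 - r) = \<gamma> + 2 * diam"
    using gamma_pos diam_nonneg r_lt_1 by (auto simp: C_def)
  define X where "X = scale (real (lv x) - 1)"
  have X: "scale (real (lv x)) = X * r" using scale_diff[of "real (lv x)"] r_pos by (simp add: X_def field_simps)
  define q where "q = exp (decay * n)"
  have q: "1 \<le> q" using decay_pos by (simp add: q_def)
  have sq: "scale (s - n) = scale s * q" for s :: real by (simp add: q_def exp_add[symmetric] algebra_simps)
  have "dist (pt y) (pt z) \<le> C * (scale (real (lv y) - n) - scale (real (lv y)))"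
    using Suc.IH[OF y(2)] by (simp add: C_def)
  also have "\<dots> = C * (scale (real (lv y)) * (q - 1))"
    unfolding sq by (simp only: right_diff_distrib mult_1_right)
  also have "\<dots> \<le> C * (X * (q - 1))"
    using C q lev_edge[OF y(1)] unfolding X_def by (intro mult_left_mono mult_right_mono scale_antimono) auto
  finally have "dist (pt x) (pt z) \<le> C * (1 - r) * X + C * (X * (q - 1))"
    using pt_edge[OF y(1)] dist_triangle[of "pt x" "pt z" "pt y"] C(2) by (simp add: X_def)
  also have "\<dots> = C * (X * q - X * r)" by (simp add: algebra_simps)
  also have "X * q = scale (real (lv x) - Suc n)"
    using sq[of "real (lv x) - 1"] by (simp add: X_def algebra_simps)
  finally show ?case unfolding X C_def .
qed simp

definition "pt_const = 2 * (\<gamma> + 2 * diam) / (1 - r) / r"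

lemma pt_const_nonneg: "0 \<le> pt_const"
  using gamma_pos diam_nonneg r_pos r_lt_1 by (simp add: pt_const_def)

lemma pt_dist_le:
  assumes V: "x \<in> V" "y \<in> V"
  shows "dist (pt x) (pt y) \<le> pt_const * scale (gp x y)"
proof -
  \<comment> \<open>split a geodesic where it is closest to the root\<close>
  define k where "k = nat \<lceil>real (lv x) - gp x y\<rceil>"
  have g: "2 * gp x y = real (lv x) + real (lv y) - real (gd x y)" by (simp add: gromov_product_def)
  have k: "real (lv x) - gp x y \<le> real k" "real k < real (lv x) - gp x y + 1"
  proof -
    have "real k = of_int \<lceil>real (lv x) - gp x y\<rceil>" using gp_le_lev(1)[OF V] by (simp add: k_def)
    then show "real (lv x) - gp x y \<le> real k" "real k < real (lv x) - gp x y + 1"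
      using ceiling_correct[of "real (lv x) - gp x y"] by linarith+
  qed
  have "real (lv x) \<le> real (lv y) + real (gd x y)" using lev_gd[OF V] by linarith
  then have "real (lv x) - gp x y \<le> real (gd x y)" using g by linarith
  then have kd: "k \<le> gd x y" unfolding k_def by (simp add: ceiling_le nat_le_iff)
  have "(x, y) \<in> E ^^ (k + (gd x y - k))" using graph_dist_walk[OF V] kd by simp
  then obtain w where w: "(x, w) \<in> E ^^ k" "(w, y) \<in> E ^^ (gd x y - k)" by (auto simp: relpow_add)
  define C where "C = (\<gamma> + 2 * diam) / (1 - r)"
  have C0: "0 \<le> C" using gamma_pos diam_nonneg r_lt_1 by (simp add: C_def)
  have le: "C * (scale s - scale s') \<le> C * scale (gp x y - 1)" if "gp x y - 1 \<le> s" for s s'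
  proof (rule mult_left_mono[OF _ C0])
    show "scale s - scale s' \<le> scale (gp x y - 1)"
      using scale_antimono[OF that] exp_ge_zero[of "- decay * s'"] by linarith
  qed
  have "dist (pt x) (pt w) \<le> C * scale (gp x y - 1)"
    using pt_walk[OF w(1)] le[of "real (lv x) - k" "real (lv x)"] k by (simp add: C_def)
  moreover have "dist (pt y) (pt w) \<le> C * scale (gp x y - 1)"
    using pt_walk[OF walk_sym[OF w(2)]] le[of "real (lv y) - real (gd x y - k)" "real (lv y)"] k g kd
    by (simp add: C_def of_nat_diff)
  ultimately have "dist (pt x) (pt y) \<le> 2 * C * scale (gp x y - 1)"
    using dist_triangle2[of "pt x" "pt y" "pt w"] by simp
  then show ?thesis unfolding scale_diff by (simp add: pt_const_def C_def)
qed

lemma prefix_ancestor: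
  assumes "x \<in> V" "l \<le> lv x"
  shows "\<exists>w\<in>J l. prefix w x \<and> gd x w \<le> lv x - l"
  using assms
proof (induction "lv x - l" arbitrary: x)
  case 0
  then show ?case using vertex_iff[of x] by auto
next
  case (Suc n)
  then have "x \<noteq> []" using level_eq_0_iff[of x] by auto
  have par: "par x \<in> V" "Suc (lv (par x)) = lv x"
    using parent_in_V level_parent Suc.prems(1) \<open>x \<noteq> []\<close> by auto
  then have xJ: "x \<in> J (Suc (lv (par x)))" using Suc.prems(1) vertex_iff by metis
  obtain w where w: "w \<in> J l" "prefix w (par x)" "gd (par x) w \<le> lv (par x) - l"
  proof -
    have "n = lv (par x) - l" "l \<le> lv (par x)" using Suc.hyps(2) par(2) by linarith+
    then show ?thesis using Suc.hyps(1)[of "par x"] par(1) that by blast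
  qed
  have "(x, par x) \<in> E" using Suc.prems(1) par \<open>x \<noteq> []\<close> by (simp add: edge_iff)
  then have "gd x w \<le> 1 + gd (par x) w"
    using gd_triangle[OF Suc.prems(1) par(1) J_in_V[OF w(1)]] gd_edge by (meson add_right_mono order_trans)
  then have "gd x w \<le> lv x - l" using w(3) par(2) Suc.hyps(2) by linarith
  then show ?case using w parent_props(2)[OF xJ] prefix_order.trans by blast
qed

text \<open>If the cells of \<open>x\<close> and \<open>y\<close> are close on the scale of level \<open>l\<close>, then the ancestors of level
  \<open>l\<close> are equal or horizontal neighbours, which gives a path from \<open>x\<close> to \<open>y\<close>.\<close>

lemma gp_ge_level:
  assumes V: "x \<in> V" "y \<in> V" and l: "l \<le> lv x" "l \<le> lv y" and d: "dist (pt x) (pt y) \<le> \<gamma> * r ^ l"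
  shows "real l - 1 \<le> gp x y"
proof -
  obtain w where w: "w \<in> J l" "prefix w x" "gd x w \<le> lv x - l" using prefix_ancestor[OF V(1) l(1)] by blast
  obtain w' where w': "w' \<in> J l" "prefix w' y" "gd y w' \<le> lv y - l" using prefix_ancestor[OF V(2) l(2)] by blast
  have lists: "x \<in> lists {1..N}" "y \<in> lists {1..N}"
    using level_bounds(1)[of x "lv x"] level_bounds(1)[of y "lv y"] V vertex_iff by auto
  have wV: "w \<in> V" "w' \<in> V" using w w' J_in_V by auto
  have "pt x \<in> wm w ` K" "pt y \<in> wm w' ` K"
    using subsetD[OF cell_mono[OF w(2) lists(1)] pt_in_cell] subsetD[OF cell_mono[OF w'(2) lists(2)] pt_in_cell] .
  then have sd: "setdist (wm w ` K) (wm w' ` K) \<le> \<gamma> * r ^ l"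
    by (rule order_trans[OF setdist_le_dist d])
  have "(w, w') \<in> E" if "w \<noteq> w'"
    using sd wV level_eq[OF w(1)] level_eq[OF w'(1)] that unfolding edge_iff augmented_edge_iff by simp
  then have "w = w' \<or> (w, w') \<in> E" by blast
  then have "gd w w' \<le> 1" using gd_edge by auto
  then have "gd x y \<le> (lv x - l) + 1 + (lv y - l)"
    using gd_triangle[OF V(1) wV(1) V(2)] gd_triangle[OF wV V(2)] w(3) w'(3) gd_sym[OF V(2) wV(2)] by linarith
  then have "real (gd x y) \<le> (real (lv x) - real l) + 1 + (real (lv y) - real l)" using l by linarith
  then show ?thesis unfolding gromov_product_def by simp
qed

definition cell_dist :: "nat list \<Rightarrow> nat list \<Rightarrow> real" where
  "cell_dist x y = r ^ lv x + r ^ lv y + dist (pt x) (pt y)"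

definition "gp_const = 1 / \<gamma> + (1 + 1 / (\<gamma> * r)) / r"

lemma gp_const_pos: "0 < gp_const"
  using gamma_pos r_pos by (simp add: gp_const_def add_pos_pos)

lemma scale_gp_le:
  assumes V: "x \<in> V" "y \<in> V"
  shows "scale (gp x y) \<le> gp_const * cell_dist x y"
proof -
  define d where "d = dist (pt x) (pt y)"
  define l\<^sub>0 where "l\<^sub>0 = min (lv x) (lv y)"
  have pos: "0 \<le> d" "0 < r ^ lv x" "0 < r ^ lv y" using r_pos by (auto simp: d_def)
  have cd: "d \<le> cell_dist x y" "r ^ lv x \<le> cell_dist x y" "r ^ lv y \<le> cell_dist x y" "0 \<le> cell_dist x y"
    using pos by (auto simp: cell_dist_def d_def)
  have gd0: "1 / \<gamma> * cell_dist x y \<le> gp_const * cell_dist x y"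
    "(1 + 1 / (\<gamma> * r)) / r * cell_dist x y \<le> gp_const * cell_dist x y"
    by (rule mult_right_mono[OF _ cd(4)], use gamma_pos r_pos in \<open>simp add: gp_const_def\<close>)+
  show ?thesis
  proof (cases "d \<le> \<gamma>")
    case False
    have "scale (gp x y) \<le> 1" using gp_nonneg[OF V] decay_pos by simp
    also have "1 \<le> 1 / \<gamma> * d" using False gamma_pos by (simp add: field_simps)
    also have "\<dots> \<le> 1 / \<gamma> * cell_dist x y" using cd(1) gamma_pos by (intro mult_left_mono) auto
    finally show ?thesis using gd0(1) by linarith
  next
    case True
    define P where "P = {l. l \<le> l\<^sub>0 \<and> d \<le> \<gamma> * r ^ l}"
    have P: "finite P" "0 \<in> P" using True by (auto simp: P_def)
    define l where "l = Max P"
    have lP: "l \<in> P" unfolding l_def using P by (intro Max_in) auto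
    have l_max: "k \<le> l" if "k \<in> P" for k unfolding l_def using P that by (intro Max_ge)
    have "real l - 1 \<le> gp x y"
      using lP by (intro gp_ge_level V) (auto simp: P_def l\<^sub>0_def d_def)
    then have "scale (gp x y) \<le> scale (real l - 1)" by (rule scale_antimono)
    also have "\<dots> = r ^ l / r" by (simp only: scale_diff scale_nat)
    also have "\<dots> \<le> ((1 + 1 / (\<gamma> * r)) * cell_dist x y) / r"
    proof (intro divide_right_mono)
      show "r ^ l \<le> (1 + 1 / (\<gamma> * r)) * cell_dist x y"
      proof (cases "l = l\<^sub>0")
        case True
        then have "r ^ l \<le> 1 * cell_dist x y" using cd by (auto simp: l\<^sub>0_def min_def)
        also have "\<dots> \<le> (1 + 1 / (\<gamma> * r)) * cell_dist x y"
          using cd(4) gamma_pos r_pos by (intro mult_right_mono) auto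
        finally show ?thesis .
      next
        case False
        then have "Suc l \<notin> P" "Suc l \<le> l\<^sub>0" using l_max[of "Suc l"] lP by (auto simp: P_def)
        then have "\<gamma> * r ^ Suc l < d" by (simp add: P_def)
        then have "r ^ l \<le> 1 / (\<gamma> * r) * d" using gamma_pos r_pos by (simp add: field_simps)
        also have "\<dots> \<le> (1 + 1 / (\<gamma> * r)) * cell_dist x y"
          using cd gamma_pos r_pos pos by (intro mult_mono) auto
        finally show ?thesis .
      qed
    qed (use r_pos in auto)
    finally show ?thesis using gd0(2) by simp
  qed
qed

lemma cell_dist_le:
  assumes V: "x \<in> V" "y \<in> V"
  shows "cell_dist x y \<le> (2 + pt_const) * scale (gp x y)"
proof -
  have "r ^ lv x \<le> scale (gp x y)" "r ^ lv y \<le> scale (gp x y)"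
    using gp_le_lev[OF V] scale_antimono unfolding scale_nat[symmetric] by blast+
  then show ?thesis using pt_dist_le[OF V] by (simp add: cell_dist_def distrib_right)
qed

text \<open>Up to a bounded error, the Gromov product is thus the logarithm of \<open>cell_dist\<close> to base \<open>r\<close>, and
  the triangle inequality for \<open>cell_dist\<close> turns into hyperbolicity.\<close>

theorem augmented_hyperbolic: "hyperbolic V E lv"
proof -
  define C where "C = 2 * gp_const * (2 + pt_const)"
  have C0: "0 < C" using gp_const_pos pt_const_nonneg by (simp add: C_def)
  define \<delta> where "\<delta> = max 0 (ln C / decay)"
  have Cd: "C \<le> exp (decay * \<delta>)"
  proof -
    have "ln C \<le> decay * \<delta>" using decay_pos by (simp add: \<delta>_def max_def field_simps split: if_splits)
    then show ?thesis using C0 by (simp add: ln_le_cancel_iff[symmetric] ln_ge_iff[symmetric])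
  qed
  have "delta_hyperbolic V E lv \<delta>"
    unfolding delta_hyperbolic_def
  proof (intro conjI ballI)
    show "0 \<le> \<delta>" by (simp add: \<delta>_def)
    fix x y z assume V: "x \<in> V" "y \<in> V" "z \<in> V"
    define g where "g = min (gp x z) (gp z y)"
    have "scale (gp x y) \<le> gp_const * cell_dist x y" by (rule scale_gp_le[OF V(1,2)])
    also have "\<dots> \<le> gp_const * (cell_dist x z + cell_dist z y)"
      using gp_const_pos dist_triangle[of "pt x" "pt y" "pt z"] r_pos
      by (intro mult_left_mono) (auto simp: cell_dist_def intro: add_increasing)
    also have "\<dots> \<le> gp_const * ((2 + pt_const) * scale g + (2 + pt_const) * scale g)"
    proof -
      have "(2 + pt_const) * scale (gp x z) \<le> (2 + pt_const) * scale g"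
        "(2 + pt_const) * scale (gp z y) \<le> (2 + pt_const) * scale g"
        using pt_const_nonneg by (intro mult_left_mono scale_antimono; simp add: g_def)+
      then show ?thesis
        using cell_dist_le[OF V(1,3)] cell_dist_le[OF V(3,2)] gp_const_pos by (intro mult_left_mono add_mono) auto
    qed
    also have "\<dots> = C * scale g" by (simp add: C_def)
    also have "\<dots> \<le> exp (decay * \<delta>) * scale g" using Cd by (intro mult_right_mono) auto
    also have "\<dots> = scale (g - \<delta>)" by (simp add: exp_add[symmetric] algebra_simps)
    finally have "decay * (g - \<delta>) \<le> decay * gp x y" by simp
    then show "min (gp x z) (gp z y) - \<delta> \<le> gp x y" using decay_pos by (simp add: g_def)
  qed
  then show ?thesis by (auto simp: hyperbolic_def)
qed

subsection \<open>The hyperbolic boundary and the attractor\<close>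

lemma geodesic_ray_iff:
  "geodesic_ray V E [] x \<longleftrightarrow> (\<forall>n. x n \<in> J n \<and> prefix (x n) (x (Suc n)))"
proof
  assume g: "geodesic_ray V E [] x"
  then have x: "x 0 = []" "\<And>n. x n \<in> V" "\<And>m n. m \<le> n \<Longrightarrow> gd (x m) (x n) = n - m"
    by (auto simp: geodesic_ray_def)
  have lvx: "lv (x n) = n" for n using gd_base[OF x(2)] x(3)[of 0 n] x(1) by simp
  have xJ: "x n \<in> J n" for n using x(2)[of n] vertex_iff lvx by metis
  have "prefix (x n) (x (Suc n))" for n
  proof -
    have "gd (x n) (x (Suc n)) = 1" using x(3)[of n "Suc n"] by simp
    then have "(x n, x (Suc n)) \<in> E" using gd_eq_1 x(2) by blast
    then have "x n = par (x (Suc n))"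
      using lvx[of n] lvx[of "Suc n"] level_parent[OF x(2), of n] by (auto simp: edge_iff augmented_edge_iff)
    then show ?thesis using parent_props(2)[OF xJ] by metis
  qed
  then show "\<forall>n. x n \<in> J n \<and> prefix (x n) (x (Suc n))" using xJ by blast
next
  assume "\<forall>n. x n \<in> J n \<and> prefix (x n) (x (Suc n))"
  then have x: "\<And>n. x n \<in> J n" "\<And>n. prefix (x n) (x (Suc n))" by auto
  have V: "x n \<in> V" for n using x(1) J_in_V by blast
  have edge: "(x n, x (Suc n)) \<in> E" for n
    using V parent_eq[OF x(1) x(1) x(2)] level_eq[OF x(1)] level_eq_0_iff[OF V, of "Suc n"] by (auto simp: edge_iff)
  have "(x m, x (m + k)) \<in> E ^^ k" for m k
    using edge by (induction k) auto
  then have "gd (x m) (x n) \<le> n - m" if "m \<le> n" for m n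
    using graph_dist_le[of "x m" "x n" "n - m"] that by (metis le_add_diff_inverse)
  moreover have "n \<le> m + gd (x m) (x n)" for m n
    using lev_gd[OF V V, of n m] gd_sym[OF V V, of m n] level_eq[OF x(1)] by simp
  ultimately have "gd (x m) (x n) = n - m" if "m \<le> n" for m n using that by (metis le_antisym le_diff_conv add.commute)
  then show "geodesic_ray V E [] x" using x(1)[of 0] V by (simp add: geodesic_ray_def)
qed

end

lemma compact_space_boundary:
  assumes "compact_space T" "\<And>x. x \<in> V \<Longrightarrow> openin T {e x}"
  shows "compact_space (boundary_space V T e)"
proof -
  have "openin T (\<Union>x\<in>V. {e x})" using assms(2) by (intro openin_Union) auto
  moreover have "boundary_set V T e = topspace T - (\<Union>x\<in>V. {e x})" by (auto simp: boundary_set_def)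
  ultimately have "closedin T (boundary_set V T e)" by (simp add: closedin_diff)
  then have "compactin T (boundary_set V T e)" by (rule closedin_compact_space[OF assms(1)])
  then show ?thesis unfolding boundary_space_def by (rule compact_space_subtopology)
qed

context augmented
begin

text \<open>By the comparison of \<open>cell_dist\<close> with the Gromov product, \<open>x \<mapsto> S\<^sub>x \<kappa>\<close> extends to the completion,
  and the extension is injective on the boundary. It is onto \<open>K\<close> because points of \<open>K\<close> have
  addresses, and an address is a geodesic ray.\<close>

theorem boundary_homeomorphic_attractor:
  assumes "completed_graph V E lv [] \<delta> Y D eH a C"
  shows "\<exists>\<iota>. canonical_attractor_map V E S K (Metric_space.mtopology Y D) eH \<iota> \<and>
    homeomorphic_map (boundary_space V (Metric_space.mtopology Y D) eH) (top_of_set K) \<iota>"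
proof -
  interpret H: completed_graph V E lv "[]" \<delta> Y D eH a C by (rule assms)
  let ?T = "H.mtopology"
  have scale_lim: "(\<lambda>k. c * scale (real k)) \<longlonglongrightarrow> 0" for c
  proof -
    have "(\<lambda>k. c * r ^ k) \<longlonglongrightarrow> c * 0" using r_pos r_lt_1 by (intro tendsto_mult_left LIMSEQ_realpow_zero) auto
    then show ?thesis by (simp only: scale_nat mult_zero_right)
  qed
  have "Cauchy (\<lambda>n. pt (z n))" if z: "H.gromov_seq z" for z
  proof (rule metric_CauchyI)
    fix e :: real assume "0 < e"
    with scale_lim[of pt_const] have "\<forall>\<^sub>F k in sequentially. pt_const * scale (real k) < e" by (rule order_tendstoD)
    then obtain k where k: "pt_const * scale (real k) < e" by (auto simp: eventually_sequentially)
    obtain n\<^sub>0 where n\<^sub>0: "\<And>i j. i \<ge> n\<^sub>0 \<Longrightarrow> j \<ge> n\<^sub>0 \<Longrightarrow> real k \<le> gp (z i) (z j)"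
      using H.gromov_seqE[OF z, of k] by blast
    have "dist (pt (z i)) (pt (z j)) < e" if "i \<ge> n\<^sub>0" "j \<ge> n\<^sub>0" for i j
    proof -
      have "dist (pt (z i)) (pt (z j)) \<le> pt_const * scale (gp (z i) (z j))"
        using H.gromov_seq_in[OF z] by (intro pt_dist_le)
      also have "\<dots> \<le> pt_const * scale (real k)"
        using pt_const_nonneg n\<^sub>0[OF that] by (intro mult_left_mono scale_antimono) auto
      finally show ?thesis using k by linarith
    qed
    then show "\<exists>M. \<forall>m\<ge>M. \<forall>n\<ge>M. dist (pt (z m)) (pt (z n)) < e" by blast
  qed
  then obtain \<iota> where \<iota>: "continuous_map ?T euclidean \<iota>" "\<And>x. x \<in> V \<Longrightarrow> \<iota> (eH x) = pt x"
    using H.extend_to_completion[of pt] by metis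
  have pt_lim: "(\<lambda>n. pt (z n)) \<longlonglongrightarrow> \<iota> \<xi>"
    if "\<And>n. z n \<in> V" "limitin ?T (\<lambda>n. eH (z n)) \<xi> sequentially" for z \<xi>
    using continuous_map_limit[OF \<iota>(1) that(2)] \<iota>(2)[OF that(1)] by (simp add: o_def)
  have inj: "\<xi> = \<eta>" if \<xi>: "\<xi> \<in> boundary_set V ?T eH" and \<eta>: "\<eta> \<in> boundary_set V ?T eH" and eq: "\<iota> \<xi> = \<iota> \<eta>" for \<xi> \<eta>
  proof -
    obtain z where z: "H.gromov_seq z" "limitin ?T (\<lambda>n. eH (z n)) \<xi> sequentially" using H.boundary_approx[OF \<xi>] .
    obtain z' where z': "H.gromov_seq z'" "limitin ?T (\<lambda>n. eH (z' n)) \<eta> sequentially" using H.boundary_approx[OF \<eta>] .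
    note zV = H.gromov_seq_in[OF z(1)] and zV' = H.gromov_seq_in[OF z'(1)]
    show ?thesis
    proof (rule H.boundary_eqI[OF z z'])
      fix k n\<^sub>0 :: nat
      define e where "e = scale (real k) / gp_const / 4"
      have e: "0 < e" using gp_const_pos by (simp add: e_def)
      have "(\<lambda>n. dist (pt (z n)) (pt (z' n))) \<longlonglongrightarrow> dist (\<iota> \<xi>) (\<iota> \<eta>)"
        using pt_lim[OF zV z(2)] pt_lim[OF zV' z'(2)] by (rule tendsto_dist)
      then have close: "\<forall>\<^sub>F n in sequentially. dist (pt (z n)) (pt (z' n)) < e"
        using e eq by (auto intro: order_tendstoD)
      have "\<forall>\<^sub>F l in sequentially. 1 * scale (real l) < e" using scale_lim[of 1] e by (rule order_tendstoD)
      then obtain l where l: "r ^ l < e" unfolding mult_1 scale_nat by (auto simp: eventually_sequentially)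
      have "\<forall>\<^sub>F n in sequentially. dist (pt (z n)) (pt (z' n)) < e \<and> l \<le> lv (z n) \<and> l \<le> lv (z' n) \<and> n\<^sub>0 \<le> n"
        by (intro eventually_conj close H.gromov_seq_lev z(1) z'(1) eventually_ge_at_top)
      then obtain n where n: "dist (pt (z n)) (pt (z' n)) < e" "l \<le> lv (z n)" "l \<le> lv (z' n)" "n\<^sub>0 \<le> n"
        by (auto simp: eventually_sequentially)
      have "r ^ lv (z n) \<le> r ^ l" "r ^ lv (z' n) \<le> r ^ l" using n r_pos r_lt_1 by (auto intro!: power_decreasing)
      then have "cell_dist (z n) (z' n) < 4 * e" using n(1) l e by (simp add: cell_dist_def)
      then have "gp_const * cell_dist (z n) (z' n) < gp_const * (4 * e)" using gp_const_pos by (intro mult_strict_left_mono)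
      also have "\<dots> = scale (real k)" using gp_const_pos by (simp add: e_def)
      finally have "scale (gp (z n) (z' n)) < scale (real k)" using scale_gp_le[OF zV zV', of n n] by linarith
      then have "real k \<le> gp (z n) (z' n)" using decay_pos by simp
      then show "\<exists>n\<ge>n\<^sub>0. real k \<le> gp (z n) (z' n)" using n(4) by blast
    qed
  qed
  have ray: "\<exists>\<xi>\<in>boundary_set V ?T eH. limitin ?T (\<lambda>n. eH (x n)) \<xi> sequentially" if x: "geodesic_ray V E [] x" for x
  proof -
    have xV: "x n \<in> V" for n using x by (simp add: geodesic_ray_def)
    have lvx: "lv (x n) = n" for n using x level_eq by (auto simp: geodesic_ray_iff)
    have gpm: "real (min i j) \<le> gp (x i) (x j)" for i j
    proof -
      have "real i \<le> gp (x i) (x j)" if "i \<le> j" for i j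
        using x that by (simp add: geodesic_ray_def gromov_product_def lvx of_nat_diff)
      from this[of i j] this[of j i] show ?thesis
        using gp_sym[OF xV xV, of j i] by (cases "i \<le> j") (auto simp: min_def)
    qed
    have "H.gromov_seq x"
      unfolding H.gromov_seq_def
    proof (intro conjI allI xV)
      fix k
      have "real k \<le> gp (x i) (x j)" if "i \<ge> k" "j \<ge> k" for i j
        using gpm[of i j] that by (simp add: min_def split: if_splits)
      then show "\<exists>n\<^sub>0. \<forall>i\<ge>n\<^sub>0. \<forall>j\<ge>n\<^sub>0. real k \<le> gp (x i) (x j)" by blast
    qed
    then show ?thesis using H.gromov_limit by metis
  qed
  have cell_lim: "(\<lambda>n. pt (x n)) \<longlonglongrightarrow> \<kappa>" if "\<And>n. x n \<in> J n" "\<And>n. \<kappa> \<in> wm (x n) ` K" for x \<kappa>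
  proof -
    have "dist (pt (x n)) \<kappa> \<le> diam * scale (real n)" for n
      using cell_diam[OF that(1) pt_in_cell that(2)] unfolding scale_nat .
    then have "(\<lambda>n. dist (pt (x n)) \<kappa>) \<longlonglongrightarrow> 0"
      by (intro tendsto_sandwich[OF _ _ tendsto_const scale_lim[of diam]]) auto
    then show ?thesis by (simp add: tendsto_dist_iff[symmetric])
  qed
  have ray_point: "\<exists>x. geodesic_ray V E [] x \<and> (\<exists>\<xi>\<in>boundary_set V ?T eH. limitin ?T (\<lambda>n. eH (x n)) \<xi> sequentially \<and> \<iota> \<xi> = \<kappa>)"
    if \<kappa>: "\<kappa> \<in> K" for \<kappa>
  proof -
    obtain x where x: "\<And>n. x n \<in> J n" "\<And>n. prefix (x n) (x (Suc n))" "\<And>n. \<kappa> \<in> wm (x n) ` K"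
      using address_exists[OF \<kappa>] by blast
    then have g: "geodesic_ray V E [] x" by (simp add: geodesic_ray_iff)
    obtain \<xi> where \<xi>: "\<xi> \<in> boundary_set V ?T eH" "limitin ?T (\<lambda>n. eH (x n)) \<xi> sequentially" using ray[OF g] by blast
    have "\<iota> \<xi> = \<kappa>" using LIMSEQ_unique[OF pt_lim[OF J_in_V[OF x(1)] \<xi>(2)] cell_lim[OF x(1,3)]] .
    then show ?thesis using g \<xi> by blast
  qed
  have in_K: "\<iota> \<xi> \<in> K" if \<xi>: "\<xi> \<in> boundary_set V ?T eH" for \<xi>
  proof -
    obtain z where z: "H.gromov_seq z" "limitin ?T (\<lambda>n. eH (z n)) \<xi> sequentially" using H.boundary_approx[OF \<xi>] .
    have ptK: "pt (z n) \<in> K" for n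
    proof -
      have "z n \<in> J (lv (z n))" using H.gromov_seq_in[OF z(1)] vertex_iff by blast
      then show ?thesis using subsetD[OF cell_subset_K[OF level_bounds(1)] pt_in_cell] by blast
    qed
    show ?thesis
      by (rule closed_sequentially[OF compact_imp_closed[OF K_props(1)] ptK pt_lim[OF H.gromov_seq_in[OF z(1)] z(2)]])
  qed
  have cell_inter: "(\<Inter>n. wm (x n) ` K) = {\<iota> \<xi>}"
    if x: "geodesic_ray V E [] x" and lim: "limitin ?T (\<lambda>n. eH (x n)) \<xi> sequentially" for x \<xi>
  proof (intro equalityI subsetI)
    have xJ: "x n \<in> J n" and xp: "prefix (x n) (x (Suc n))" for n using x by (auto simp: geodesic_ray_iff)
    note xl = pt_lim[OF J_in_V[OF xJ] lim]
    show "\<kappa> \<in> {\<iota> \<xi>}" if "\<kappa> \<in> (\<Inter>n. wm (x n) ` K)" for \<kappa>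
      using LIMSEQ_unique[OF xl cell_lim[OF xJ]] that by blast
    show "\<kappa> \<in> (\<Inter>n. wm (x n) ` K)" if "\<kappa> \<in> {\<iota> \<xi>}" for \<kappa>
    proof
      fix n
      have mono: "wm (x (n + k)) ` K \<subseteq> wm (x n) ` K" for k
      proof (induction k)
        case (Suc k)
        then show ?case using cell_mono[OF xp level_bounds(1)[OF xJ], of "n + k"] by auto
      qed simp
      have ptx: "pt (x (k + n)) \<in> wm (x n) ` K" for k
        using subsetD[OF mono[of k] pt_in_cell] by (simp add: add.commute)
      have "\<iota> \<xi> \<in> wm (x n) ` K"
        by (rule closed_sequentially[OF compact_imp_closed[OF compact_cell[OF level_bounds(1)[OF xJ]]] ptx
              LIMSEQ_ignore_initial_segment[OF xl]])
      then show "\<kappa> \<in> wm (x n) ` K" using that by simp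
    qed
  qed
  have "canonical_attractor_map V E S K ?T eH \<iota>"
    unfolding canonical_attractor_map_def
  proof (intro ballI conjI allI impI)
    fix \<xi> assume \<xi>: "\<xi> \<in> boundary_set V ?T eH"
    obtain x \<eta> where x: "geodesic_ray V E [] x" "\<eta> \<in> boundary_set V ?T eH"
      "limitin ?T (\<lambda>n. eH (x n)) \<eta> sequentially" "\<iota> \<eta> = \<iota> \<xi>"
      using ray_point[OF in_K[OF \<xi>]] by blast
    then have "\<eta> = \<xi>" using inj \<xi> by blast
    then show "\<exists>x. geodesic_ray V E [] x \<and> limitin ?T (\<lambda>n. eH (x n)) \<xi> sequentially" using x by blast
  next
    fix \<xi> x assume "geodesic_ray V E [] x \<and> limitin ?T (\<lambda>n. eH (x n)) \<xi> sequentially"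
    then show "(\<Inter>n. wm (x n) ` K) = {\<iota> \<xi>}" using cell_inter by blast
  qed
  moreover have "homeomorphic_map (boundary_space V ?T eH) (top_of_set K) \<iota>"
  proof (rule continuous_imp_homeomorphic_map)
    have ts: "topspace (boundary_space V ?T eH) = boundary_set V ?T eH"
      by (auto simp: boundary_space_def boundary_set_def)
    show "compact_space (boundary_space V ?T eH)"
      by (rule compact_space_boundary[OF H.compact_completion H.open_vertex])
    show "continuous_map (boundary_space V ?T eH) (top_of_set K) \<iota>"
      using continuous_map_from_subtopology[OF \<iota>(1), of "boundary_set V ?T eH"] in_K ts
      unfolding continuous_map_in_subtopology boundary_space_def by auto
    show "Hausdorff_space (top_of_set K)" by (intro Hausdorff_space_subtopology) simp
    show "\<iota> ` topspace (boundary_space V ?T eH) = topspace (top_of_set K)"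
      unfolding ts using in_K ray_point by fastforce
    show "inj_on \<iota> (topspace (boundary_space V ?T eH))" unfolding ts using inj by (rule inj_onI)
  qed
  ultimately show ?thesis by blast
qed

end

section \<open>Martin, hyperbolic and self-similar boundaries\<close>

theorem theorem5p1:
  fixes N :: nat and \<rho> :: "nat \<Rightarrow> real" and S :: "nat \<Rightarrow> 'a::euclidean_space \<Rightarrow> 'a"
    and Eh :: "(nat list \<times> nat list) set" and lam :: real
    and P :: "nat list \<Rightarrow> nat list \<Rightarrow> real"
    and V :: "nat list set" and E :: "(nat list \<times> nat list) set" and lev :: "nat list \<Rightarrow> nat"
  assumes ifs: "similitude_ifs N \<rho> S"
    and V: "V = tree_vertices N \<rho>" and E: "E = tree_edges N \<rho> Eh" and lev: "lev = level N \<rho>"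
    and lam: "0 < lam" "lam < 1"
    and walk: "quasi_natural_walk N \<rho> Eh lam P"
  shows
    "(pre_augmented_tree N \<rho> Eh \<and> hyperbolic V E lev \<and> bounded_degree V E \<longrightarrow>
        uniformly_irreducible V E P \<and> bounded_range V E P \<and>
        (\<exists>s<1. has_spectral_radius V P s) \<and>
        (\<forall>(TM :: 'c topology) eM. martin_compactification V (martin_kernel V P []) TM eM \<longrightarrow>
           boundary_set V TM eM = minimal_martin_boundary V P [] TM eM \<and>
           (\<forall>a (Y :: 'b set) D eH.
              admissible_exponent V E lev a \<and> hyperbolic_completion V E lev a Y D eH \<longrightarrow>
              (\<exists>\<phi>. canonical_boundary_homeomorphism V (Metric_space.mtopology Y D) eH TM eM \<phi>))))
     \<and>
     (\<forall>\<gamma>>0. \<forall>K. is_attractor N S K \<and> open_set_condition N S \<and>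
        Eh = augmented_edges N \<rho> S K \<gamma> \<longrightarrow>
        hyperbolic V E lev \<and>
        (\<forall>(TM :: 'c topology) eM a (Y :: 'b set) D eH.
           martin_compactification V (martin_kernel V P []) TM eM \<and>
           admissible_exponent V E lev a \<and> hyperbolic_completion V E lev a Y D eH \<longrightarrow>
           (\<exists>\<phi> \<iota>.
              canonical_boundary_homeomorphism V (Metric_space.mtopology Y D) eH TM eM \<phi> \<and>
              canonical_attractor_map V E S K (Metric_space.mtopology Y D) eH \<iota> \<and>
              homeomorphic_map (boundary_space V (Metric_space.mtopology Y D) eH)
                (top_of_set K) \<iota>)))"
proof -
  interpret word_tree N \<rho> using ifs by unfold_locales (auto simp: similitude_ifs_def)
  show ?thesis
  proof (intro conjI impI allI)
    assume A: "pre_augmented_tree N \<rho> Eh \<and> hyperbolic V E lev \<and> bounded_degree V E"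
    then interpret T: pre_augmented_word_tree N \<rho> Eh by unfold_locales blast
    note B = T.walk_boundary[OF lam walk, folded V E lev]
    show "uniformly_irreducible V E P" "bounded_range V E P" "\<exists>s<1. has_spectral_radius V P s"
      using B(1) A by blast+
    fix TM :: "'c topology" and eM
    assume M: "martin_compactification V (martin_kernel V P []) TM eM"
    show "boundary_set V TM eM = minimal_martin_boundary V P [] TM eM" using B(2)[OF _ _ M] A by blast
    fix a and Y :: "'b set" and D eH
    assume "admissible_exponent V E lev a \<and> hyperbolic_completion V E lev a Y D eH"
    then show "\<exists>\<phi>. canonical_boundary_homeomorphism V (Metric_space.mtopology Y D) eH TM eM \<phi>"
      using B(3)[OF _ _ M] A by blast
  next
    fix \<gamma> :: real and K :: "'a set"
    assume \<gamma>: "0 < \<gamma>" and A: "is_attractor N S K \<and> open_set_condition N S \<and> Eh = augmented_edges N \<rho> S K \<gamma>"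
    interpret T: augmented N \<rho> S K \<gamma> using \<gamma> A ifs by unfold_locales (auto simp: similitude_ifs_def)
    have Eh: "augmented_edges N \<rho> S K \<gamma> = Eh" using A by simp
    have hyp: "hyperbolic V E lev"
      using T.augmented_hyperbolic unfolding Eh V[symmetric] E[symmetric] lev[symmetric] .
    have deg: "bounded_degree V E"
      using T.augmented_bounded_degree A unfolding Eh V[symmetric] E[symmetric] lev[symmetric] by blast
    show "hyperbolic V E lev" by (rule hyp)
    fix TM :: "'c topology" and eM a and Y :: "'b set" and D eH
    assume H: "martin_compactification V (martin_kernel V P []) TM eM \<and>
      admissible_exponent V E lev a \<and> hyperbolic_completion V E lev a Y D eH"
    note boundary = T.walk_boundary(3)[OF lam, unfolded Eh, folded V E lev]
    obtain \<phi> where \<phi>: "canonical_boundary_homeomorphism V (Metric_space.mtopology Y D) eH TM eM \<phi>"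
      using boundary[OF walk deg hyp] H by blast
    obtain \<delta> where \<delta>: "hyperbolic_graph V E lev [] \<delta>"
      using T.hyperbolic_graphI[unfolded Eh, folded V E lev, OF hyp] .
    obtain C where C: "completed_graph V E lev [] \<delta> Y D eH a C"
      using T.completed_graphI[unfolded Eh, folded V E lev, OF \<delta>] H by blast
    obtain \<iota> where "canonical_attractor_map V E S K (Metric_space.mtopology Y D) eH \<iota>"
      "homeomorphic_map (boundary_space V (Metric_space.mtopology Y D) eH) (top_of_set K) \<iota>"
      using T.boundary_homeomorphic_attractor[unfolded Eh, folded V E lev, OF C] by blast
    with \<phi> show "\<exists>\<phi> \<iota>. canonical_boundary_homeomorphism V (Metric_space.mtopology Y D) eH TM eM \<phi> \<and>
        canonical_attractor_map V E S K (Metric_space.mtopology Y D) eH \<iota> \<and>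
        homeomorphic_map (boundary_space V (Metric_space.mtopology Y D) eH) (top_of_set K) \<iota>" by blast
  qed
qed

end
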